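(* Let $\mathbf C$ and $\mathbf D$ be $2$-categories, and let $L\colon\mathbf C\to\mathbf D$ be a normal pseudo-functor. Suppose that $\mathbf C$ has tensors by the category $\mathbb 2=\{0\to1\}$ and that $L$ preserves them. Then the following statements are equivalent. (i) The normal pseudo-functor $L\colon \mathbf C\to \mathbf D$ has a right bi-adjoint $R\colon \mathbf D\to \mathbf C$. (ii) For all objects $D\in \mathbf D$, there is an object $RD\in \mathbf C$ together with a morphism $\varepsilon_D\colon LRD\to D$ in $\mathbf D$ such that $(RD,\varepsilon_D)$ is bi-terminal in the pseudo-slice $2$-category $L\downarrow D$.
   Context: **$2$-categories.** $\mathbf{Cat}$ is the $2$-category of categories, functors and natural transformations; $\mathbf C^{\mathrm{op}}$ reverses morphisms but not $2$-morphisms. A normal pseudo-functor $F\colon\mathbf A\to\mathbf B$ between (strict) $2$-categories consists of an assignment on objects, functors $\mathbf A(A,A')\to\mathbf B(FA,FA')$, and invertible compositors $\phi_{a,a'}\colon (Fa')(Fa)\Rightarrow F(a'a)$ satisfying the usual naturality, associativity and unit axioms, with all unitors identities (so $F\mathrm{id}_A=\mathrm{id}_{FA}$). **Bi-adjunction.** A bi-adjunction between $\mathbf C$ and $\mathbf D$ comprises normal pseudo-functors $L\colon\mathbf C\to\mathbf D$ and $R\colon\mathbf D\to\mathbf C$, and adjoint equivalences of categories $\Phi_{C,D}\colon\mathbf C(C,RD)\to\mathbf D(LC,D)$ pseudo-natural in $C\in\mathbf C^{\mathrm{op}}$ and $D\in\mathbf D$. In that case $R$ is called a right bi-adjoint of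 $L$. **Tensors.** A tensor of an object $C\in\mathbf C$ by a category $\mathcal A$ is a pair $(C\otimes\mathcal A,\zeta)$ of an object $C\otimes\mathcal A\in\mathbf C$ and a functor $\zeta\colon\mathcal A\to\mathbf C(C,C\otimes\mathcal A)$ such that for every $C'\in\mathbf C$ the functor $\mathbf C(C\otimes\mathcal A,C')\to\mathbf{Cat}(\mathcal A,\mathbf C(C,C'))$, $h\mapsto (h\circ-)\circ\zeta$, is an isomorphism of categories. $\mathbf C$ has tensors by $\mathcal A$ if every object has one. $L$ preserves tensors by $\mathbb 2$ if for every object $C\in\mathbf C$ there is a tensor of $LC$ by $\mathbb 2$ in $\mathbf D$ and an isomorphism $L(C\otimes\mathbb 2)\cong(LC)\otimes\mathbb 2$ in $\mathbf D$ natural with respect to the defining cones (i.e. compatible with the functor $\mathbb 2\xrightarrow{\zeta}\mathbf C(C,C\otimes\mathbb 2)\xrightarrow{L}\mathbf D(LC,L(C\otimes\mathbb 2))$ and the structure functor of $(LC)\otimes\mathbb 2$). **Pseudo-slice $2$-category $L\downarrow D$**: objects $(C,f\colon LC\to D)$; morphisms $(C,f)\to(C',f')$ pairs $(c,\psi)$ of $c\colon C\to C'$ and an invertible $\psi\colon f'(Lc)\Rightarrow f$ (composed using the compositors of $L$); $2$-morphisms $(c,\psi)\Rightarrow(d,\varphi)$ the $\beta\colon c\Rightarrow d$ with $\varphi\circ(f'\,L\beta)=\psi$. **Bi-initial and bi-terminal objects.** For an object $I$ of a $2$-category $\mathbf A$, the pseudo-slice $I\downarrow\mathbf A$ has objects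 $(A,f\colon I\to A)$; morphisms $(A,f)\to(A',f')$ pairs $(a,\psi)$ of $a\colon A\to A'$ and an invertible $\psi\colon f'\Rightarrow af$; $2$-morphisms $(a,\psi)\Rightarrow(b,\varphi)$ the $\beta\colon a\Rightarrow b$ with $(\beta f)\circ\psi=\varphi$. A $2$-functor is a trivial fibration if it is surjective on objects, full on morphisms (every morphism $FA\to FA'$ is the image of some morphism $A\to A'$) and fully faithful on $2$-morphisms. $I$ is bi-initial if the projection $I\downarrow\mathbf A\to\mathbf A$ is a trivial fibration, and bi-terminal in $\mathbf A$ if it is bi-initial in $\mathbf A^{\mathrm{op}}$. *)

theory Defs
  imports "HOL-Library.FuncSet"
begin

section \<open>Categories, functors, natural transformations\<close>

record ('o, 'm) cat =
  Obj :: "'o set"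
  Arr :: "'m set"
  Dom :: "'m \<Rightarrow> 'o"
  Cod :: "'m \<Rightarrow> 'o"
  Ident :: "'o \<Rightarrow> 'm"
  Comp :: "'m \<Rightarrow> 'm \<Rightarrow> 'm"  (infixl "\<cdot>\<index>" 70)

definition arrows :: "('o, 'm) cat \<Rightarrow> 'o \<Rightarrow> 'o \<Rightarrow> 'm set" where
  "arrows K x y = {a \<in> Arr K. Dom K a = x \<and> Cod K a = y}"

locale category =
  fixes K :: "('o, 'm) cat" (structure)
  assumes Dom_in: "a \<in> Arr K \<Longrightarrow> Dom K a \<in> Obj K"
    and Cod_in: "a \<in> Arr K \<Longrightarrow> Cod K a \<in> Obj K"
    and Ident_in: "x \<in> Obj K \<Longrightarrow> Ident K x \<in> arrows K x x"
    and Comp_in: "\<lbrakk>a \<in> arrows K x y; b \<in> arrows K y z\<rbrakk> \<Longrightarrow> b \<cdot> a \<in> arrows K x z"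
    and Ident_left: "a \<in> arrows K x y \<Longrightarrow> Ident K y \<cdot> a = a"
    and Ident_right: "a \<in> arrows K x y \<Longrightarrow> a \<cdot> Ident K x = a"
    and Comp_assoc: "\<lbrakk>a \<in> arrows K w x; b \<in> arrows K x y; c \<in> arrows K y z\<rbrakk>
        \<Longrightarrow> (c \<cdot> b) \<cdot> a = c \<cdot> (b \<cdot> a)"

definition is_inverse :: "('o, 'm) cat \<Rightarrow> 'm \<Rightarrow> 'm \<Rightarrow> bool" where
  "is_inverse K a b \<longleftrightarrow> a \<in> Arr K \<and> b \<in> arrows K (Cod K a) (Dom K a)
     \<and> b \<cdot>\<^bsub>K\<^esub> a = Ident K (Dom K a) \<and> a \<cdot>\<^bsub>K\<^esub> b = Ident K (Cod K a)"

definition is_iso :: "('o, 'm) cat \<Rightarrow> 'm \<Rightarrow> bool" where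
  "is_iso K a \<longleftrightarrow> (\<exists>b. is_inverse K a b)"

definition the_inverse :: "('o, 'm) cat \<Rightarrow> 'm \<Rightarrow> 'm" where
  "the_inverse K a = (THE b. is_inverse K a b)"

record ('a, 'b, 'x, 'y) fun_data =
  fob :: "'a \<Rightarrow> 'x"
  far :: "'b \<Rightarrow> 'y"

locale cat_functor =
  fixes A :: "('a, 'b) cat" and B :: "('x, 'y) cat" and F :: "('a, 'b, 'x, 'y) fun_data"
  assumes dom_category: "category A" and cod_category: "category B"
    and fob_in: "x \<in> Obj A \<Longrightarrow> fob F x \<in> Obj B"
    and far_in: "a \<in> arrows A x y \<Longrightarrow> far F a \<in> arrows B (fob F x) (fob F y)"
    and far_Ident: "x \<in> Obj A \<Longrightarrow> far F (Ident A x) = Ident B (fob F x)"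
    and far_Comp: "\<lbrakk>a \<in> arrows A x y; b \<in> arrows A y z\<rbrakk>
        \<Longrightarrow> far F (b \<cdot>\<^bsub>A\<^esub> a) = far F b \<cdot>\<^bsub>B\<^esub> far F a"

definition fun_id :: "('a, 'b, 'a, 'b) fun_data" where
  "fun_id = \<lparr>fob = (\<lambda>x. x), far = (\<lambda>a. a)\<rparr>"

definition fun_comp ::
    "('x, 'y, 'u, 'v) fun_data \<Rightarrow> ('a, 'b, 'x, 'y) fun_data \<Rightarrow> ('a, 'b, 'u, 'v) fun_data" where
  "fun_comp G F = \<lparr>fob = fob G \<circ> fob F, far = far G \<circ> far F\<rparr>"

locale nat_trans =
  dom_fun: cat_functor A B F + cod_fun: cat_functor A B G
  for A :: "('a, 'b) cat" and B :: "('x, 'y) cat" and F G +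
  fixes \<alpha> :: "'a \<Rightarrow> 'y"
  assumes component_in: "x \<in> Obj A \<Longrightarrow> \<alpha> x \<in> arrows B (fob F x) (fob G x)"
    and naturality: "a \<in> arrows A x y \<Longrightarrow> far G a \<cdot>\<^bsub>B\<^esub> \<alpha> x = \<alpha> y \<cdot>\<^bsub>B\<^esub> far F a"

locale nat_iso = nat_trans +
  assumes component_iso: "x \<in> Obj A \<Longrightarrow> is_iso B (\<alpha> x)"

definition iso_of_categories ::
    "('a, 'b) cat \<Rightarrow> ('x, 'y) cat \<Rightarrow> ('a, 'b, 'x, 'y) fun_data \<Rightarrow> bool" where
  "iso_of_categories A B F \<longleftrightarrow> cat_functor A B F \<and>
     (\<exists>G. cat_functor B A G
        \<and> (\<forall>x \<in> Obj A. fob G (fob F x) = x) \<and> (\<forall>a \<in> Arr A. far G (far F a) = a)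
        \<and> (\<forall>x \<in> Obj B. fob F (fob G x) = x) \<and> (\<forall>a \<in> Arr B. far F (far G a) = a))"

locale adjoint_equivalence =
  left: cat_functor A B F + right: cat_functor B A G +
  unit: nat_iso A A fun_id "fun_comp G F" \<eta> +
  counit: nat_iso B B "fun_comp F G" fun_id \<epsilon>
  for A :: "('a, 'b) cat" and B :: "('x, 'y) cat" and F G \<eta> \<epsilon> +
  assumes triangle_left: "x \<in> Obj A \<Longrightarrow> \<epsilon> (fob F x) \<cdot>\<^bsub>B\<^esub> far F (\<eta> x) = Ident B (fob F x)"
    and triangle_right: "y \<in> Obj B \<Longrightarrow> far G (\<epsilon> y) \<cdot>\<^bsub>A\<^esub> \<eta> (fob G y) = Ident A (fob G y)"

text \<open>
  The functor category \<open>Cat(A, B)\<close>.  Its objects are functors and its arrows natural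
  transformations together with their source and target; all are required to be \<open>undefined\<close>
  outside the carriers of \<open>A\<close>, so that equality in HOL is equality of functors, respectively of
  natural transformations.
\<close>

definition functor_cat :: "('a, 'b) cat \<Rightarrow> ('x, 'y) cat \<Rightarrow>
    (('a, 'b, 'x, 'y) fun_data,
     ('a, 'b, 'x, 'y) fun_data \<times> ('a, 'b, 'x, 'y) fun_data \<times> ('a \<Rightarrow> 'y)) cat" where
  "functor_cat A B =
    (let Fs = {F. cat_functor A B F \<and> fob F \<in> extensional (Obj A) \<and> far F \<in> extensional (Arr A)}
     in \<lparr>Obj = Fs,
         Arr = {(F, G, \<alpha>). F \<in> Fs \<and> G \<in> Fs \<and> nat_trans A B F G \<alpha> \<and> \<alpha> \<in> extensional (Obj A)},
         Dom = (\<lambda>(F, G, \<alpha>). F),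
         Cod = (\<lambda>(F, G, \<alpha>). G),
         Ident = (\<lambda>F. (F, F, \<lambda>x \<in> Obj A. Ident B (fob F x))),
         Comp = (\<lambda>(G', H, \<beta>) (F, G, \<alpha>). (F, H, \<lambda>x \<in> Obj A. \<beta> x \<cdot>\<^bsub>B\<^esub> \<alpha> x))\<rparr>)"

text \<open>The category \<open>\<two> = {0 \<rightarrow> 1}\<close>, as the poset \<open>False \<le> True\<close>.\<close>

definition walking_arrow :: "(bool, bool \<times> bool) cat" where
  "walking_arrow = \<lparr>Obj = UNIV, Arr = {(i, j). i \<le> j}, Dom = fst, Cod = snd,
     Ident = (\<lambda>i. (i, i)), Comp = (\<lambda>(j', k) (i, j). (i, k))\<rparr>"


section \<open>Strict 2-categories\<close>

record ('o, 'm, 'c) twocat =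
  Ob :: "'o set"
  Mor :: "'m set"
  Cell :: "'c set"
  src :: "'m \<Rightarrow> 'o"
  tgt :: "'m \<Rightarrow> 'o"
  dom2 :: "'c \<Rightarrow> 'm"
  cod2 :: "'c \<Rightarrow> 'm"
  id1 :: "'o \<Rightarrow> 'm"
  id2 :: "'m \<Rightarrow> 'c"
  comp1 :: "'m \<Rightarrow> 'm \<Rightarrow> 'm"  (infixl "\<odot>\<index>" 75)
  vcomp :: "'c \<Rightarrow> 'c \<Rightarrow> 'c"  (infixl "\<bullet>\<index>" 70)
  hcomp :: "'c \<Rightarrow> 'c \<Rightarrow> 'c"  (infixl "\<star>\<index>" 75)

definition hom1 :: "('o, 'm, 'c) twocat \<Rightarrow> 'o \<Rightarrow> 'o \<Rightarrow> 'm set" where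
  "hom1 C X Y = {f \<in> Mor C. src C f = X \<and> tgt C f = Y}"

definition hom2 :: "('o, 'm, 'c) twocat \<Rightarrow> 'm \<Rightarrow> 'm \<Rightarrow> 'c set" where
  "hom2 C f g = {\<alpha> \<in> Cell C. dom2 C \<alpha> = f \<and> cod2 C \<alpha> = g}"

definition cat1 :: "('o, 'm, 'c) twocat \<Rightarrow> ('o, 'm) cat" where
  "cat1 C = \<lparr>Obj = Ob C, Arr = Mor C, Dom = src C, Cod = tgt C, Ident = id1 C, Comp = comp1 C\<rparr>"

definition cat2 :: "('o, 'm, 'c) twocat \<Rightarrow> ('m, 'c) cat" where
  "cat2 C = \<lparr>Obj = Mor C, Arr = Cell C, Dom = dom2 C, Cod = cod2 C,
     Ident = id2 C, Comp = vcomp C\<rparr>"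

definition hom_cat :: "('o, 'm, 'c) twocat \<Rightarrow> 'o \<Rightarrow> 'o \<Rightarrow> ('m, 'c) cat" where
  "hom_cat C X Y = \<lparr>Obj = hom1 C X Y,
     Arr = {\<alpha> \<in> Cell C. dom2 C \<alpha> \<in> hom1 C X Y \<and> cod2 C \<alpha> \<in> hom1 C X Y},
     Dom = dom2 C, Cod = cod2 C, Ident = id2 C, Comp = vcomp C\<rparr>"

locale two_category =
  fixes C :: "('o, 'm, 'c) twocat" (structure)
  assumes category_cat1: "category (cat1 C)"
    and category_cat2: "category (cat2 C)"
    and globular: "\<alpha> \<in> Cell C \<Longrightarrow>
        src C (dom2 C \<alpha>) = src C (cod2 C \<alpha>) \<and> tgt C (dom2 C \<alpha>) = tgt C (cod2 C \<alpha>)"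
    and hcomp_in: "\<lbrakk>f \<in> hom1 C X Y; g \<in> hom1 C Y Z; \<alpha> \<in> hom2 C f f'; \<beta> \<in> hom2 C g g'\<rbrakk>
        \<Longrightarrow> \<beta> \<star> \<alpha> \<in> hom2 C (g \<odot> f) (g' \<odot> f')"
    and hcomp_id2: "\<lbrakk>f \<in> hom1 C X Y; g \<in> hom1 C Y Z\<rbrakk>
        \<Longrightarrow> id2 C g \<star> id2 C f = id2 C (g \<odot> f)"
    and interchange: "\<lbrakk>f \<in> hom1 C X Y; g \<in> hom1 C Y Z;
        \<alpha> \<in> hom2 C f f'; \<alpha>' \<in> hom2 C f' f''; \<beta> \<in> hom2 C g g'; \<beta>' \<in> hom2 C g' g''\<rbrakk>
        \<Longrightarrow> (\<beta>' \<bullet> \<beta>) \<star> (\<alpha>' \<bullet> \<alpha>) = (\<beta>' \<star> \<alpha>') \<bullet> (\<beta> \<star> \<alpha>)"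
    and hcomp_unit_left: "\<lbrakk>f \<in> hom1 C X Y; \<alpha> \<in> hom2 C f f'\<rbrakk>
        \<Longrightarrow> id2 C (id1 C Y) \<star> \<alpha> = \<alpha>"
    and hcomp_unit_right: "\<lbrakk>f \<in> hom1 C X Y; \<alpha> \<in> hom2 C f f'\<rbrakk>
        \<Longrightarrow> \<alpha> \<star> id2 C (id1 C X) = \<alpha>"
    and hcomp_assoc: "\<lbrakk>f \<in> hom1 C W X; g \<in> hom1 C X Y; h \<in> hom1 C Y Z;
        \<alpha> \<in> hom2 C f f'; \<beta> \<in> hom2 C g g'; \<gamma> \<in> hom2 C h h'\<rbrakk>
        \<Longrightarrow> (\<gamma> \<star> \<beta>) \<star> \<alpha> = \<gamma> \<star> (\<beta> \<star> \<alpha>)"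

definition op2 :: "('o, 'm, 'c) twocat \<Rightarrow> ('o, 'm, 'c) twocat" where
  "op2 C = \<lparr>Ob = Ob C, Mor = Mor C, Cell = Cell C, src = tgt C, tgt = src C,
     dom2 = dom2 C, cod2 = cod2 C, id1 = id1 C, id2 = id2 C,
     comp1 = (\<lambda>g f. f \<odot>\<^bsub>C\<^esub> g), vcomp = vcomp C, hcomp = (\<lambda>\<beta> \<alpha>. \<alpha> \<star>\<^bsub>C\<^esub> \<beta>)\<rparr>"

definition prod2 :: "('o, 'm, 'c) twocat \<Rightarrow> ('o', 'm', 'c') twocat
    \<Rightarrow> ('o \<times> 'o', 'm \<times> 'm', 'c \<times> 'c') twocat" where
  "prod2 C D = \<lparr>Ob = Ob C \<times> Ob D, Mor = Mor C \<times> Mor D, Cell = Cell C \<times> Cell D,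
     src = map_prod (src C) (src D), tgt = map_prod (tgt C) (tgt D),
     dom2 = map_prod (dom2 C) (dom2 D), cod2 = map_prod (cod2 C) (cod2 D),
     id1 = map_prod (id1 C) (id1 D), id2 = map_prod (id2 C) (id2 D),
     comp1 = (\<lambda>(g, g') (f, f'). (g \<odot>\<^bsub>C\<^esub> f, g' \<odot>\<^bsub>D\<^esub> f')),
     vcomp = (\<lambda>(\<beta>, \<beta>') (\<alpha>, \<alpha>'). (\<beta> \<bullet>\<^bsub>C\<^esub> \<alpha>, \<beta>' \<bullet>\<^bsub>D\<^esub> \<alpha>')),
     hcomp = (\<lambda>(\<beta>, \<beta>') (\<alpha>, \<alpha>'). (\<beta> \<star>\<^bsub>C\<^esub> \<alpha>, \<beta>' \<star>\<^bsub>D\<^esub> \<alpha>'))\<rparr>"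


section \<open>Normal pseudo-functors\<close>

text \<open>\<open>cpt F a a'\<close> is the compositor \<open>(F a')(F a) \<Rightarrow> F(a' a)\<close>.\<close>

record ('o, 'm, 'c, 'o', 'm', 'c') psfun =
  ap0 :: "'o \<Rightarrow> 'o'"
  ap1 :: "'m \<Rightarrow> 'm'"
  ap2 :: "'c \<Rightarrow> 'c'"
  cpt :: "'m \<Rightarrow> 'm \<Rightarrow> 'c'"

locale normal_pseudo_functor =
  fixes A :: "('o, 'm, 'c) twocat" and B :: "('o', 'm', 'c') twocat"
    and F :: "('o, 'm, 'c, 'o', 'm', 'c') psfun"
  assumes dom_two_category: "two_category A" and cod_two_category: "two_category B"
    and ap0_in: "X \<in> Ob A \<Longrightarrow> ap0 F X \<in> Ob B"
    and local_functor: "\<lbrakk>X \<in> Ob A; Y \<in> Ob A\<rbrakk> \<Longrightarrow>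
        cat_functor (hom_cat A X Y) (hom_cat B (ap0 F X) (ap0 F Y)) \<lparr>fob = ap1 F, far = ap2 F\<rparr>"
    and ap1_id1: "X \<in> Ob A \<Longrightarrow> ap1 F (id1 A X) = id1 B (ap0 F X)"
    and cpt_in: "\<lbrakk>a \<in> hom1 A X Y; a' \<in> hom1 A Y Z\<rbrakk> \<Longrightarrow>
        cpt F a a' \<in> hom2 B (ap1 F a' \<odot>\<^bsub>B\<^esub> ap1 F a) (ap1 F (a' \<odot>\<^bsub>A\<^esub> a))"
    and cpt_iso: "\<lbrakk>a \<in> hom1 A X Y; a' \<in> hom1 A Y Z\<rbrakk> \<Longrightarrow> is_iso (cat2 B) (cpt F a a')"
    and cpt_natural: "\<lbrakk>a \<in> hom1 A X Y; a' \<in> hom1 A Y Z;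
        \<alpha> \<in> hom2 A a b; \<alpha>' \<in> hom2 A a' b'\<rbrakk> \<Longrightarrow>
        cpt F b b' \<bullet>\<^bsub>B\<^esub> (ap2 F \<alpha>' \<star>\<^bsub>B\<^esub> ap2 F \<alpha>) = ap2 F (\<alpha>' \<star>\<^bsub>A\<^esub> \<alpha>) \<bullet>\<^bsub>B\<^esub> cpt F a a'"
    and cpt_assoc: "\<lbrakk>a \<in> hom1 A W X; a' \<in> hom1 A X Y; a'' \<in> hom1 A Y Z\<rbrakk> \<Longrightarrow>
        cpt F a (a'' \<odot>\<^bsub>A\<^esub> a') \<bullet>\<^bsub>B\<^esub> (cpt F a' a'' \<star>\<^bsub>B\<^esub> id2 B (ap1 F a))
        = cpt F (a' \<odot>\<^bsub>A\<^esub> a) a'' \<bullet>\<^bsub>B\<^esub> (id2 B (ap1 F a'') \<star>\<^bsub>B\<^esub> cpt F a a')"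
    and cpt_unit_left: "a \<in> hom1 A X Y \<Longrightarrow> cpt F a (id1 A Y) = id2 B (ap1 F a)"
    and cpt_unit_right: "a \<in> hom1 A X Y \<Longrightarrow> cpt F (id1 A X) a = id2 B (ap1 F a)"

text \<open>
  Normal pseudo-functors \<open>A \<rightarrow> Cat\<close>, with the axioms of \<open>normal_pseudo_functor\<close> written out
  for the 2-category \<open>Cat\<close>: 2-cells of \<open>Cat\<close> are given by their components.  This is kept separate
  from \<open>normal_pseudo_functor\<close> because a bi-adjunction compares pseudo-functors whose values are
  categories carried by different HOL types, so that no single 2-category \<open>Cat\<close> contains both.
\<close>

record ('o, 'm, 'c, 'x, 'y) catfun =
  at_ob :: "'o \<Rightarrow> ('x, 'y) cat"
  at_mor :: "'m \<Rightarrow> ('x, 'y, 'x, 'y) fun_data"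
  at_cell :: "'c \<Rightarrow> 'x \<Rightarrow> 'y"
  at_cpt :: "'m \<Rightarrow> 'm \<Rightarrow> 'x \<Rightarrow> 'y"

locale cat_valued_pseudo_functor =
  fixes A :: "('o, 'm, 'c) twocat" and P :: "('o, 'm, 'c, 'x, 'y) catfun"
  assumes dom_two_category: "two_category A"
    and at_ob: "X \<in> Ob A \<Longrightarrow> category (at_ob P X)"
    and at_mor: "a \<in> hom1 A X Y \<Longrightarrow> cat_functor (at_ob P X) (at_ob P Y) (at_mor P a)"
    and at_cell: "\<lbrakk>a \<in> hom1 A X Y; \<alpha> \<in> hom2 A a b\<rbrakk> \<Longrightarrow>
        nat_trans (at_ob P X) (at_ob P Y) (at_mor P a) (at_mor P b) (at_cell P \<alpha>)"
    and at_cell_id2: "\<lbrakk>a \<in> hom1 A X Y; x \<in> Obj (at_ob P X)\<rbrakk> \<Longrightarrow>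
        at_cell P (id2 A a) x = Ident (at_ob P Y) (fob (at_mor P a) x)"
    and at_cell_vcomp: "\<lbrakk>a \<in> hom1 A X Y; \<alpha> \<in> hom2 A a b; \<beta> \<in> hom2 A b c; x \<in> Obj (at_ob P X)\<rbrakk> \<Longrightarrow>
        at_cell P (\<beta> \<bullet>\<^bsub>A\<^esub> \<alpha>) x = at_cell P \<beta> x \<cdot>\<^bsub>at_ob P Y\<^esub> at_cell P \<alpha> x"
    and at_mor_id1_fob: "\<lbrakk>X \<in> Ob A; x \<in> Obj (at_ob P X)\<rbrakk> \<Longrightarrow> fob (at_mor P (id1 A X)) x = x"
    and at_mor_id1_far: "\<lbrakk>X \<in> Ob A; u \<in> Arr (at_ob P X)\<rbrakk> \<Longrightarrow> far (at_mor P (id1 A X)) u = u"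
    and at_cpt_iso: "\<lbrakk>a \<in> hom1 A X Y; a' \<in> hom1 A Y Z\<rbrakk> \<Longrightarrow>
        nat_iso (at_ob P X) (at_ob P Z) (fun_comp (at_mor P a') (at_mor P a))
          (at_mor P (a' \<odot>\<^bsub>A\<^esub> a)) (at_cpt P a a')"
    and at_cpt_natural: "\<lbrakk>a \<in> hom1 A X Y; a' \<in> hom1 A Y Z; \<alpha> \<in> hom2 A a b; \<alpha>' \<in> hom2 A a' b';
        x \<in> Obj (at_ob P X)\<rbrakk> \<Longrightarrow>
        at_cpt P b b' x \<cdot>\<^bsub>at_ob P Z\<^esub>
          (at_cell P \<alpha>' (fob (at_mor P b) x) \<cdot>\<^bsub>at_ob P Z\<^esub> far (at_mor P a') (at_cell P \<alpha> x))
        = at_cell P (\<alpha>' \<star>\<^bsub>A\<^esub> \<alpha>) x \<cdot>\<^bsub>at_ob P Z\<^esub> at_cpt P a a' x"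
    and at_cpt_assoc: "\<lbrakk>a \<in> hom1 A W X; a' \<in> hom1 A X Y; a'' \<in> hom1 A Y Z; x \<in> Obj (at_ob P W)\<rbrakk> \<Longrightarrow>
        at_cpt P a (a'' \<odot>\<^bsub>A\<^esub> a') x \<cdot>\<^bsub>at_ob P Z\<^esub> at_cpt P a' a'' (fob (at_mor P a) x)
        = at_cpt P (a' \<odot>\<^bsub>A\<^esub> a) a'' x \<cdot>\<^bsub>at_ob P Z\<^esub> far (at_mor P a'') (at_cpt P a a' x)"
    and at_cpt_unit_left: "\<lbrakk>a \<in> hom1 A X Y; x \<in> Obj (at_ob P X)\<rbrakk> \<Longrightarrow>
        at_cpt P a (id1 A Y) x = Ident (at_ob P Y) (fob (at_mor P a) x)"
    and at_cpt_unit_right: "\<lbrakk>a \<in> hom1 A X Y; x \<in> Obj (at_ob P X)\<rbrakk> \<Longrightarrow>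
        at_cpt P (id1 A X) a x = Ident (at_ob P Y) (fob (at_mor P a) x)"

text \<open>
  Pseudo-natural transformations \<open>P \<Rightarrow> Q\<close> of normal pseudo-functors \<open>A \<rightarrow> Cat\<close>: components are
  functors \<open>\<Phi> X : P X \<rightarrow> Q X\<close>, and \<open>\<theta> a\<close> is the invertible 2-cell \<open>(Q a)(\<Phi> X) \<Rightarrow> (\<Phi> Y)(P a)\<close> of
  \<open>Cat\<close> for \<open>a : X \<rightarrow> Y\<close>.
\<close>

locale pseudo_natural =
  source: cat_valued_pseudo_functor A P + target: cat_valued_pseudo_functor A Q
  for A :: "('o, 'm, 'c) twocat" and P :: "('o, 'm, 'c, 'x, 'y) catfun"
    and Q :: "('o, 'm, 'c, 'u, 'v) catfun" +
  fixes \<Phi> :: "'o \<Rightarrow> ('x, 'y, 'u, 'v) fun_data" and \<theta> :: "'m \<Rightarrow> 'x \<Rightarrow> 'v"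
  assumes component: "X \<in> Ob A \<Longrightarrow> cat_functor (at_ob P X) (at_ob Q X) (\<Phi> X)"
    and constraint: "a \<in> hom1 A X Y \<Longrightarrow>
        nat_iso (at_ob P X) (at_ob Q Y) (fun_comp (at_mor Q a) (\<Phi> X)) (fun_comp (\<Phi> Y) (at_mor P a)) (\<theta> a)"
    and constraint_natural: "\<lbrakk>a \<in> hom1 A X Y; \<alpha> \<in> hom2 A a b; x \<in> Obj (at_ob P X)\<rbrakk> \<Longrightarrow>
        \<theta> b x \<cdot>\<^bsub>at_ob Q Y\<^esub> at_cell Q \<alpha> (fob (\<Phi> X) x)
        = far (\<Phi> Y) (at_cell P \<alpha> x) \<cdot>\<^bsub>at_ob Q Y\<^esub> \<theta> a x"
    and constraint_id1: "\<lbrakk>X \<in> Ob A; x \<in> Obj (at_ob P X)\<rbrakk> \<Longrightarrow>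
        \<theta> (id1 A X) x = Ident (at_ob Q X) (fob (\<Phi> X) x)"
    and constraint_comp1: "\<lbrakk>a \<in> hom1 A X Y; a' \<in> hom1 A Y Z; x \<in> Obj (at_ob P X)\<rbrakk> \<Longrightarrow>
        \<theta> (a' \<odot>\<^bsub>A\<^esub> a) x \<cdot>\<^bsub>at_ob Q Z\<^esub> at_cpt Q a a' (fob (\<Phi> X) x)
        = far (\<Phi> Z) (at_cpt P a a' x) \<cdot>\<^bsub>at_ob Q Z\<^esub>
            (\<theta> a' (fob (at_mor P a) x) \<cdot>\<^bsub>at_ob Q Z\<^esub> far (at_mor Q a') (\<theta> a x))"


section \<open>Bi-adjunctions\<close>

text \<open>The pseudo-functors \<open>C(-, R -)\<close> and \<open>D(L -, -)\<close> from \<open>C\<^sup>o\<^sup>p \<times> D\<close> to \<open>Cat\<close>.\<close>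

definition hom_right :: "('o, 'm, 'c) twocat \<Rightarrow> ('p, 'n, 'd, 'o, 'm, 'c) psfun
    \<Rightarrow> ('o \<times> 'p, 'm \<times> 'n, 'c \<times> 'd, 'm, 'c) catfun" where
  "hom_right C R =
    \<lparr>at_ob = (\<lambda>(X, Y). hom_cat C X (ap0 R Y)),
     at_mor = (\<lambda>(c, d). \<lparr>fob = (\<lambda>g. ap1 R d \<odot>\<^bsub>C\<^esub> (g \<odot>\<^bsub>C\<^esub> c)),
                         far = (\<lambda>\<alpha>. id2 C (ap1 R d) \<star>\<^bsub>C\<^esub> (\<alpha> \<star>\<^bsub>C\<^esub> id2 C c))\<rparr>),
     at_cell = (\<lambda>(\<gamma>, \<delta>) g. ap2 R \<delta> \<star>\<^bsub>C\<^esub> (id2 C g \<star>\<^bsub>C\<^esub> \<gamma>)),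
     at_cpt = (\<lambda>(c, d) (c', d') g. cpt R d d' \<star>\<^bsub>C\<^esub> (id2 C g \<star>\<^bsub>C\<^esub> id2 C (c \<odot>\<^bsub>C\<^esub> c')))\<rparr>"

definition hom_left :: "('p, 'n, 'd) twocat \<Rightarrow> ('o, 'm, 'c, 'p, 'n, 'd) psfun
    \<Rightarrow> ('o \<times> 'p, 'm \<times> 'n, 'c \<times> 'd, 'n, 'd) catfun" where
  "hom_left D L =
    \<lparr>at_ob = (\<lambda>(X, Y). hom_cat D (ap0 L X) Y),
     at_mor = (\<lambda>(c, d). \<lparr>fob = (\<lambda>h. d \<odot>\<^bsub>D\<^esub> (h \<odot>\<^bsub>D\<^esub> ap1 L c)),
                         far = (\<lambda>\<alpha>. id2 D d \<star>\<^bsub>D\<^esub> (\<alpha> \<star>\<^bsub>D\<^esub> id2 D (ap1 L c)))\<rparr>),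
     at_cell = (\<lambda>(\<gamma>, \<delta>) h. \<delta> \<star>\<^bsub>D\<^esub> (id2 D h \<star>\<^bsub>D\<^esub> ap2 L \<gamma>)),
     at_cpt = (\<lambda>(c, d) (c', d') h. id2 D (d' \<odot>\<^bsub>D\<^esub> d) \<star>\<^bsub>D\<^esub> (id2 D h \<star>\<^bsub>D\<^esub> cpt L c' c))\<rparr>"

locale bi_adjunction =
  left_psfun: normal_pseudo_functor C D L +
  right_psfun: normal_pseudo_functor D C R +
  pseudo_natural "prod2 (op2 C) D" "hom_right C R" "hom_left D L" \<Phi> \<theta>
  for C :: "('o, 'm, 'c) twocat" and D :: "('p, 'n, 'd) twocat" and L R \<Phi> \<theta> +
  fixes \<Psi> :: "'o \<times> 'p \<Rightarrow> ('n, 'd, 'm, 'c) fun_data"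
    and \<eta> :: "'o \<times> 'p \<Rightarrow> 'm \<Rightarrow> 'c" and \<epsilon> :: "'o \<times> 'p \<Rightarrow> 'n \<Rightarrow> 'd"
  assumes component_equivalence: "\<lbrakk>X \<in> Ob C; Y \<in> Ob D\<rbrakk> \<Longrightarrow>
      adjoint_equivalence (hom_cat C X (ap0 R Y)) (hom_cat D (ap0 L X) Y)
        (\<Phi> (X, Y)) (\<Psi> (X, Y)) (\<eta> (X, Y)) (\<epsilon> (X, Y))"

definition right_bi_adjoint :: "('o, 'm, 'c) twocat \<Rightarrow> ('p, 'n, 'd) twocat \<Rightarrow>
    ('o, 'm, 'c, 'p, 'n, 'd) psfun \<Rightarrow> ('p, 'n, 'd, 'o, 'm, 'c) psfun \<Rightarrow> bool" where
  "right_bi_adjoint C D L R \<longleftrightarrow> (\<exists>\<Phi> \<theta> \<Psi> \<eta> \<epsilon>. bi_adjunction C D L R \<Phi> \<theta> \<Psi> \<eta> \<epsilon>)"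


section \<open>Tensors\<close>

text \<open>The functor \<open>C(T, Y) \<rightarrow> Cat(A, C(X, Y))\<close>, \<open>h \<mapsto> (h \<circ> -) \<circ> \<zeta>\<close>.\<close>

definition tensor_comparison :: "('o, 'm, 'c) twocat \<Rightarrow> ('a, 'b) cat \<Rightarrow> ('a, 'b, 'm, 'c) fun_data \<Rightarrow>
    ('m, 'c, ('a, 'b, 'm, 'c) fun_data,
     ('a, 'b, 'm, 'c) fun_data \<times> ('a, 'b, 'm, 'c) fun_data \<times> ('a \<Rightarrow> 'c)) fun_data" where
  "tensor_comparison C A \<zeta> =
    (let K = (\<lambda>h. \<lparr>fob = (\<lambda>x \<in> Obj A. h \<odot>\<^bsub>C\<^esub> fob \<zeta> x), far = (\<lambda>u \<in> Arr A. id2 C h \<star>\<^bsub>C\<^esub> far \<zeta> u)\<rparr>)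
     in \<lparr>fob = K,
         far = (\<lambda>\<gamma>. (K (dom2 C \<gamma>), K (cod2 C \<gamma>), \<lambda>x \<in> Obj A. \<gamma> \<star>\<^bsub>C\<^esub> id2 C (fob \<zeta> x)))\<rparr>)"

definition is_tensor :: "('o, 'm, 'c) twocat \<Rightarrow> ('a, 'b) cat \<Rightarrow> 'o \<Rightarrow> 'o \<Rightarrow>
    ('a, 'b, 'm, 'c) fun_data \<Rightarrow> bool" where
  "is_tensor C A X T \<zeta> \<longleftrightarrow> X \<in> Ob C \<and> T \<in> Ob C \<and> cat_functor A (hom_cat C X T) \<zeta>
     \<and> (\<forall>Y \<in> Ob C. iso_of_categories (hom_cat C T Y) (functor_cat A (hom_cat C X Y))
          (tensor_comparison C A \<zeta>))"

definition has_tensors :: "('o, 'm, 'c) twocat \<Rightarrow> ('a, 'b) cat \<Rightarrow> bool" where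
  "has_tensors C A \<longleftrightarrow> (\<forall>X \<in> Ob C. \<exists>T \<zeta>. is_tensor C A X T \<zeta>)"

text \<open>
  A tensor of \<open>X\<close> is unique up to isomorphism, but pseudo-functors need not send isomorphisms to
  isomorphisms (only to equivalences), so preservation may depend on the tensor \<open>T\<close> of \<open>X\<close>.
  It is asked for one tensor of each object, which covers any choice of tensors.
\<close>

definition preserves_tensors :: "('o, 'm, 'c) twocat \<Rightarrow> ('p, 'n, 'd) twocat \<Rightarrow>
    ('o, 'm, 'c, 'p, 'n, 'd) psfun \<Rightarrow> ('a, 'b) cat \<Rightarrow> bool" where
  "preserves_tensors C D L A \<longleftrightarrow> (\<forall>X \<in> Ob C. \<exists>T \<zeta>. is_tensor C A X T \<zeta> \<and>
     (\<exists>S \<xi> i. is_tensor D A (ap0 L X) S \<xi> \<and> i \<in> hom1 D (ap0 L T) S \<and> is_iso (cat1 D) i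
        \<and> (\<forall>x \<in> Obj A. i \<odot>\<^bsub>D\<^esub> ap1 L (fob \<zeta> x) = fob \<xi> x)
        \<and> (\<forall>u \<in> Arr A. id2 D i \<star>\<^bsub>D\<^esub> ap2 L (far \<zeta> u) = far \<xi> u)))"


section \<open>Pseudo-slices, bi-initial and bi-terminal objects\<close>

text \<open>
  The pseudo-slice \<open>L \<down> Y\<close> is \<open>pseudo_slice C D L Y\<close> and \<open>I \<down> A\<close> is \<open>pseudo_coslice A I\<close>.  In both
  a 1-cell is recorded as \<open>(source, target, c, \<psi>)\<close> and a 2-cell as \<open>(source, target, \<beta>)\<close>, so that
  they determine their boundaries.  The 2-cell of a composite in \<open>L \<down> Y\<close> is
  \<open>f''(L(c' c)) \<cong> f''(L c')(L c) \<Rightarrow> f'(L c) \<Rightarrow> f\<close>.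
\<close>

definition pseudo_slice :: "('o, 'm, 'c) twocat \<Rightarrow> ('p, 'n, 'd) twocat \<Rightarrow>
    ('o, 'm, 'c, 'p, 'n, 'd) psfun \<Rightarrow> 'p \<Rightarrow>
    ('o \<times> 'n,
     ('o \<times> 'n) \<times> ('o \<times> 'n) \<times> 'm \<times> 'd,
     (('o \<times> 'n) \<times> ('o \<times> 'n) \<times> 'm \<times> 'd) \<times> (('o \<times> 'n) \<times> ('o \<times> 'n) \<times> 'm \<times> 'd) \<times> 'c) twocat" where
  "pseudo_slice C D L Y =
    (let Obs = {(X, f). X \<in> Ob C \<and> f \<in> hom1 D (ap0 L X) Y};
         Mors = {((X, f), (X', f'), c, \<psi>). (X, f) \<in> Obs \<and> (X', f') \<in> Obs \<and> c \<in> hom1 C X X'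
                   \<and> \<psi> \<in> hom2 D (f' \<odot>\<^bsub>D\<^esub> ap1 L c) f \<and> is_iso (cat2 D) \<psi>};
         cmp = (\<lambda>(p', (X'', f''), c', \<psi>') (p, q, c, \<psi>). (p, (X'', f''), c' \<odot>\<^bsub>C\<^esub> c,
                  \<psi> \<bullet>\<^bsub>D\<^esub> (\<psi>' \<star>\<^bsub>D\<^esub> id2 D (ap1 L c))
                    \<bullet>\<^bsub>D\<^esub> (id2 D f'' \<star>\<^bsub>D\<^esub> the_inverse (cat2 D) (cpt L c c'))))
     in \<lparr>Ob = Obs,
         Mor = Mors,
         Cell = {((p, (X', f'), c, \<psi>), (q, q', d, \<phi>), \<beta>).
                   (p, (X', f'), c, \<psi>) \<in> Mors \<and> (q, q', d, \<phi>) \<in> Mors \<and> p = q \<and> (X', f') = q'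
                   \<and> \<beta> \<in> hom2 C c d \<and> \<phi> \<bullet>\<^bsub>D\<^esub> (id2 D f' \<star>\<^bsub>D\<^esub> ap2 L \<beta>) = \<psi>},
         src = (\<lambda>(p, q, c, \<psi>). p),
         tgt = (\<lambda>(p, q, c, \<psi>). q),
         dom2 = (\<lambda>(m, n, \<beta>). m),
         cod2 = (\<lambda>(m, n, \<beta>). n),
         id1 = (\<lambda>(X, f). ((X, f), (X, f), id1 C X, id2 D f)),
         id2 = (\<lambda>(p, q, c, \<psi>). ((p, q, c, \<psi>), (p, q, c, \<psi>), id2 C c)),
         comp1 = cmp,
         vcomp = (\<lambda>(m', n', \<beta>') (m, n, \<beta>). (m, n', \<beta>' \<bullet>\<^bsub>C\<^esub> \<beta>)),
         hcomp = (\<lambda>(m', n', \<beta>') (m, n, \<beta>). (cmp m' m, cmp n' n, \<beta>' \<star>\<^bsub>C\<^esub> \<beta>))\<rparr>)"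

definition pseudo_coslice :: "('o, 'm, 'c) twocat \<Rightarrow> 'o \<Rightarrow>
    ('o \<times> 'm,
     ('o \<times> 'm) \<times> ('o \<times> 'm) \<times> 'm \<times> 'c,
     (('o \<times> 'm) \<times> ('o \<times> 'm) \<times> 'm \<times> 'c) \<times> (('o \<times> 'm) \<times> ('o \<times> 'm) \<times> 'm \<times> 'c) \<times> 'c) twocat" where
  "pseudo_coslice A I =
    (let Obs = {(X, f). X \<in> Ob A \<and> f \<in> hom1 A I X};
         Mors = {((X, f), (X', f'), a, \<psi>). (X, f) \<in> Obs \<and> (X', f') \<in> Obs \<and> a \<in> hom1 A X X'
                   \<and> \<psi> \<in> hom2 A f' (a \<odot>\<^bsub>A\<^esub> f) \<and> is_iso (cat2 A) \<psi>};
         cmp = (\<lambda>(p', q', a', \<psi>') (p, q, a, \<psi>).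
                  (p, q', a' \<odot>\<^bsub>A\<^esub> a, (id2 A a' \<star>\<^bsub>A\<^esub> \<psi>) \<bullet>\<^bsub>A\<^esub> \<psi>'))
     in \<lparr>Ob = Obs,
         Mor = Mors,
         Cell = {(((X, f), p', a, \<psi>), (q, q', b, \<phi>), \<beta>).
                   ((X, f), p', a, \<psi>) \<in> Mors \<and> (q, q', b, \<phi>) \<in> Mors \<and> (X, f) = q \<and> p' = q'
                   \<and> \<beta> \<in> hom2 A a b \<and> (\<beta> \<star>\<^bsub>A\<^esub> id2 A f) \<bullet>\<^bsub>A\<^esub> \<psi> = \<phi>},
         src = (\<lambda>(p, q, a, \<psi>). p),
         tgt = (\<lambda>(p, q, a, \<psi>). q),
         dom2 = (\<lambda>(m, n, \<beta>). m),
         cod2 = (\<lambda>(m, n, \<beta>). n),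
         id1 = (\<lambda>(X, f). ((X, f), (X, f), id1 A X, id2 A f)),
         id2 = (\<lambda>(p, q, a, \<psi>). ((p, q, a, \<psi>), (p, q, a, \<psi>), id2 A a)),
         comp1 = cmp,
         vcomp = (\<lambda>(m', n', \<beta>') (m, n, \<beta>). (m, n', \<beta>' \<bullet>\<^bsub>A\<^esub> \<beta>)),
         hcomp = (\<lambda>(m', n', \<beta>') (m, n, \<beta>). (cmp m' m, cmp n' n, \<beta>' \<star>\<^bsub>A\<^esub> \<beta>))\<rparr>)"

locale two_functor = normal_pseudo_functor +
  assumes cpt_trivial: "\<lbrakk>a \<in> hom1 A X Y; a' \<in> hom1 A Y Z\<rbrakk> \<Longrightarrow>
      cpt F a a' = id2 B (ap1 F (a' \<odot>\<^bsub>A\<^esub> a))"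

locale trivial_fibration = two_functor +
  assumes surjective_on_objects: "Y \<in> Ob B \<Longrightarrow> \<exists>X \<in> Ob A. ap0 F X = Y"
    and full_on_morphisms: "\<lbrakk>X \<in> Ob A; X' \<in> Ob A; g \<in> hom1 B (ap0 F X) (ap0 F X')\<rbrakk> \<Longrightarrow>
        \<exists>f \<in> hom1 A X X'. ap1 F f = g"
    and fully_faithful_on_cells: "\<lbrakk>f \<in> hom1 A X X'; f' \<in> hom1 A X X';
        \<beta> \<in> hom2 B (ap1 F f) (ap1 F f')\<rbrakk> \<Longrightarrow> \<exists>!\<alpha>. \<alpha> \<in> hom2 A f f' \<and> ap2 F \<alpha> = \<beta>"

definition coslice_projection :: "('o, 'm, 'c) twocat \<Rightarrow>
    ('o \<times> 'm,
     ('o \<times> 'm) \<times> ('o \<times> 'm) \<times> 'm \<times> 'c,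
     (('o \<times> 'm) \<times> ('o \<times> 'm) \<times> 'm \<times> 'c) \<times> (('o \<times> 'm) \<times> ('o \<times> 'm) \<times> 'm \<times> 'c) \<times> 'c,
     'o, 'm, 'c) psfun" where
  "coslice_projection A = \<lparr>ap0 = (\<lambda>(X, f). X), ap1 = (\<lambda>(p, q, a, \<psi>). a), ap2 = (\<lambda>(m, n, \<beta>). \<beta>),
     cpt = (\<lambda>(p, q, a, \<psi>) (p', q', a', \<psi>'). id2 A (a' \<odot>\<^bsub>A\<^esub> a))\<rparr>"

definition bi_initial :: "('o, 'm, 'c) twocat \<Rightarrow> 'o \<Rightarrow> bool" where
  "bi_initial A I \<longleftrightarrow> I \<in> Ob A \<and> trivial_fibration (pseudo_coslice A I) A (coslice_projection A)"

definition bi_terminal :: "('o, 'm, 'c) twocat \<Rightarrow> 'o \<Rightarrow> bool" where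
  "bi_terminal A T \<longleftrightarrow> bi_initial (op2 A) T"

end

theory Submission
  imports Defs
begin

text \<open>
  Let \<open>\<epsilon> : L X \<rightarrow> Y\<close> be a 1-cell of \<open>D\<close>.  Everything is expressed by the transposition functors
  \<open>C(Z, X) \<rightarrow> D(L Z, Y)\<close>, \<open>c \<mapsto> \<epsilon> (L c)\<close>, one for each object \<open>Z\<close> of \<open>C\<close>.

  An object of a 2-category is bi-initial exactly if its hom-categories are equivalent to the terminal
  category (\<open>bi_initial_iff\<close>).  In the pseudo-slice \<open>L \<down> Y\<close> this says that \<open>(X, \<epsilon>)\<close> is bi-terminal iff
  \<open>\<epsilon>\<close> is a universal arrow (\<open>bi_terminal_slice_iff\<close>): the transposition functors are essentially
  surjective, and fully faithful with respect to invertible 2-cells.  The latter restriction is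
  caused by the 2-cells in the 1-cells of a pseudo-slice, which are invertible by definition.

  A right bi-adjoint \<open>R\<close> yields universal arrows by a bicategorical Yoneda argument: for \<open>X = R Y\<close> and
  \<open>\<epsilon> = \<Phi>(id)\<close> the transposition functor is naturally isomorphic to the equivalence \<open>\<Phi>\<close>
  (\<open>universal_arrow_counit\<close>).

  The converse needs transposition to be fully faithful for all 2-cells, and this is what tensors
  provide (\<open>fully_faithful_transposition\<close>).  Let \<open>T = Z \<otimes> \<two>\<close>.  A 2-cell between 1-cells \<open>Z \<rightarrow> X\<close> is a
  1-cell \<open>T \<rightarrow> X\<close>, and because \<open>L\<close> preserves the tensor, a 2-cell between 1-cells \<open>L Z \<rightarrow> Y\<close> is a
  1-cell \<open>L T \<rightarrow> Y\<close>.  Essential surjectivity at \<open>T\<close> therefore lifts arbitrary 2-cells at \<open>Z\<close>, and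
  uniqueness of lifts of invertible 2-cells at \<open>T\<close> and \<open>Z\<close> makes these lifts unique.

  Once all transposition functors are equivalences, \<open>R\<close> is determined by choosing for each
  \<open>d : Y \<rightarrow> Y'\<close> a 1-cell \<open>R d\<close> and an isomorphism \<open>\<sigma> d : d \<epsilon> \<cong> \<epsilon>' (L (R d))\<close>.  The action of \<open>R\<close> on
  2-cells and its compositors are the unique lifts of what \<open>\<sigma>\<close> prescribes in \<open>D\<close>, and each coherence
  law for \<open>R\<close> holds because both sides have the same transpose.  The pseudo-naturality constraint of
  the equivalences is \<open>\<sigma>\<close> composed with compositors of \<open>L\<close> (\<open>right_bi_adjoint_R\<close>).
\<close>


section \<open>Isomorphisms and equivalences of categories\<close>

context category
begin

lemma arrows_Obj: "a \<in> arrows K x y \<Longrightarrow> x \<in> Obj K" "a \<in> arrows K x y \<Longrightarrow> y \<in> Obj K"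
  using Dom_in Cod_in by (auto simp: arrows_def)

lemma is_inverse_iff:
  assumes "a \<in> arrows K x y"
  shows "is_inverse K a b \<longleftrightarrow> b \<in> arrows K y x \<and> b \<cdot> a = Ident K x \<and> a \<cdot> b = Ident K y"
  using assms by (auto simp: is_inverse_def arrows_def)

lemma inverse_unique:
  assumes a: "a \<in> arrows K x y" and "is_inverse K a b" "is_inverse K a c"
  shows "b = c"
proof -
  have b: "b \<in> arrows K y x" "b \<cdot> a = Ident K x" and c: "c \<in> arrows K y x" "a \<cdot> c = Ident K y"
    using assms by (simp_all add: is_inverse_iff)
  have "b = b \<cdot> (a \<cdot> c)" using b c by (simp add: Ident_right)
  also have "\<dots> = c" using Comp_assoc[OF c(1) a b(1)] b c by (simp add: Ident_left)
  finally show ?thesis .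
qed

lemma the_inverse:
  assumes a: "a \<in> arrows K x y" and iso: "is_iso K a"
  shows "the_inverse K a \<in> arrows K y x"
    and "the_inverse K a \<cdot> a = Ident K x" and "a \<cdot> the_inverse K a = Ident K y"
proof -
  obtain b where b: "is_inverse K a b" using iso by (auto simp: is_iso_def)
  then have "the_inverse K a = b"
    unfolding the_inverse_def using inverse_unique[OF a] by blast
  with b show "the_inverse K a \<in> arrows K y x" "the_inverse K a \<cdot> a = Ident K x"
      "a \<cdot> the_inverse K a = Ident K y"
    by (simp_all add: is_inverse_iff[OF a])
qed

lemma isoI:
  assumes "a \<in> arrows K x y" "b \<in> arrows K y x" "b \<cdot> a = Ident K x" "a \<cdot> b = Ident K y"
  shows "is_iso K a"
  using assms is_inverse_iff unfolding is_iso_def by blast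

lemma iso_the_inverse:
  assumes "a \<in> arrows K x y" "is_iso K a"
  shows "is_iso K (the_inverse K a)"
  using the_inverse[OF assms] by (intro isoI[OF _ assms(1)]) auto

lemma Comp_inverse_cancel:
  assumes a: "a \<in> arrows K x y" and iso: "is_iso K a"
  shows "b \<in> arrows K w x \<Longrightarrow> the_inverse K a \<cdot> (a \<cdot> b) = b"
    and "c \<in> arrows K w y \<Longrightarrow> a \<cdot> (the_inverse K a \<cdot> c) = c"
    and "d \<in> arrows K y z \<Longrightarrow> (d \<cdot> a) \<cdot> the_inverse K a = d"
proof -
  note i = the_inverse[OF assms]
  show "b \<in> arrows K w x \<Longrightarrow> the_inverse K a \<cdot> (a \<cdot> b) = b"
    using Comp_assoc[OF _ a i(1)] i(2) Ident_left by simp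
  show "c \<in> arrows K w y \<Longrightarrow> a \<cdot> (the_inverse K a \<cdot> c) = c"
    using Comp_assoc[OF _ i(1) a] i(3) Ident_left by simp
  show "d \<in> arrows K y z \<Longrightarrow> (d \<cdot> a) \<cdot> the_inverse K a = d"
    using Comp_assoc[OF i(1) a] i(3) Ident_right by simp
qed

lemma iso_left_cancel:
  assumes a: "a \<in> arrows K x y" and iso: "is_iso K a"
    and "b \<in> arrows K w x" "c \<in> arrows K w x" "a \<cdot> b = a \<cdot> c"
  shows "b = c"
  using Comp_inverse_cancel(1)[OF a iso] assms(3-) by metis

lemma iso_right_cancel:
  assumes a: "a \<in> arrows K x y" and iso: "is_iso K a"
    and "b \<in> arrows K y z" "c \<in> arrows K y z" "b \<cdot> a = c \<cdot> a"
  shows "b = c"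
  using Comp_inverse_cancel(3)[OF a iso] assms(3-) by metis

lemma iso_Comp:
  assumes a: "a \<in> arrows K x y" "is_iso K a" and b: "b \<in> arrows K y z" "is_iso K b"
  shows "is_iso K (b \<cdot> a)"
proof (rule isoI)
  let ?a = "the_inverse K a" and ?b = "the_inverse K b"
  note ia = the_inverse[OF a] and ib = the_inverse[OF b]
  show ba: "b \<cdot> a \<in> arrows K x z" and ab: "?a \<cdot> ?b \<in> arrows K z x"
    using Comp_in[OF a(1) b(1)] Comp_in[OF ib(1) ia(1)] by auto
  have "(?a \<cdot> ?b) \<cdot> (b \<cdot> a) = ?a \<cdot> (?b \<cdot> (b \<cdot> a))" using Comp_assoc[OF ba ib(1) ia(1)] .
  also have "\<dots> = Ident K x" using Comp_inverse_cancel(1)[OF b a(1)] ia by simp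
  finally show "(?a \<cdot> ?b) \<cdot> (b \<cdot> a) = Ident K x" .
  have "(b \<cdot> a) \<cdot> (?a \<cdot> ?b) = b \<cdot> (a \<cdot> (?a \<cdot> ?b))" using Comp_assoc[OF ab a(1) b(1)] .
  also have "\<dots> = Ident K z" using Comp_inverse_cancel(2)[OF a ib(1)] ib by simp
  finally show "(b \<cdot> a) \<cdot> (?a \<cdot> ?b) = Ident K z" .
qed

lemma iso_Ident: "x \<in> Obj K \<Longrightarrow> is_iso K (Ident K x)"
  using isoI[OF Ident_in Ident_in] Ident_left[OF Ident_in] by auto

end

lemma cat_functor_fun_id: "category A \<Longrightarrow> cat_functor A A fun_id"
  by (simp add: cat_functor_def fun_id_def)

lemma cat_functor_fun_comp:
  assumes F: "cat_functor A B F" and G: "cat_functor B E G"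
  shows "cat_functor A E (fun_comp G F)"
proof -
  interpret F: cat_functor A B F by (rule F)
  interpret G: cat_functor B E G by (rule G)
  interpret A: category A by (rule F.dom_category)
  interpret E: category E by (rule G.cod_category)
  show ?thesis
  proof
    fix a b x y z assume a: "a \<in> arrows A x y" and b: "b \<in> arrows A y z"
    show "far (fun_comp G F) (b \<cdot>\<^bsub>A\<^esub> a) = far (fun_comp G F) b \<cdot>\<^bsub>E\<^esub> far (fun_comp G F) a"
      using F.far_Comp[OF a b] G.far_Comp[OF F.far_in[OF a] F.far_in[OF b]] by (simp add: fun_comp_def)
  qed (use F.fob_in F.far_in F.far_Ident G.fob_in G.far_in G.far_Ident in \<open>simp_all add: fun_comp_def\<close>)
qed

definition fully_faithful :: "('a, 'b) cat \<Rightarrow> ('x, 'y) cat \<Rightarrow> ('a, 'b, 'x, 'y) fun_data \<Rightarrow> bool" where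
  "fully_faithful A B F \<longleftrightarrow> (\<forall>x \<in> Obj A. \<forall>y \<in> Obj A. \<forall>b \<in> arrows B (fob F x) (fob F y).
     \<exists>!a. a \<in> arrows A x y \<and> far F a = b)"

definition essentially_surjective ::
    "('a, 'b) cat \<Rightarrow> ('x, 'y) cat \<Rightarrow> ('a, 'b, 'x, 'y) fun_data \<Rightarrow> bool" where
  "essentially_surjective A B F \<longleftrightarrow>
     (\<forall>y \<in> Obj B. \<exists>x \<in> Obj A. \<exists>b \<in> arrows B (fob F x) y. is_iso B b)"

text \<open>
  If \<open>G F\<close> is naturally isomorphic to the identity then \<open>F\<close> is faithful, because an arrow \<open>a\<close> is
  recovered from \<open>G F a\<close> by conjugation with the components of the isomorphism.
\<close>

lemma faithful_if_unit_iso: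
  assumes F: "cat_functor A B F" and G: "cat_functor B A G"
    and \<eta>: "nat_iso A A fun_id (fun_comp G F) \<eta>"
    and a: "a \<in> arrows A x y" and b: "b \<in> arrows A x y" and eq: "far F a = far F b"
  shows "a = b"
proof -
  interpret \<eta>: nat_iso A A fun_id "fun_comp G F" \<eta> by (rule \<eta>)
  interpret A: category A by (rule \<eta>.dom_fun.dom_category)
  have ob: "x \<in> Obj A" "y \<in> Obj A" using a A.arrows_Obj by auto
  have "\<eta> y \<cdot>\<^bsub>A\<^esub> a = \<eta> y \<cdot>\<^bsub>A\<^esub> b"
    using \<eta>.naturality[OF a] \<eta>.naturality[OF b] eq by (simp add: fun_id_def fun_comp_def)
  then show ?thesis
    using A.iso_left_cancel[of "\<eta> y" y] \<eta>.component_in[OF ob(2)] \<eta>.component_iso[OF ob(2)] a b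
    by (simp add: fun_id_def fun_comp_def)
qed

lemma faithful_if_counit_iso:
  assumes F: "cat_functor A B F" and G: "cat_functor B A G"
    and \<epsilon>: "nat_iso B B (fun_comp F G) fun_id \<epsilon>"
    and a: "a \<in> arrows B x y" and b: "b \<in> arrows B x y" and eq: "far G a = far G b"
  shows "a = b"
proof -
  interpret \<epsilon>: nat_iso B B "fun_comp F G" fun_id \<epsilon> by (rule \<epsilon>)
  interpret B: category B by (rule \<epsilon>.dom_fun.dom_category)
  have ob: "x \<in> Obj B" "y \<in> Obj B" using a B.arrows_Obj by auto
  have "a \<cdot>\<^bsub>B\<^esub> \<epsilon> x = b \<cdot>\<^bsub>B\<^esub> \<epsilon> x"
    using \<epsilon>.naturality[OF a] \<epsilon>.naturality[OF b] eq by (simp add: fun_id_def fun_comp_def)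
  then show ?thesis
    using B.iso_right_cancel[of "\<epsilon> x" _ x] \<epsilon>.component_in[OF ob(1)] \<epsilon>.component_iso[OF ob(1)] a b
    by (simp add: fun_id_def fun_comp_def)
qed

context adjoint_equivalence
begin

text \<open>
  The preimage of \<open>b : F x \<rightarrow> F y\<close> is \<open>G b\<close> conjugated with the unit.  Its image under \<open>F\<close> is \<open>b\<close> because
  the two have the same image under \<open>G\<close>, which is faithful by the counit.
\<close>

lemma fully_faithful: "fully_faithful A B F"
  unfolding fully_faithful_def
proof (intro ballI ex_ex1I)
  interpret A: category A by (rule left.dom_category)
  fix x y b assume x: "x \<in> Obj A" and y: "y \<in> Obj A" and b: "b \<in> arrows B (fob F x) (fob F y)"
  have \<eta>: "\<eta> x \<in> arrows A x (fob G (fob F x))" "is_iso A (\<eta> x)"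
      "\<eta> y \<in> arrows A y (fob G (fob F y))" "is_iso A (\<eta> y)"
    using unit.component_in[OF x] unit.component_iso[OF x] unit.component_in[OF y]
      unit.component_iso[OF y] by (simp_all add: fun_id_def fun_comp_def)
  note iy = A.the_inverse[OF \<eta>(3,4)]
  define a where "a = the_inverse A (\<eta> y) \<cdot>\<^bsub>A\<^esub> (far G b \<cdot>\<^bsub>A\<^esub> \<eta> x)"
  have Gb: "far G b \<in> arrows A (fob G (fob F x)) (fob G (fob F y))"
    using right.far_in[OF b] .
  have a: "a \<in> arrows A x y"
    unfolding a_def using A.Comp_in[OF A.Comp_in[OF \<eta>(1) Gb] iy(1)] .
  have GFa: "far G (far F a) \<in> arrows A (fob G (fob F x)) (fob G (fob F y))"
    using left.far_in[OF a] right.far_in by blast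
  have "far G (far F a) \<cdot>\<^bsub>A\<^esub> \<eta> x = \<eta> y \<cdot>\<^bsub>A\<^esub> a"
    using unit.naturality[OF a] by (simp add: fun_id_def fun_comp_def)
  also have "\<dots> = far G b \<cdot>\<^bsub>A\<^esub> \<eta> x"
    unfolding a_def using A.Comp_inverse_cancel(2)[OF \<eta>(3,4) A.Comp_in[OF \<eta>(1) Gb]] .
  finally have "far G (far F a) = far G b"
    using A.iso_right_cancel[OF \<eta>(1,2) GFa Gb] by blast
  then have "far F a = b"
    using faithful_if_counit_iso[OF left.cat_functor_axioms right.cat_functor_axioms
        counit.nat_iso_axioms left.far_in[OF a] b] by blast
  with a show "\<exists>a. a \<in> arrows A x y \<and> far F a = b" by blast
next
  fix x y b a a'
  assume "a \<in> arrows A x y \<and> far F a = b" "a' \<in> arrows A x y \<and> far F a' = b"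
  then show "a = a'"
    using faithful_if_unit_iso[OF left.cat_functor_axioms right.cat_functor_axioms
        unit.nat_iso_axioms] by blast
qed

lemma essentially_surjective: "essentially_surjective A B F"
  unfolding essentially_surjective_def
proof
  fix y assume y: "y \<in> Obj B"
  show "\<exists>x \<in> Obj A. \<exists>b \<in> arrows B (fob F x) y. is_iso B b"
    using counit.component_in[OF y] counit.component_iso[OF y] right.fob_in[OF y]
    by (auto simp: fun_id_def fun_comp_def)
qed

end

text \<open>
  The quasi-inverse \<open>G\<close> and the counit are chosen by essential surjectivity.  The action of \<open>G\<close> on
  arrows and the unit are then the unique preimages under \<open>F\<close> of the arrows that make the counit
  natural and the first triangle commute; all other laws follow because \<open>F\<close> is faithful.
\<close>

lemma adjoint_equivalence_if_fully_faithful: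
  assumes F: "cat_functor A B F"
    and ff: "fully_faithful A B F" and es: "essentially_surjective A B F"
  shows "\<exists>G \<eta> \<epsilon>. adjoint_equivalence A B F G \<eta> \<epsilon>"
proof -
  interpret F: cat_functor A B F by (rule F)
  interpret A: category A by (rule F.dom_category)
  interpret B: category B by (rule F.cod_category)
  obtain g \<epsilon> where g: "\<And>y. y \<in> Obj B \<Longrightarrow> g y \<in> Obj A"
      and \<epsilon>: "\<And>y. y \<in> Obj B \<Longrightarrow> \<epsilon> y \<in> arrows B (fob F (g y)) y"
      and \<epsilon>_iso: "\<And>y. y \<in> Obj B \<Longrightarrow> is_iso B (\<epsilon> y)"
    using es unfolding essentially_surjective_def by metis
  note \<epsilon>' = B.the_inverse[OF \<epsilon> \<epsilon>_iso]
  have faithful: "a = a'" if "a \<in> arrows A x y" "a' \<in> arrows A x y" "far F a = far F a'" for a a' x y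
    using that ff F.far_in A.arrows_Obj unfolding fully_faithful_def by metis
  define lift where "lift x y b = (THE a. a \<in> arrows A x y \<and> far F a = b)" for x y b
  have lift: "lift x y b \<in> arrows A x y \<and> far F (lift x y b) = b"
    if "x \<in> Obj A" "y \<in> Obj A" "b \<in> arrows B (fob F x) (fob F y)" for x y b
  proof -
    have "\<exists>!a. a \<in> arrows A x y \<and> far F a = b" using ff that unfolding fully_faithful_def by blast
    from theI'[OF this] show ?thesis unfolding lift_def .
  qed
  define G where "G = \<lparr>fob = g, far = \<lambda>b. lift (g (Dom B b)) (g (Cod B b))
    (the_inverse B (\<epsilon> (Cod B b)) \<cdot>\<^bsub>B\<^esub> (b \<cdot>\<^bsub>B\<^esub> \<epsilon> (Dom B b)))\<rparr>"
  define \<eta> where "\<eta> x = lift x (g (fob F x)) (the_inverse B (\<epsilon> (fob F x)))" for x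
  have Gfob: "fob G y = g y" for y by (simp add: G_def)
  have Gfar: "far G b \<in> arrows A (g x) (g y)"
      and FG: "far F (far G b) = the_inverse B (\<epsilon> y) \<cdot>\<^bsub>B\<^esub> (b \<cdot>\<^bsub>B\<^esub> \<epsilon> x)"
    if b: "b \<in> arrows B x y" for b x y
  proof -
    have "x \<in> Obj B" "y \<in> Obj B" "Dom B b = x" "Cod B b = y"
      using b B.arrows_Obj by (auto simp: arrows_def)
    with b show "far G b \<in> arrows A (g x) (g y)"
        "far F (far G b) = the_inverse B (\<epsilon> y) \<cdot>\<^bsub>B\<^esub> (b \<cdot>\<^bsub>B\<^esub> \<epsilon> x)"
      using lift g B.Comp_in[OF B.Comp_in[OF \<epsilon> b] \<epsilon>'(1)] by (auto simp: G_def)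
  qed
  have \<epsilon>_nat: "\<epsilon> y \<cdot>\<^bsub>B\<^esub> far F (far G b) = b \<cdot>\<^bsub>B\<^esub> \<epsilon> x" if b: "b \<in> arrows B x y" for b x y
    using B.Comp_inverse_cancel(2)[OF \<epsilon> \<epsilon>_iso] B.Comp_in[OF \<epsilon> b] B.arrows_Obj[OF b] FG[OF b]
    by simp
  have FGin: "far F (far G b) \<in> arrows B (fob F (g x)) (fob F (g y))" if "b \<in> arrows B x y" for b x y
    using F.far_in[OF Gfar[OF that]] .
  have G: "cat_functor B A G"
  proof
    show "x \<in> Obj B \<Longrightarrow> fob G x \<in> Obj A" for x using g by (simp add: Gfob)
    show "b \<in> arrows B x y \<Longrightarrow> far G b \<in> arrows A (fob G x) (fob G y)" for b x y
      using Gfar by (simp add: Gfob)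
  next
    fix x assume x: "x \<in> Obj B"
    have "far F (far G (Ident B x)) = Ident B (fob F (g x))"
      using x FG[OF B.Ident_in[OF x]] \<epsilon>'[OF x] B.Ident_left[OF \<epsilon>[OF x]] by simp
    also have "\<dots> = far F (Ident A (g x))" using F.far_Ident g x by simp
    finally show "far G (Ident B x) = Ident A (fob G x)"
      using faithful[OF Gfar[OF B.Ident_in[OF x]] A.Ident_in[OF g[OF x]]] by (simp add: Gfob)
  next
    fix a b x y z assume a: "a \<in> arrows B x y" and b: "b \<in> arrows B y z"
    have z: "z \<in> Obj B" and x: "x \<in> Obj B" and y: "y \<in> Obj B"
      using a b B.arrows_Obj by auto
    have ba: "b \<cdot>\<^bsub>B\<^esub> a \<in> arrows B x z" using B.Comp_in[OF a b] .
    have "\<epsilon> z \<cdot>\<^bsub>B\<^esub> far F (far G b \<cdot>\<^bsub>A\<^esub> far G a)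
        = \<epsilon> z \<cdot>\<^bsub>B\<^esub> (far F (far G b) \<cdot>\<^bsub>B\<^esub> far F (far G a))"
      using F.far_Comp[OF Gfar[OF a] Gfar[OF b]] by simp
    also have "\<dots> = (\<epsilon> z \<cdot>\<^bsub>B\<^esub> far F (far G b)) \<cdot>\<^bsub>B\<^esub> far F (far G a)"
      using B.Comp_assoc[OF FGin[OF a] FGin[OF b] \<epsilon>[OF z]] by simp
    also have "\<dots> = b \<cdot>\<^bsub>B\<^esub> (\<epsilon> y \<cdot>\<^bsub>B\<^esub> far F (far G a))"
      using \<epsilon>_nat[OF b] B.Comp_assoc[OF FGin[OF a] \<epsilon>[OF y] b] by simp
    also have "\<dots> = (b \<cdot>\<^bsub>B\<^esub> a) \<cdot>\<^bsub>B\<^esub> \<epsilon> x"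
      using \<epsilon>_nat[OF a] B.Comp_assoc[OF \<epsilon>[OF x] a b] by simp
    also have "\<dots> = \<epsilon> z \<cdot>\<^bsub>B\<^esub> far F (far G (b \<cdot>\<^bsub>B\<^esub> a))" using \<epsilon>_nat[OF ba] by simp
    finally have "far F (far G b \<cdot>\<^bsub>A\<^esub> far G a) = far F (far G (b \<cdot>\<^bsub>B\<^esub> a))"
      using B.iso_left_cancel[OF \<epsilon>[OF z] \<epsilon>_iso[OF z]] F.far_in A.Comp_in Gfar a b ba by blast
    then show "far G (b \<cdot>\<^bsub>B\<^esub> a) = far G b \<cdot>\<^bsub>A\<^esub> far G a"
      using faithful A.Comp_in Gfar a b ba by metis
  qed
  have \<eta>in: "\<eta> x \<in> arrows A x (g (fob F x))" and F\<eta>: "far F (\<eta> x) = the_inverse B (\<epsilon> (fob F x))"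
    if "x \<in> Obj A" for x
    using lift[OF that g \<epsilon>'(1)] F.fob_in[OF that] unfolding \<eta>_def by auto
  interpret G: cat_functor B A G by (rule G)
  note GF = cat_functor_fun_comp[OF F G] and FG' = cat_functor_fun_comp[OF G F]
    and id = cat_functor_fun_id[OF A.category_axioms] cat_functor_fun_id[OF B.category_axioms]
  have counit: "nat_iso B B (fun_comp F G) fun_id \<epsilon>"
    using FG' id \<epsilon> \<epsilon>_iso \<epsilon>_nat by (simp add: nat_iso_def nat_trans_def nat_trans_axioms_def
        nat_iso_axioms_def Gfob fun_comp_def fun_id_def)
  have \<epsilon>F\<eta>: "\<epsilon> (fob F x) \<cdot>\<^bsub>B\<^esub> far F (\<eta> x) = Ident B (fob F x)" if "x \<in> Obj A" for x
    using F\<eta>[OF that] \<epsilon>'(3) F.fob_in[OF that] by simp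
  have \<eta>_nat: "far G (far F a) \<cdot>\<^bsub>A\<^esub> \<eta> x = \<eta> y \<cdot>\<^bsub>A\<^esub> a" if a: "a \<in> arrows A x y" for a x y
  proof -
    have ob: "x \<in> Obj A" "y \<in> Obj A" using a A.arrows_Obj by auto
    note Fa = F.far_in[OF a] and Fob = F.fob_in[OF ob(1)] F.fob_in[OF ob(2)]
    note F\<eta>in = F.far_in[OF \<eta>in[OF ob(1)]] F.far_in[OF \<eta>in[OF ob(2)]]
    have "\<epsilon> (fob F y) \<cdot>\<^bsub>B\<^esub> far F (far G (far F a) \<cdot>\<^bsub>A\<^esub> \<eta> x)
        = \<epsilon> (fob F y) \<cdot>\<^bsub>B\<^esub> (far F (far G (far F a)) \<cdot>\<^bsub>B\<^esub> far F (\<eta> x))"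
      using F.far_Comp[OF \<eta>in[OF ob(1)] Gfar[OF Fa]] by simp
    also have "\<dots> = (\<epsilon> (fob F y) \<cdot>\<^bsub>B\<^esub> far F (far G (far F a))) \<cdot>\<^bsub>B\<^esub> far F (\<eta> x)"
      using B.Comp_assoc[OF F\<eta>in(1) FGin[OF Fa] \<epsilon>[OF Fob(2)]] by simp
    also have "\<dots> = far F a \<cdot>\<^bsub>B\<^esub> (\<epsilon> (fob F x) \<cdot>\<^bsub>B\<^esub> far F (\<eta> x))"
      using B.Comp_assoc[OF F\<eta>in(1) \<epsilon>[OF Fob(1)] Fa] \<epsilon>_nat[OF Fa] by simp
    also have "\<dots> = (\<epsilon> (fob F y) \<cdot>\<^bsub>B\<^esub> far F (\<eta> y)) \<cdot>\<^bsub>B\<^esub> far F a"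
      using \<epsilon>F\<eta>[OF ob(1)] \<epsilon>F\<eta>[OF ob(2)] Fa by (simp add: B.Ident_left B.Ident_right)
    also have "\<dots> = \<epsilon> (fob F y) \<cdot>\<^bsub>B\<^esub> far F (\<eta> y \<cdot>\<^bsub>A\<^esub> a)"
      using B.Comp_assoc[OF Fa F\<eta>in(2) \<epsilon>[OF Fob(2)]] F.far_Comp[OF a \<eta>in[OF ob(2)]] by simp
    finally have "far F (far G (far F a) \<cdot>\<^bsub>A\<^esub> \<eta> x) = far F (\<eta> y \<cdot>\<^bsub>A\<^esub> a)"
      using B.iso_left_cancel[OF \<epsilon>[OF Fob(2)] \<epsilon>_iso[OF Fob(2)]]
        F.far_in A.Comp_in[OF \<eta>in[OF ob(1)] Gfar[OF Fa]] A.Comp_in[OF a \<eta>in[OF ob(2)]] by blast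
    then show ?thesis
      using faithful A.Comp_in[OF \<eta>in[OF ob(1)] Gfar[OF Fa]] A.Comp_in[OF a \<eta>in[OF ob(2)]] by blast
  qed
  have \<eta>_iso: "is_iso A (\<eta> x)" if x: "x \<in> Obj A" for x
  proof (rule A.isoI)
    let ?e = "lift (g (fob F x)) x (\<epsilon> (fob F x))"
    note Fx = F.fob_in[OF x]
    have e: "?e \<in> arrows A (g (fob F x)) x" "far F ?e = \<epsilon> (fob F x)"
      using lift[OF g[OF Fx] x \<epsilon>[OF Fx]] by auto
    show "\<eta> x \<in> arrows A x (g (fob F x))" "?e \<in> arrows A (g (fob F x)) x"
      using \<eta>in[OF x] e by auto
    have "far F (?e \<cdot>\<^bsub>A\<^esub> \<eta> x) = far F (Ident A x)" "far F (\<eta> x \<cdot>\<^bsub>A\<^esub> ?e) = far F (Ident A (g (fob F x)))"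
      using Fx F.far_Comp[OF \<eta>in[OF x] e(1)] F.far_Comp[OF e(1) \<eta>in[OF x]] F\<eta>[OF x] e \<epsilon>'[OF Fx]
        F.far_Ident[OF x] F.far_Ident[OF g[OF Fx]] by auto
    then show "?e \<cdot>\<^bsub>A\<^esub> \<eta> x = Ident A x" "\<eta> x \<cdot>\<^bsub>A\<^esub> ?e = Ident A (g (fob F x))"
      using faithful A.Comp_in[OF \<eta>in[OF x] e(1)] A.Comp_in[OF e(1) \<eta>in[OF x]]
        A.Ident_in[OF x] A.Ident_in[OF g[OF Fx]] by blast+
  qed
  have unit: "nat_iso A A fun_id (fun_comp G F) \<eta>"
    using GF id \<eta>in \<eta>_iso \<eta>_nat by (simp add: nat_iso_def nat_trans_def nat_trans_axioms_def
        nat_iso_axioms_def Gfob fun_comp_def fun_id_def)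
  have tri: "far G (\<epsilon> y) \<cdot>\<^bsub>A\<^esub> \<eta> (fob G y) = Ident A (fob G y)" if y: "y \<in> Obj B" for y
  proof -
    note gy = g[OF y] and Fgy = F.fob_in[OF g[OF y]]
    have G\<epsilon>: "far G (\<epsilon> y) \<in> arrows A (g (fob F (g y))) (g y)" using Gfar[OF \<epsilon>[OF y]] .
    have "far F (far G (\<epsilon> y)) = \<epsilon> (fob F (g y))"
      using FG[OF \<epsilon>[OF y]] B.Comp_inverse_cancel(1)[OF \<epsilon>[OF y] \<epsilon>_iso[OF y] \<epsilon>[OF Fgy]] by simp
    then have "far F (far G (\<epsilon> y) \<cdot>\<^bsub>A\<^esub> \<eta> (g y)) = far F (Ident A (g y))"
      using Fgy F.far_Comp[OF \<eta>in[OF gy] G\<epsilon>] F\<eta>[OF gy] \<epsilon>'[OF Fgy] F.far_Ident[OF gy] by simp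
    then show ?thesis
      using faithful A.Comp_in[OF \<eta>in[OF gy] G\<epsilon>] A.Ident_in[OF gy] by (simp add: Gfob)
  qed
  have "adjoint_equivalence A B F G \<eta> \<epsilon>"
    by (intro adjoint_equivalence.intro adjoint_equivalence_axioms.intro F G unit counit \<epsilon>F\<eta> tri)
  then show ?thesis by blast
qed


section \<open>Calculus in 2-categories\<close>

text \<open>
  The axioms are restated with equations between sources and targets in place of memberships in
  hom-sets.  Such typing conditions are solved by rewriting, so that most of the laws can be used as
  simplification rules: composites are associated to the right and units are removed.
\<close>

context two_category
begin

sublocale cat1: category "cat1 C" by (rule category_cat1)
sublocale cat2: category "cat2 C" by (rule category_cat2)

lemma cat1_sel [simp]:
  "Obj (cat1 C) = Ob C" "Arr (cat1 C) = Mor C" "Dom (cat1 C) = src C" "Cod (cat1 C) = tgt C"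
  "Ident (cat1 C) = id1 C" "Comp (cat1 C) = comp1 C"
  by (simp_all add: cat1_def)

lemma cat2_sel [simp]:
  "Obj (cat2 C) = Mor C" "Arr (cat2 C) = Cell C" "Dom (cat2 C) = dom2 C" "Cod (cat2 C) = cod2 C"
  "Ident (cat2 C) = id2 C" "Comp (cat2 C) = vcomp C"
  by (simp_all add: cat2_def)

lemma arrows_cat1 [simp]: "arrows (cat1 C) X Y = hom1 C X Y"
  by (simp add: arrows_def hom1_def)

lemma arrows_cat2 [simp]: "arrows (cat2 C) f g = hom2 C f g"
  by (simp add: arrows_def hom2_def)

lemma src_Ob [simp]: "f \<in> Mor C \<Longrightarrow> src C f \<in> Ob C"
  and tgt_Ob [simp]: "f \<in> Mor C \<Longrightarrow> tgt C f \<in> Ob C"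
  using cat1.Dom_in cat1.Cod_in by auto

lemma dom2_Mor [simp]: "\<alpha> \<in> Cell C \<Longrightarrow> dom2 C \<alpha> \<in> Mor C"
  and cod2_Mor [simp]: "\<alpha> \<in> Cell C \<Longrightarrow> cod2 C \<alpha> \<in> Mor C"
  using cat2.Dom_in cat2.Cod_in by auto

lemma src_cod2 [simp]: "\<alpha> \<in> Cell C \<Longrightarrow> src C (cod2 C \<alpha>) = src C (dom2 C \<alpha>)"
  and tgt_cod2 [simp]: "\<alpha> \<in> Cell C \<Longrightarrow> tgt C (cod2 C \<alpha>) = tgt C (dom2 C \<alpha>)"
  using globular by auto

lemma id1_type [simp]:
  assumes "X \<in> Ob C"
  shows "id1 C X \<in> Mor C" and "src C (id1 C X) = X" and "tgt C (id1 C X) = X"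
  using cat1.Ident_in assms by (auto simp: hom1_def)

lemma comp1_type [simp]:
  assumes "f \<in> Mor C" "g \<in> Mor C" "tgt C f = src C g"
  shows "g \<odot> f \<in> Mor C" and "src C (g \<odot> f) = src C f" and "tgt C (g \<odot> f) = tgt C g"
  using cat1.Comp_in[of f "src C f" "src C g" g "tgt C g"] assms by (auto simp: hom1_def)

lemma id1_left [simp]: "\<lbrakk>f \<in> Mor C; tgt C f = Y\<rbrakk> \<Longrightarrow> id1 C Y \<odot> f = f"
  and id1_right [simp]: "\<lbrakk>f \<in> Mor C; src C f = X\<rbrakk> \<Longrightarrow> f \<odot> id1 C X = f"
  using cat1.Ident_left cat1.Ident_right by (auto simp: hom1_def)

lemma comp1_assoc [simp]:
  "\<lbrakk>f \<in> Mor C; g \<in> Mor C; h \<in> Mor C; tgt C f = src C g; tgt C g = src C h\<rbrakk>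
    \<Longrightarrow> (h \<odot> g) \<odot> f = h \<odot> (g \<odot> f)"
  using cat1.Comp_assoc by (simp add: hom1_def)

lemma id2_type [simp]:
  assumes "f \<in> Mor C"
  shows "id2 C f \<in> Cell C" and "dom2 C (id2 C f) = f" and "cod2 C (id2 C f) = f"
  using cat2.Ident_in assms by (auto simp: hom2_def)

lemma vcomp_type [simp]:
  assumes "\<alpha> \<in> Cell C" "\<beta> \<in> Cell C" "cod2 C \<alpha> = dom2 C \<beta>"
  shows "\<beta> \<bullet> \<alpha> \<in> Cell C" and "dom2 C (\<beta> \<bullet> \<alpha>) = dom2 C \<alpha>" and "cod2 C (\<beta> \<bullet> \<alpha>) = cod2 C \<beta>"
  using cat2.Comp_in[of \<alpha> "dom2 C \<alpha>" "dom2 C \<beta>" \<beta> "cod2 C \<beta>"] assms by (auto simp: hom2_def)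

lemma vcomp_id2_left [simp]: "\<lbrakk>\<alpha> \<in> Cell C; cod2 C \<alpha> = f\<rbrakk> \<Longrightarrow> id2 C f \<bullet> \<alpha> = \<alpha>"
  and vcomp_id2_right [simp]: "\<lbrakk>\<alpha> \<in> Cell C; dom2 C \<alpha> = f\<rbrakk> \<Longrightarrow> \<alpha> \<bullet> id2 C f = \<alpha>"
  using cat2.Ident_left cat2.Ident_right by (auto simp: hom2_def)

lemma vcomp_assoc [simp]:
  "\<lbrakk>\<alpha> \<in> Cell C; \<beta> \<in> Cell C; \<gamma> \<in> Cell C; cod2 C \<alpha> = dom2 C \<beta>; cod2 C \<beta> = dom2 C \<gamma>\<rbrakk>
    \<Longrightarrow> (\<gamma> \<bullet> \<beta>) \<bullet> \<alpha> = \<gamma> \<bullet> (\<beta> \<bullet> \<alpha>)"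
  using cat2.Comp_assoc by (simp add: hom2_def)

lemma hcomp_type [simp]:
  assumes "\<alpha> \<in> Cell C" "\<beta> \<in> Cell C" "tgt C (dom2 C \<alpha>) = src C (dom2 C \<beta>)"
  shows "\<beta> \<star> \<alpha> \<in> Cell C" and "dom2 C (\<beta> \<star> \<alpha>) = dom2 C \<beta> \<odot> dom2 C \<alpha>"
    and "cod2 C (\<beta> \<star> \<alpha>) = cod2 C \<beta> \<odot> cod2 C \<alpha>"
  using hcomp_in[of "dom2 C \<alpha>" "src C (dom2 C \<alpha>)" "src C (dom2 C \<beta>)" "dom2 C \<beta>" "tgt C (dom2 C \<beta>)" \<alpha>
      "cod2 C \<alpha>" \<beta> "cod2 C \<beta>"] assms by (auto simp: hom1_def hom2_def)

lemma hcomp_id2' [simp]: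
  "\<lbrakk>f \<in> Mor C; g \<in> Mor C; tgt C f = src C g\<rbrakk> \<Longrightarrow> id2 C g \<star> id2 C f = id2 C (g \<odot> f)"
  using hcomp_id2 by (simp add: hom1_def)

lemma hcomp_unit [simp]:
  "\<lbrakk>\<alpha> \<in> Cell C; tgt C (dom2 C \<alpha>) = Y\<rbrakk> \<Longrightarrow> id2 C (id1 C Y) \<star> \<alpha> = \<alpha>"
  "\<lbrakk>\<alpha> \<in> Cell C; src C (dom2 C \<alpha>) = X\<rbrakk> \<Longrightarrow> \<alpha> \<star> id2 C (id1 C X) = \<alpha>"
  using hcomp_unit_left hcomp_unit_right by (auto simp: hom1_def hom2_def)

lemma hcomp_assoc' [simp]:
  "\<lbrakk>\<alpha> \<in> Cell C; \<beta> \<in> Cell C; \<gamma> \<in> Cell C; tgt C (dom2 C \<alpha>) = src C (dom2 C \<beta>);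
    tgt C (dom2 C \<beta>) = src C (dom2 C \<gamma>)\<rbrakk> \<Longrightarrow> (\<gamma> \<star> \<beta>) \<star> \<alpha> = \<gamma> \<star> (\<beta> \<star> \<alpha>)"
  using hcomp_assoc by (auto simp: hom1_def hom2_def)

lemma interchange':
  "\<lbrakk>\<alpha> \<in> Cell C; \<alpha>' \<in> Cell C; \<beta> \<in> Cell C; \<beta>' \<in> Cell C; cod2 C \<alpha> = dom2 C \<alpha>'; cod2 C \<beta> = dom2 C \<beta>';
    tgt C (dom2 C \<alpha>) = src C (dom2 C \<beta>)\<rbrakk>
    \<Longrightarrow> (\<beta>' \<star> \<alpha>') \<bullet> (\<beta> \<star> \<alpha>) = (\<beta>' \<bullet> \<beta>) \<star> (\<alpha>' \<bullet> \<alpha>)"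
  using interchange[of "dom2 C \<alpha>" "src C (dom2 C \<alpha>)" "src C (dom2 C \<beta>)" "dom2 C \<beta>" "tgt C (dom2 C \<beta>)"
      \<alpha> "dom2 C \<alpha>'" \<alpha>' "cod2 C \<alpha>'" \<beta> "dom2 C \<beta>'" \<beta>' "cod2 C \<beta>'"]
  by (simp add: hom1_def hom2_def)

lemma whisker_left_vcomp:
  "\<lbrakk>g \<in> Mor C; \<alpha> \<in> Cell C; \<beta> \<in> Cell C; cod2 C \<alpha> = dom2 C \<beta>; tgt C (dom2 C \<alpha>) = src C g\<rbrakk>
    \<Longrightarrow> id2 C g \<star> (\<beta> \<bullet> \<alpha>) = (id2 C g \<star> \<beta>) \<bullet> (id2 C g \<star> \<alpha>)"
  by (simp add: interchange')

lemma whisker_right_vcomp: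
  "\<lbrakk>f \<in> Mor C; \<alpha> \<in> Cell C; \<beta> \<in> Cell C; cod2 C \<alpha> = dom2 C \<beta>; src C (dom2 C \<alpha>) = tgt C f\<rbrakk>
    \<Longrightarrow> (\<beta> \<bullet> \<alpha>) \<star> id2 C f = (\<beta> \<star> id2 C f) \<bullet> (\<alpha> \<star> id2 C f)"
  by (simp add: interchange')

lemma hcomp_whisker:
  assumes "\<alpha> \<in> Cell C" "\<beta> \<in> Cell C" "tgt C (dom2 C \<alpha>) = src C (dom2 C \<beta>)"
    and "dom2 C \<alpha> = f" "cod2 C \<alpha> = f'" "dom2 C \<beta> = g" "cod2 C \<beta> = g'"
  shows "(\<beta> \<star> id2 C f') \<bullet> (id2 C g \<star> \<alpha>) = \<beta> \<star> \<alpha>"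
    and "(id2 C g' \<star> \<alpha>) \<bullet> (\<beta> \<star> id2 C f) = \<beta> \<star> \<alpha>"
  using assms by (auto simp: interchange')

lemma whisker_comp1:
  "\<lbrakk>f \<in> Mor C; g \<in> Mor C; \<alpha> \<in> Cell C; tgt C f = src C g; tgt C (dom2 C \<alpha>) = src C f\<rbrakk>
    \<Longrightarrow> id2 C (g \<odot> f) \<star> \<alpha> = id2 C g \<star> (id2 C f \<star> \<alpha>)"
  using hcomp_assoc'[of \<alpha> "id2 C f" "id2 C g"] by simp

text \<open>
  In a vertical composite associated to the right, an equation for the composite of the two leading
  factors does not match a subterm; this lemma applies it.
\<close>

lemma vcomp_replace:
  assumes "\<beta> \<bullet> \<alpha> = \<gamma>" "\<alpha> \<in> Cell C" "\<beta> \<in> Cell C" "\<delta> \<in> Cell C" "cod2 C \<delta> = dom2 C \<alpha>" "cod2 C \<alpha> = dom2 C \<beta>"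
  shows "\<beta> \<bullet> (\<alpha> \<bullet> \<delta>) = \<gamma> \<bullet> \<delta>"
  using assms by (metis vcomp_assoc)

abbreviation iso2 :: "'c \<Rightarrow> bool" where "iso2 \<alpha> \<equiv> is_iso (cat2 C) \<alpha>"
abbreviation inv2 :: "'c \<Rightarrow> 'c" where "inv2 \<alpha> \<equiv> the_inverse (cat2 C) \<alpha>"

lemma iso2_Cell: "iso2 \<alpha> \<Longrightarrow> \<alpha> \<in> Cell C"
  by (auto simp: is_iso_def is_inverse_def)

lemma inv2_type [simp]:
  assumes "iso2 \<alpha>"
  shows "inv2 \<alpha> \<in> Cell C" and "dom2 C (inv2 \<alpha>) = cod2 C \<alpha>" and "cod2 C (inv2 \<alpha>) = dom2 C \<alpha>"
    and "iso2 (inv2 \<alpha>)"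
  using cat2.the_inverse[of \<alpha> "dom2 C \<alpha>" "cod2 C \<alpha>"] cat2.iso_the_inverse[of \<alpha> "dom2 C \<alpha>" "cod2 C \<alpha>"]
    assms iso2_Cell[OF assms] by (auto simp: hom2_def)

lemma inv2_vcomp [simp]:
  assumes "iso2 \<alpha>"
  shows "inv2 \<alpha> \<bullet> \<alpha> = id2 C (dom2 C \<alpha>)" and "\<alpha> \<bullet> inv2 \<alpha> = id2 C (cod2 C \<alpha>)"
  using cat2.the_inverse[of \<alpha> "dom2 C \<alpha>" "cod2 C \<alpha>"]
    assms iso2_Cell[OF assms] by (auto simp: hom2_def)

lemma inv2_vcomp_cancel [simp]:
  assumes "iso2 \<alpha>" "\<beta> \<in> Cell C"
  shows "cod2 C \<beta> = dom2 C \<alpha> \<Longrightarrow> inv2 \<alpha> \<bullet> (\<alpha> \<bullet> \<beta>) = \<beta>"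
    and "cod2 C \<beta> = cod2 C \<alpha> \<Longrightarrow> \<alpha> \<bullet> (inv2 \<alpha> \<bullet> \<beta>) = \<beta>"
  using cat2.Comp_inverse_cancel(1,2)[of \<alpha> "dom2 C \<alpha>" "cod2 C \<alpha>" \<beta> "dom2 C \<beta>"] assms iso2_Cell[OF assms(1)]
  by (simp_all add: hom2_def)

lemma iso2I:
  assumes "\<alpha> \<in> Cell C" "\<beta> \<in> Cell C" "dom2 C \<beta> = cod2 C \<alpha>" "cod2 C \<beta> = dom2 C \<alpha>"
    "\<beta> \<bullet> \<alpha> = id2 C (dom2 C \<alpha>)" "\<alpha> \<bullet> \<beta> = id2 C (cod2 C \<alpha>)"
  shows "iso2 \<alpha>"
  using cat2.isoI[of \<alpha> "dom2 C \<alpha>" "cod2 C \<alpha>" \<beta>] assms by (auto simp: hom2_def)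

lemma inv2_unique:
  assumes "\<alpha> \<in> Cell C" "\<beta> \<in> Cell C" "dom2 C \<beta> = cod2 C \<alpha>" "cod2 C \<beta> = dom2 C \<alpha>"
    "\<beta> \<bullet> \<alpha> = id2 C (dom2 C \<alpha>)" "\<alpha> \<bullet> \<beta> = id2 C (cod2 C \<alpha>)"
  shows "inv2 \<alpha> = \<beta>"
proof -
  have i: "iso2 \<alpha>" using iso2I[OF assms] .
  have "\<beta> = \<beta> \<bullet> (\<alpha> \<bullet> inv2 \<alpha>)" using assms i by simp
  also have "\<dots> = inv2 \<alpha>" using vcomp_assoc[of "inv2 \<alpha>" \<alpha> \<beta>] assms i by simp
  finally show ?thesis by simp
qed

lemma iso2_id2 [simp]: "f \<in> Mor C \<Longrightarrow> iso2 (id2 C f)"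
  using cat2.iso_Ident by simp

lemma inv2_id2 [simp]: "f \<in> Mor C \<Longrightarrow> inv2 (id2 C f) = id2 C f"
  by (intro inv2_unique) simp_all

lemma iso2_vcomp [simp]: "\<lbrakk>iso2 \<alpha>; iso2 \<beta>; cod2 C \<alpha> = dom2 C \<beta>\<rbrakk> \<Longrightarrow> iso2 (\<beta> \<bullet> \<alpha>)"
  using cat2.iso_Comp[of \<alpha> "dom2 C \<alpha>" "dom2 C \<beta>" \<beta> "cod2 C \<beta>"] iso2_Cell by (auto simp: hom2_def)

lemma hcomp_inv2:
  assumes "iso2 \<alpha>" "iso2 \<beta>" "tgt C (dom2 C \<alpha>) = src C (dom2 C \<beta>)"
  shows "iso2 (\<beta> \<star> \<alpha>)" and "inv2 (\<beta> \<star> \<alpha>) = inv2 \<beta> \<star> inv2 \<alpha>"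
proof -
  have c: "\<alpha> \<in> Cell C" "\<beta> \<in> Cell C" using iso2_Cell assms by auto
  show "iso2 (\<beta> \<star> \<alpha>)"
    by (rule iso2I[of _ "inv2 \<beta> \<star> inv2 \<alpha>"]) (use c assms in \<open>simp_all add: interchange'\<close>)
  show "inv2 (\<beta> \<star> \<alpha>) = inv2 \<beta> \<star> inv2 \<alpha>"
    by (rule inv2_unique) (use c assms in \<open>simp_all add: interchange'\<close>)
qed

lemma iso2_hcomp [simp]:
  "\<lbrakk>iso2 \<alpha>; iso2 \<beta>; tgt C (dom2 C \<alpha>) = src C (dom2 C \<beta>)\<rbrakk> \<Longrightarrow> iso2 (\<beta> \<star> \<alpha>)"
  by (rule hcomp_inv2)

lemma iso2_left_cancel:
  assumes "iso2 \<alpha>" "\<beta> \<in> Cell C" "\<gamma> \<in> Cell C" "cod2 C \<beta> = dom2 C \<alpha>" "cod2 C \<gamma> = dom2 C \<alpha>"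
    "\<alpha> \<bullet> \<beta> = \<alpha> \<bullet> \<gamma>"
  shows "\<beta> = \<gamma>"
  using cat2.iso_left_cancel[of \<alpha> "dom2 C \<alpha>" "cod2 C \<alpha>" \<beta> "dom2 C \<beta>" \<gamma>]
    assms iso2_Cell[OF assms(1)] vcomp_type(2)[of \<beta> \<alpha>] vcomp_type(2)[of \<gamma> \<alpha>]
  by (simp add: hom2_def)

lemma iso2_right_cancel:
  assumes "iso2 \<alpha>" "\<beta> \<in> Cell C" "\<gamma> \<in> Cell C" "dom2 C \<beta> = cod2 C \<alpha>" "dom2 C \<gamma> = cod2 C \<alpha>"
    "\<beta> \<bullet> \<alpha> = \<gamma> \<bullet> \<alpha>"
  shows "\<beta> = \<gamma>"
  using cat2.iso_right_cancel[of \<alpha> "dom2 C \<alpha>" "cod2 C \<alpha>" \<beta> "cod2 C \<beta>" \<gamma>]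
    assms iso2_Cell[OF assms(1)] vcomp_type(3)[of \<alpha> \<beta>] vcomp_type(3)[of \<alpha> \<gamma>]
  by (simp add: hom2_def)

lemma hom_cat_sel [simp]:
  "Obj (hom_cat C X Y) = hom1 C X Y" "Dom (hom_cat C X Y) = dom2 C" "Cod (hom_cat C X Y) = cod2 C"
  "Ident (hom_cat C X Y) = id2 C" "Comp (hom_cat C X Y) = vcomp C"
  "Arr (hom_cat C X Y) = {\<alpha> \<in> Cell C. dom2 C \<alpha> \<in> hom1 C X Y}"
  by (auto simp: hom_cat_def hom1_def)

lemma arrows_hom_cat:
  "arrows (hom_cat C X Y) f g = (if f \<in> hom1 C X Y then hom2 C f g else {})"
  by (auto simp: arrows_def hom1_def hom2_def)

lemma category_hom_cat: "category (hom_cat C X Y)"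
  by unfold_locales (auto simp: arrows_def hom1_def)

lemma is_iso_hom_cat:
  assumes "\<alpha> \<in> Cell C" "dom2 C \<alpha> \<in> hom1 C X Y"
  shows "is_iso (hom_cat C X Y) \<alpha> \<longleftrightarrow> iso2 \<alpha>"
proof -
  have "is_inverse (hom_cat C X Y) \<alpha> \<beta> \<longleftrightarrow> is_inverse (cat2 C) \<alpha> \<beta>" for \<beta>
    using assms by (auto simp: is_inverse_def arrows_def hom1_def)
  then show ?thesis by (simp add: is_iso_def)
qed

end


section \<open>Calculus of normal pseudo-functors\<close>

context normal_pseudo_functor
begin

sublocale A: two_category A by (rule dom_two_category)
sublocale B: two_category B by (rule cod_two_category)

lemma ap0_Ob [simp]: "X \<in> Ob A \<Longrightarrow> ap0 F X \<in> Ob B"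
  by (rule ap0_in)

lemma ap1_type [simp]:
  assumes "a \<in> Mor A"
  shows "ap1 F a \<in> Mor B" and "src B (ap1 F a) = ap0 F (src A a)" and "tgt B (ap1 F a) = ap0 F (tgt A a)"
  using cat_functor.fob_in[OF local_functor, of "src A a" "tgt A a" a] assms by (auto simp: hom1_def)

lemma ap2_type [simp]:
  assumes "\<alpha> \<in> Cell A"
  shows "ap2 F \<alpha> \<in> Cell B" and "dom2 B (ap2 F \<alpha>) = ap1 F (dom2 A \<alpha>)"
    and "cod2 B (ap2 F \<alpha>) = ap1 F (cod2 A \<alpha>)"
  using cat_functor.far_in[OF local_functor, of "src A (dom2 A \<alpha>)" "tgt A (dom2 A \<alpha>)" \<alpha> "dom2 A \<alpha>" "cod2 A \<alpha>"]
    assms by (auto simp: hom1_def hom2_def A.arrows_hom_cat B.arrows_hom_cat)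

lemma ap2_id2 [simp]: "a \<in> Mor A \<Longrightarrow> ap2 F (id2 A a) = id2 B (ap1 F a)"
  using cat_functor.far_Ident[OF local_functor, of "src A a" "tgt A a" a] by (auto simp: hom1_def)

lemma ap2_vcomp [simp]:
  "\<lbrakk>\<alpha> \<in> Cell A; \<beta> \<in> Cell A; cod2 A \<alpha> = dom2 A \<beta>\<rbrakk> \<Longrightarrow> ap2 F (\<beta> \<bullet>\<^bsub>A\<^esub> \<alpha>) = ap2 F \<beta> \<bullet>\<^bsub>B\<^esub> ap2 F \<alpha>"
  using cat_functor.far_Comp[OF local_functor, of "src A (dom2 A \<alpha>)" "tgt A (dom2 A \<alpha>)"
      \<alpha> "dom2 A \<alpha>" "dom2 A \<beta>" \<beta> "cod2 A \<beta>"] A.src_cod2[of \<alpha>] A.tgt_cod2[of \<alpha>]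
  by (auto simp: hom1_def hom2_def A.arrows_hom_cat simp del: A.src_cod2 A.tgt_cod2)

lemma ap2_iso2 [simp]: "A.iso2 \<alpha> \<Longrightarrow> B.iso2 (ap2 F \<alpha>)"
  using A.iso2_Cell[of \<alpha>] ap2_vcomp[of \<alpha> "A.inv2 \<alpha>"] ap2_vcomp[of "A.inv2 \<alpha>" \<alpha>]
  by (intro B.iso2I[of _ "ap2 F (A.inv2 \<alpha>)"]) (simp_all del: ap2_vcomp)

lemma ap1_id1' [simp]: "X \<in> Ob A \<Longrightarrow> ap1 F (id1 A X) = id1 B (ap0 F X)"
  by (rule ap1_id1)

lemma cpt_type [simp]:
  assumes "a \<in> Mor A" "a' \<in> Mor A" "tgt A a = src A a'"
  shows "cpt F a a' \<in> Cell B" and "dom2 B (cpt F a a') = ap1 F a' \<odot>\<^bsub>B\<^esub> ap1 F a"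
    and "cod2 B (cpt F a a') = ap1 F (a' \<odot>\<^bsub>A\<^esub> a)" and "B.iso2 (cpt F a a')"
  using cpt_in[of a "src A a" "src A a'" a'] cpt_iso[of a "src A a" "src A a'" a'] assms
  by (auto simp: hom1_def hom2_def)

lemma cpt_natural':
  assumes "\<alpha> \<in> Cell A" "\<alpha>' \<in> Cell A" "tgt A (dom2 A \<alpha>) = src A (dom2 A \<alpha>')"
    and "dom2 A \<alpha> = a" "dom2 A \<alpha>' = a'" "cod2 A \<alpha> = b" "cod2 A \<alpha>' = b'"
  shows "cpt F b b' \<bullet>\<^bsub>B\<^esub> (ap2 F \<alpha>' \<star>\<^bsub>B\<^esub> ap2 F \<alpha>) = ap2 F (\<alpha>' \<star>\<^bsub>A\<^esub> \<alpha>) \<bullet>\<^bsub>B\<^esub> cpt F a a'"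
  using cpt_natural[of a "src A a" "src A a'" a' "tgt A a'" \<alpha> b \<alpha>' b'] assms
  by (auto simp: hom1_def hom2_def)

lemma cpt_assoc':
  "\<lbrakk>a \<in> Mor A; a' \<in> Mor A; a'' \<in> Mor A; tgt A a = src A a'; tgt A a' = src A a''\<rbrakk> \<Longrightarrow>
    cpt F a (a'' \<odot>\<^bsub>A\<^esub> a') \<bullet>\<^bsub>B\<^esub> (cpt F a' a'' \<star>\<^bsub>B\<^esub> id2 B (ap1 F a))
    = cpt F (a' \<odot>\<^bsub>A\<^esub> a) a'' \<bullet>\<^bsub>B\<^esub> (id2 B (ap1 F a'') \<star>\<^bsub>B\<^esub> cpt F a a')"
  using cpt_assoc[of a "src A a" "src A a'" a' "src A a''" a''] by (auto simp: hom1_def)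

lemma cpt_unit [simp]:
  "\<lbrakk>a \<in> Mor A; tgt A a = Y\<rbrakk> \<Longrightarrow> cpt F a (id1 A Y) = id2 B (ap1 F a)"
  "\<lbrakk>a \<in> Mor A; src A a = X\<rbrakk> \<Longrightarrow> cpt F (id1 A X) a = id2 B (ap1 F a)"
  using cpt_unit_left cpt_unit_right by (auto simp: hom1_def)

end


section \<open>Opposites, products and the two-sided hom pseudo-functor\<close>

text \<open>
  The axioms of a 2-category in terms of sources and targets instead of hom-sets.  The typing
  conditions become equations, which the simplifier can decide in concrete 2-categories.
\<close>

lemma two_categoryI:
  fixes C :: "('o, 'm, 'c) twocat" (structure)
  assumes "\<And>f. f \<in> Mor C \<Longrightarrow> src C f \<in> Ob C" "\<And>f. f \<in> Mor C \<Longrightarrow> tgt C f \<in> Ob C"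
    and "\<And>\<alpha>. \<alpha> \<in> Cell C \<Longrightarrow> dom2 C \<alpha> \<in> Mor C" "\<And>\<alpha>. \<alpha> \<in> Cell C \<Longrightarrow> cod2 C \<alpha> \<in> Mor C"
    and "\<And>\<alpha>. \<alpha> \<in> Cell C \<Longrightarrow> src C (cod2 C \<alpha>) = src C (dom2 C \<alpha>) \<and> tgt C (cod2 C \<alpha>) = tgt C (dom2 C \<alpha>)"
    and "\<And>X. X \<in> Ob C \<Longrightarrow> id1 C X \<in> Mor C \<and> src C (id1 C X) = X \<and> tgt C (id1 C X) = X"
    and "\<And>f g. \<lbrakk>f \<in> Mor C; g \<in> Mor C; tgt C f = src C g\<rbrakk>
      \<Longrightarrow> g \<odot> f \<in> Mor C \<and> src C (g \<odot> f) = src C f \<and> tgt C (g \<odot> f) = tgt C g"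
    and "\<And>f. f \<in> Mor C \<Longrightarrow> id1 C (tgt C f) \<odot> f = f" "\<And>f. f \<in> Mor C \<Longrightarrow> f \<odot> id1 C (src C f) = f"
    and "\<And>f g h. \<lbrakk>f \<in> Mor C; g \<in> Mor C; h \<in> Mor C; tgt C f = src C g; tgt C g = src C h\<rbrakk>
      \<Longrightarrow> (h \<odot> g) \<odot> f = h \<odot> (g \<odot> f)"
    and "\<And>f. f \<in> Mor C \<Longrightarrow> id2 C f \<in> Cell C \<and> dom2 C (id2 C f) = f \<and> cod2 C (id2 C f) = f"
    and "\<And>\<alpha> \<beta>. \<lbrakk>\<alpha> \<in> Cell C; \<beta> \<in> Cell C; cod2 C \<alpha> = dom2 C \<beta>\<rbrakk>
      \<Longrightarrow> \<beta> \<bullet> \<alpha> \<in> Cell C \<and> dom2 C (\<beta> \<bullet> \<alpha>) = dom2 C \<alpha> \<and> cod2 C (\<beta> \<bullet> \<alpha>) = cod2 C \<beta>"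
    and "\<And>\<alpha>. \<alpha> \<in> Cell C \<Longrightarrow> id2 C (cod2 C \<alpha>) \<bullet> \<alpha> = \<alpha>" "\<And>\<alpha>. \<alpha> \<in> Cell C \<Longrightarrow> \<alpha> \<bullet> id2 C (dom2 C \<alpha>) = \<alpha>"
    and "\<And>\<alpha> \<beta> \<gamma>. \<lbrakk>\<alpha> \<in> Cell C; \<beta> \<in> Cell C; \<gamma> \<in> Cell C; cod2 C \<alpha> = dom2 C \<beta>; cod2 C \<beta> = dom2 C \<gamma>\<rbrakk>
      \<Longrightarrow> (\<gamma> \<bullet> \<beta>) \<bullet> \<alpha> = \<gamma> \<bullet> (\<beta> \<bullet> \<alpha>)"
    and "\<And>\<alpha> \<beta>. \<lbrakk>\<alpha> \<in> Cell C; \<beta> \<in> Cell C; tgt C (dom2 C \<alpha>) = src C (dom2 C \<beta>)\<rbrakk>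
      \<Longrightarrow> \<beta> \<star> \<alpha> \<in> Cell C \<and> dom2 C (\<beta> \<star> \<alpha>) = dom2 C \<beta> \<odot> dom2 C \<alpha> \<and> cod2 C (\<beta> \<star> \<alpha>) = cod2 C \<beta> \<odot> cod2 C \<alpha>"
    and "\<And>f g. \<lbrakk>f \<in> Mor C; g \<in> Mor C; tgt C f = src C g\<rbrakk> \<Longrightarrow> id2 C g \<star> id2 C f = id2 C (g \<odot> f)"
    and "\<And>\<alpha> \<alpha>' \<beta> \<beta>'. \<lbrakk>\<alpha> \<in> Cell C; \<alpha>' \<in> Cell C; \<beta> \<in> Cell C; \<beta>' \<in> Cell C; cod2 C \<alpha> = dom2 C \<alpha>';
        cod2 C \<beta> = dom2 C \<beta>'; tgt C (dom2 C \<alpha>) = src C (dom2 C \<beta>)\<rbrakk>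
      \<Longrightarrow> (\<beta>' \<bullet> \<beta>) \<star> (\<alpha>' \<bullet> \<alpha>) = (\<beta>' \<star> \<alpha>') \<bullet> (\<beta> \<star> \<alpha>)"
    and "\<And>\<alpha>. \<alpha> \<in> Cell C \<Longrightarrow> id2 C (id1 C (tgt C (dom2 C \<alpha>))) \<star> \<alpha> = \<alpha>"
    and "\<And>\<alpha>. \<alpha> \<in> Cell C \<Longrightarrow> \<alpha> \<star> id2 C (id1 C (src C (dom2 C \<alpha>))) = \<alpha>"
    and "\<And>\<alpha> \<beta> \<gamma>. \<lbrakk>\<alpha> \<in> Cell C; \<beta> \<in> Cell C; \<gamma> \<in> Cell C; tgt C (dom2 C \<alpha>) = src C (dom2 C \<beta>);
        tgt C (dom2 C \<beta>) = src C (dom2 C \<gamma>)\<rbrakk> \<Longrightarrow> (\<gamma> \<star> \<beta>) \<star> \<alpha> = \<gamma> \<star> (\<beta> \<star> \<alpha>)"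
  shows "two_category C"
proof (rule two_category.intro)
  show "category (cat1 C)"
    by unfold_locales (auto simp: cat1_def arrows_def assms)
  show "category (cat2 C)"
    by unfold_locales (auto simp: cat2_def arrows_def assms)
qed (auto simp: hom1_def hom2_def assms)

lemma op2_sel [simp]:
  "Ob (op2 C) = Ob C" "Mor (op2 C) = Mor C" "Cell (op2 C) = Cell C" "src (op2 C) = tgt C"
  "tgt (op2 C) = src C" "dom2 (op2 C) = dom2 C" "cod2 (op2 C) = cod2 C" "id1 (op2 C) = id1 C"
  "id2 (op2 C) = id2 C" "comp1 (op2 C) g f = comp1 C f g" "vcomp (op2 C) = vcomp C"
  "hcomp (op2 C) \<beta> \<alpha> = hcomp C \<alpha> \<beta>"
  by (simp_all add: op2_def)

lemma prod2_sel [simp]: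
  "Ob (prod2 C D) = Ob C \<times> Ob D" "Mor (prod2 C D) = Mor C \<times> Mor D" "Cell (prod2 C D) = Cell C \<times> Cell D"
  "src (prod2 C D) (f, f') = (src C f, src D f')" "tgt (prod2 C D) (f, f') = (tgt C f, tgt D f')"
  "dom2 (prod2 C D) (\<alpha>, \<alpha>') = (dom2 C \<alpha>, dom2 D \<alpha>')" "cod2 (prod2 C D) (\<alpha>, \<alpha>') = (cod2 C \<alpha>, cod2 D \<alpha>')"
  "id1 (prod2 C D) (X, X') = (id1 C X, id1 D X')" "id2 (prod2 C D) (f, f') = (id2 C f, id2 D f')"
  "comp1 (prod2 C D) (g, g') (f, f') = (comp1 C g f, comp1 D g' f')"
  "vcomp (prod2 C D) (\<beta>, \<beta>') (\<alpha>, \<alpha>') = (vcomp C \<beta> \<alpha>, vcomp D \<beta>' \<alpha>')"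
  "hcomp (prod2 C D) (\<beta>, \<beta>') (\<alpha>, \<alpha>') = (hcomp C \<beta> \<alpha>, hcomp D \<beta>' \<alpha>')"
  by (simp_all add: prod2_def)

lemma two_category_op2:
  assumes "two_category C"
  shows "two_category (op2 C)"
proof -
  interpret two_category C by (rule assms)
  show ?thesis by (rule two_categoryI) (auto simp: interchange')
qed

lemma two_category_prod2:
  assumes "two_category C" "two_category D"
  shows "two_category (prod2 C D)"
proof -
  interpret C: two_category C by (rule assms(1))
  interpret D: two_category D by (rule assms(2))
  show ?thesis by (rule two_categoryI) (auto simp: C.interchange' D.interchange')
qed

definition id_psfun :: "('o, 'm, 'c) twocat \<Rightarrow> ('o, 'm, 'c, 'o, 'm, 'c) psfun" where
  "id_psfun C = \<lparr>ap0 = (\<lambda>X. X), ap1 = (\<lambda>f. f), ap2 = (\<lambda>\<alpha>. \<alpha>), cpt = (\<lambda>a a'. id2 C (a' \<odot>\<^bsub>C\<^esub> a))\<rparr>"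

lemma normal_pseudo_functor_id:
  assumes "two_category C"
  shows "normal_pseudo_functor C C (id_psfun C)"
proof -
  interpret two_category C by (rule assms)
  have "cat_functor (hom_cat C X Y) (hom_cat C X Y) \<lparr>fob = \<lambda>f. f, far = \<lambda>\<alpha>. \<alpha>\<rparr>" for X Y
    using cat_functor_fun_id[OF category_hom_cat] by (simp add: fun_id_def)
  then show ?thesis
    by (intro normal_pseudo_functor.intro two_category_axioms) (auto simp: id_psfun_def hom1_def hom2_def)
qed

text \<open>
  The pseudo-functor \<open>K(L -, R -)\<close>.  Both hom pseudo-functors of a bi-adjunction have this form, with
  an identity pseudo-functor on one side.
\<close>

definition hom_psfun :: "('o, 'm, 'c) twocat \<Rightarrow> ('p, 'n, 'd, 'o, 'm, 'c) psfun
    \<Rightarrow> ('q, 'k, 'e, 'o, 'm, 'c) psfun \<Rightarrow> ('p \<times> 'q, 'n \<times> 'k, 'd \<times> 'e, 'm, 'c) catfun" where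
  "hom_psfun K L R =
    \<lparr>at_ob = (\<lambda>(X, Y). hom_cat K (ap0 L X) (ap0 R Y)),
     at_mor = (\<lambda>(c, d). \<lparr>fob = (\<lambda>g. ap1 R d \<odot>\<^bsub>K\<^esub> (g \<odot>\<^bsub>K\<^esub> ap1 L c)),
                         far = (\<lambda>\<alpha>. id2 K (ap1 R d) \<star>\<^bsub>K\<^esub> (\<alpha> \<star>\<^bsub>K\<^esub> id2 K (ap1 L c)))\<rparr>),
     at_cell = (\<lambda>(\<gamma>, \<delta>) g. ap2 R \<delta> \<star>\<^bsub>K\<^esub> (id2 K g \<star>\<^bsub>K\<^esub> ap2 L \<gamma>)),
     at_cpt = (\<lambda>(c, d) (c', d') g. cpt R d d' \<star>\<^bsub>K\<^esub> (id2 K g \<star>\<^bsub>K\<^esub> cpt L c' c))\<rparr>"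

lemma hom_right_eq: "hom_right C R = hom_psfun C (id_psfun C) R"
  by (simp add: hom_right_def hom_psfun_def id_psfun_def)

lemma hom_left_eq: "hom_left D L = hom_psfun D L (id_psfun D)"
  by (simp add: hom_left_def hom_psfun_def id_psfun_def)

locale hom_setting =
  L: normal_pseudo_functor A K L + R: normal_pseudo_functor B K R
  for A :: "('p, 'n, 'd) twocat" and B :: "('q, 'k, 'e) twocat" and K :: "('o, 'm, 'c) twocat"
    and L :: "('p, 'n, 'd, 'o, 'm, 'c) psfun" and R :: "('q, 'k, 'e, 'o, 'm, 'c) psfun"
begin

lemma hom_psfun_at_mor:
  assumes c: "c \<in> Mor A" and d: "d \<in> Mor B"
  shows "cat_functor (hom_cat K (ap0 L (tgt A c)) (ap0 R (src B d)))
    (hom_cat K (ap0 L (src A c)) (ap0 R (tgt B d))) (at_mor (hom_psfun K L R) (c, d))"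
  by (intro cat_functor.intro L.B.category_hom_cat)
    (use assms in \<open>auto simp: hom_psfun_def L.B.arrows_hom_cat hom1_def hom2_def L.B.whisker_left_vcomp
      L.B.whisker_right_vcomp split: if_splits\<close>)

lemma hom_psfun_at_cell:
  assumes \<gamma>: "\<gamma> \<in> Cell A" and \<delta>: "\<delta> \<in> Cell B"
  shows "nat_trans (hom_cat K (ap0 L (tgt A (dom2 A \<gamma>))) (ap0 R (src B (dom2 B \<delta>))))
    (hom_cat K (ap0 L (src A (dom2 A \<gamma>))) (ap0 R (tgt B (dom2 B \<delta>))))
    (at_mor (hom_psfun K L R) (dom2 A \<gamma>, dom2 B \<delta>)) (at_mor (hom_psfun K L R) (cod2 A \<gamma>, cod2 B \<delta>))
    (at_cell (hom_psfun K L R) (\<gamma>, \<delta>))"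
proof -
  have F: "cat_functor (hom_cat K (ap0 L (tgt A (dom2 A \<gamma>))) (ap0 R (src B (dom2 B \<delta>))))
      (hom_cat K (ap0 L (src A (dom2 A \<gamma>))) (ap0 R (tgt B (dom2 B \<delta>))))
      (at_mor (hom_psfun K L R) (dom2 A \<gamma>, dom2 B \<delta>))"
    using hom_psfun_at_mor[of "dom2 A \<gamma>" "dom2 B \<delta>"] assms by simp
  have G: "cat_functor (hom_cat K (ap0 L (tgt A (dom2 A \<gamma>))) (ap0 R (src B (dom2 B \<delta>))))
      (hom_cat K (ap0 L (src A (dom2 A \<gamma>))) (ap0 R (tgt B (dom2 B \<delta>))))
      (at_mor (hom_psfun K L R) (cod2 A \<gamma>, cod2 B \<delta>))"
    using hom_psfun_at_mor[of "cod2 A \<gamma>" "cod2 B \<delta>"] assms by simp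
  show ?thesis
    by (intro nat_trans.intro F G nat_trans_axioms.intro)
      (use assms in \<open>auto simp: hom_psfun_def L.B.arrows_hom_cat hom1_def hom2_def L.B.interchange'
        split: if_splits\<close>)
qed

lemma hom_psfun_at_cpt:
  assumes c: "c \<in> Mor A" "c' \<in> Mor A" "tgt A c' = src A c"
    and d: "d \<in> Mor B" "d' \<in> Mor B" "tgt B d = src B d'"
  shows "nat_iso (hom_cat K (ap0 L (tgt A c)) (ap0 R (src B d))) (hom_cat K (ap0 L (src A c')) (ap0 R (tgt B d')))
    (fun_comp (at_mor (hom_psfun K L R) (c', d')) (at_mor (hom_psfun K L R) (c, d)))
    (at_mor (hom_psfun K L R) (c \<odot>\<^bsub>A\<^esub> c', d' \<odot>\<^bsub>B\<^esub> d)) (at_cpt (hom_psfun K L R) (c, d) (c', d'))"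
proof -
  note F = hom_psfun_at_mor[OF c(1) d(1)] and F' = hom_psfun_at_mor[OF c(2) d(2)]
  have G: "cat_functor (hom_cat K (ap0 L (tgt A c)) (ap0 R (src B d)))
      (hom_cat K (ap0 L (src A c')) (ap0 R (tgt B d')))
      (at_mor (hom_psfun K L R) (c \<odot>\<^bsub>A\<^esub> c', d' \<odot>\<^bsub>B\<^esub> d))"
    using hom_psfun_at_mor[of "c \<odot>\<^bsub>A\<^esub> c'" "d' \<odot>\<^bsub>B\<^esub> d"] assms by simp
  have FF: "cat_functor (hom_cat K (ap0 L (tgt A c)) (ap0 R (src B d)))
      (hom_cat K (ap0 L (src A c')) (ap0 R (tgt B d')))
      (fun_comp (at_mor (hom_psfun K L R) (c', d')) (at_mor (hom_psfun K L R) (c, d)))"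
    using cat_functor_fun_comp[OF F] F' assms by simp
  show ?thesis
  proof (intro nat_iso.intro nat_trans.intro FF G nat_trans_axioms.intro nat_iso_axioms.intro, goal_cases)
    case (1 g)
    then show ?case
      using assms by (auto simp: hom_psfun_def fun_comp_def L.B.arrows_hom_cat hom1_def hom2_def)
  next
    case (2 \<alpha> g h)
    then have \<alpha>: "\<alpha> \<in> Cell K" "src K (dom2 K \<alpha>) = ap0 L (tgt A c)" "tgt K (dom2 K \<alpha>) = ap0 R (src B d)"
        "dom2 K \<alpha> = g" "cod2 K \<alpha> = h"
      by (auto simp: L.B.arrows_hom_cat hom1_def hom2_def split: if_splits)
    have gh: "h \<in> Mor K" "g \<in> Mor K" "src K h = ap0 L (tgt A c)" "tgt K h = ap0 R (src B d)"
      using \<alpha> L.B.cod2_Mor[of \<alpha>] L.B.dom2_Mor[of \<alpha>] L.B.src_cod2[of \<alpha>] L.B.tgt_cod2[of \<alpha>] by simp_all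
    have "id2 K (ap1 R d') \<star>\<^bsub>K\<^esub> ((id2 K (ap1 R d) \<star>\<^bsub>K\<^esub> (\<alpha> \<star>\<^bsub>K\<^esub> id2 K (ap1 L c))) \<star>\<^bsub>K\<^esub> id2 K (ap1 L c'))
        = id2 K (ap1 R d' \<odot>\<^bsub>K\<^esub> ap1 R d) \<star>\<^bsub>K\<^esub> (\<alpha> \<star>\<^bsub>K\<^esub> id2 K (ap1 L c \<odot>\<^bsub>K\<^esub> ap1 L c'))"
      using \<alpha> gh assms by (simp add: L.B.whisker_comp1)
    moreover have "(id2 K (ap1 R (d' \<odot>\<^bsub>B\<^esub> d)) \<star>\<^bsub>K\<^esub> (\<alpha> \<star>\<^bsub>K\<^esub> id2 K (ap1 L (c \<odot>\<^bsub>A\<^esub> c')))) \<bullet>\<^bsub>K\<^esub>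
          (cpt R d d' \<star>\<^bsub>K\<^esub> (id2 K g \<star>\<^bsub>K\<^esub> cpt L c' c))
        = (cpt R d d' \<star>\<^bsub>K\<^esub> (id2 K h \<star>\<^bsub>K\<^esub> cpt L c' c)) \<bullet>\<^bsub>K\<^esub>
          (id2 K (ap1 R d' \<odot>\<^bsub>K\<^esub> ap1 R d) \<star>\<^bsub>K\<^esub> (\<alpha> \<star>\<^bsub>K\<^esub> id2 K (ap1 L c \<odot>\<^bsub>K\<^esub> ap1 L c')))"
      using \<alpha> gh assms by (simp add: L.B.interchange')
    ultimately show ?case
      by (simp only: hom_psfun_def fun_comp_def L.B.hom_cat_sel catfun.simps fun_data.simps prod.case o_def)
  next
    case (3 g)
    then show ?case
      using assms by (subst L.B.is_iso_hom_cat) (auto simp: hom_psfun_def hom1_def L.B.is_iso_hom_cat)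
  qed
qed

text \<open>
  In the coherence laws every factor is regrouped as a horizontal composite of a 2-cell from \<open>R\<close>, the
  identity of \<open>g\<close> and a 2-cell from \<open>L\<close>.  By interchange the laws then split into the corresponding
  laws of \<open>R\<close> and of \<open>L\<close>.
\<close>

lemma hom_psfun_at_cpt_natural:
  assumes \<gamma>: "\<gamma> \<in> Cell A" "\<gamma>' \<in> Cell A" "tgt A (dom2 A \<gamma>') = src A (dom2 A \<gamma>)"
    and \<delta>: "\<delta> \<in> Cell B" "\<delta>' \<in> Cell B" "tgt B (dom2 B \<delta>) = src B (dom2 B \<delta>')"
    and c: "dom2 A \<gamma> = c" "dom2 A \<gamma>' = c'" "cod2 A \<gamma> = b" "cod2 A \<gamma>' = b'"
    and d: "dom2 B \<delta> = d" "dom2 B \<delta>' = d'" "cod2 B \<delta> = e" "cod2 B \<delta>' = e'"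
    and g: "g \<in> Mor K" "src K g = ap0 L (tgt A c)" "tgt K g = ap0 R (src B d)"
  shows "(cpt R e e' \<star>\<^bsub>K\<^esub> (id2 K g \<star>\<^bsub>K\<^esub> cpt L b' b)) \<bullet>\<^bsub>K\<^esub>
      ((ap2 R \<delta>' \<star>\<^bsub>K\<^esub> (id2 K (ap1 R e \<odot>\<^bsub>K\<^esub> (g \<odot>\<^bsub>K\<^esub> ap1 L b)) \<star>\<^bsub>K\<^esub> ap2 L \<gamma>')) \<bullet>\<^bsub>K\<^esub>
       (id2 K (ap1 R d') \<star>\<^bsub>K\<^esub> ((ap2 R \<delta> \<star>\<^bsub>K\<^esub> (id2 K g \<star>\<^bsub>K\<^esub> ap2 L \<gamma>)) \<star>\<^bsub>K\<^esub> id2 K (ap1 L c'))))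
    = (ap2 R (\<delta>' \<star>\<^bsub>B\<^esub> \<delta>) \<star>\<^bsub>K\<^esub> (id2 K g \<star>\<^bsub>K\<^esub> ap2 L (\<gamma> \<star>\<^bsub>A\<^esub> \<gamma>'))) \<bullet>\<^bsub>K\<^esub>
      (cpt R d d' \<star>\<^bsub>K\<^esub> (id2 K g \<star>\<^bsub>K\<^esub> cpt L c' c))"
proof -
  have Ac: "c \<in> Mor A" "b \<in> Mor A" "c' \<in> Mor A" "b' \<in> Mor A" "src A b = src A c" "tgt A b = tgt A c"
      "src A b' = src A c'" "tgt A b' = tgt A c'" "tgt A c' = src A c"
    using \<gamma> c L.A.dom2_Mor[of \<gamma>] L.A.cod2_Mor[of \<gamma>] L.A.dom2_Mor[of \<gamma>'] L.A.cod2_Mor[of \<gamma>']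
      L.A.src_cod2[of \<gamma>] L.A.tgt_cod2[of \<gamma>] L.A.src_cod2[of \<gamma>'] L.A.tgt_cod2[of \<gamma>'] by metis+
  have Bd: "d \<in> Mor B" "e \<in> Mor B" "d' \<in> Mor B" "e' \<in> Mor B" "src B e = src B d" "tgt B e = tgt B d"
      "src B e' = src B d'" "tgt B e' = tgt B d'" "tgt B d = src B d'"
    using \<delta> d R.A.dom2_Mor[of \<delta>] R.A.cod2_Mor[of \<delta>] R.A.dom2_Mor[of \<delta>'] R.A.cod2_Mor[of \<delta>']
      R.A.src_cod2[of \<delta>] R.A.tgt_cod2[of \<delta>] R.A.src_cod2[of \<delta>'] R.A.tgt_cod2[of \<delta>'] by metis+
  have t: "L.B.iso2 (cpt L b' b)" "L.B.iso2 (cpt R e e')" using Ac Bd by simp_all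
  have 1: "(ap2 R \<delta>' \<star>\<^bsub>K\<^esub> (id2 K (ap1 R e \<odot>\<^bsub>K\<^esub> (g \<odot>\<^bsub>K\<^esub> ap1 L b)) \<star>\<^bsub>K\<^esub> ap2 L \<gamma>'))
      = (ap2 R \<delta>' \<star>\<^bsub>K\<^esub> id2 K (ap1 R e)) \<star>\<^bsub>K\<^esub> (id2 K g \<star>\<^bsub>K\<^esub> (id2 K (ap1 L b) \<star>\<^bsub>K\<^esub> ap2 L \<gamma>'))"
    using Ac Bd \<gamma> \<delta> c d g by (simp add: L.B.whisker_comp1)
  have 2: "(id2 K (ap1 R d') \<star>\<^bsub>K\<^esub> ((ap2 R \<delta> \<star>\<^bsub>K\<^esub> (id2 K g \<star>\<^bsub>K\<^esub> ap2 L \<gamma>)) \<star>\<^bsub>K\<^esub> id2 K (ap1 L c')))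
      = (id2 K (ap1 R d') \<star>\<^bsub>K\<^esub> ap2 R \<delta>) \<star>\<^bsub>K\<^esub> (id2 K g \<star>\<^bsub>K\<^esub> (ap2 L \<gamma> \<star>\<^bsub>K\<^esub> id2 K (ap1 L c')))"
    using Ac Bd \<gamma> \<delta> c d g by (simp add: L.B.whisker_comp1)
  have "(ap2 R \<delta>' \<star>\<^bsub>K\<^esub> (id2 K (ap1 R e \<odot>\<^bsub>K\<^esub> (g \<odot>\<^bsub>K\<^esub> ap1 L b)) \<star>\<^bsub>K\<^esub> ap2 L \<gamma>')) \<bullet>\<^bsub>K\<^esub>
       (id2 K (ap1 R d') \<star>\<^bsub>K\<^esub> ((ap2 R \<delta> \<star>\<^bsub>K\<^esub> (id2 K g \<star>\<^bsub>K\<^esub> ap2 L \<gamma>)) \<star>\<^bsub>K\<^esub> id2 K (ap1 L c')))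
     = (ap2 R \<delta>' \<star>\<^bsub>K\<^esub> ap2 R \<delta>) \<star>\<^bsub>K\<^esub> (id2 K g \<star>\<^bsub>K\<^esub> (ap2 L \<gamma> \<star>\<^bsub>K\<^esub> ap2 L \<gamma>'))"
    unfolding 1 2 using Ac Bd \<gamma> \<delta> c d g by (simp add: L.B.interchange' del: L.B.hcomp_assoc')
  then show ?thesis
    using Ac Bd \<gamma> \<delta> c d g L.cpt_natural'[of \<gamma>' \<gamma>] R.cpt_natural'[of \<delta> \<delta>']
    by (simp add: L.B.interchange' del: L.B.hcomp_assoc')
qed

lemma hom_psfun_at_cpt_assoc:
  assumes c: "c \<in> Mor A" "c' \<in> Mor A" "c'' \<in> Mor A" "tgt A c'' = src A c'" "tgt A c' = src A c"
    and d: "d \<in> Mor B" "d' \<in> Mor B" "d'' \<in> Mor B" "tgt B d = src B d'" "tgt B d' = src B d''"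
    and g: "g \<in> Mor K" "src K g = ap0 L (tgt A c)" "tgt K g = ap0 R (src B d)"
  shows "(cpt R d (d'' \<odot>\<^bsub>B\<^esub> d') \<star>\<^bsub>K\<^esub> (id2 K g \<star>\<^bsub>K\<^esub> cpt L (c' \<odot>\<^bsub>A\<^esub> c'') c)) \<bullet>\<^bsub>K\<^esub>
      (cpt R d' d'' \<star>\<^bsub>K\<^esub> (id2 K (ap1 R d \<odot>\<^bsub>K\<^esub> (g \<odot>\<^bsub>K\<^esub> ap1 L c)) \<star>\<^bsub>K\<^esub> cpt L c'' c'))
    = (cpt R (d' \<odot>\<^bsub>B\<^esub> d) d'' \<star>\<^bsub>K\<^esub> (id2 K g \<star>\<^bsub>K\<^esub> cpt L c'' (c \<odot>\<^bsub>A\<^esub> c'))) \<bullet>\<^bsub>K\<^esub>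
      (id2 K (ap1 R d'') \<star>\<^bsub>K\<^esub> ((cpt R d d' \<star>\<^bsub>K\<^esub> (id2 K g \<star>\<^bsub>K\<^esub> cpt L c' c)) \<star>\<^bsub>K\<^esub> id2 K (ap1 L c'')))"
proof -
  have 1: "cpt R d' d'' \<star>\<^bsub>K\<^esub> (id2 K (ap1 R d \<odot>\<^bsub>K\<^esub> (g \<odot>\<^bsub>K\<^esub> ap1 L c)) \<star>\<^bsub>K\<^esub> cpt L c'' c')
      = (cpt R d' d'' \<star>\<^bsub>K\<^esub> id2 K (ap1 R d)) \<star>\<^bsub>K\<^esub> (id2 K g \<star>\<^bsub>K\<^esub> (id2 K (ap1 L c) \<star>\<^bsub>K\<^esub> cpt L c'' c'))"
    using assms by (simp add: L.B.whisker_comp1)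
  have 2: "id2 K (ap1 R d'') \<star>\<^bsub>K\<^esub> ((cpt R d d' \<star>\<^bsub>K\<^esub> (id2 K g \<star>\<^bsub>K\<^esub> cpt L c' c)) \<star>\<^bsub>K\<^esub> id2 K (ap1 L c''))
      = (id2 K (ap1 R d'') \<star>\<^bsub>K\<^esub> cpt R d d') \<star>\<^bsub>K\<^esub> (id2 K g \<star>\<^bsub>K\<^esub> (cpt L c' c \<star>\<^bsub>K\<^esub> id2 K (ap1 L c'')))"
    using assms by (simp add: L.B.whisker_comp1)
  show ?thesis
    unfolding 1 2 using assms L.cpt_assoc'[of c'' c' c] R.cpt_assoc'[of d d' d'']
    by (simp add: L.B.interchange' del: L.B.hcomp_assoc')
qed

lemma cat_valued_hom_psfun: "cat_valued_pseudo_functor (prod2 (op2 A) B) (hom_psfun K L R)"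
proof (rule cat_valued_pseudo_functor.intro, goal_cases)
  case 1
  show ?case
    by (intro two_category_prod2 two_category_op2 L.A.two_category_axioms R.A.two_category_axioms)
next
  case (2 X)
  show ?case by (cases X) (simp add: hom_psfun_def L.B.category_hom_cat)
next
  case (3 a X Y)
  then show ?case
    using hom_psfun_at_mor[of "fst a" "snd a"]
    by (cases a) (auto simp: hom1_def hom_psfun_def)
next
  case (4 a X Y \<alpha> b)
  then show ?case
    using hom_psfun_at_cell[of "fst \<alpha>" "snd \<alpha>"]
    by (cases \<alpha>) (auto simp: hom1_def hom2_def hom_psfun_def)
next
  case (5 a X Y x)
  then show ?case by (auto simp: hom1_def hom2_def hom_psfun_def)
next
  case (6 a X Y \<alpha> b \<beta> c x)
  then show ?case by (auto simp: hom1_def hom2_def hom_psfun_def L.B.interchange')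
next
  case (7 X x)
  then show ?case by (auto simp: hom1_def hom_psfun_def)
next
  case (8 X x)
  then show ?case by (auto simp: hom1_def hom_psfun_def)
next
  case (9 a X Y a' Z)
  then show ?case
    using hom_psfun_at_cpt[of "fst a" "fst a'" "snd a" "snd a'"]
    by (cases a; cases a') (auto simp: hom1_def hom_psfun_def)
next
  case (10 a X Y a' Z \<alpha> b \<alpha>' b' x)
  then show ?case
    using hom_psfun_at_cpt_natural[of "fst \<alpha>" "fst \<alpha>'" "snd \<alpha>" "snd \<alpha>'" "fst a" "fst a'" "fst b" "fst b'"
        "snd a" "snd a'" "snd b" "snd b'" x]
    by (cases \<alpha>; cases \<alpha>') (auto simp: hom1_def hom2_def hom_psfun_def)
next
  case (11 a W X a' Y a'' Z x)
  then show ?case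
    using hom_psfun_at_cpt_assoc[of "fst a" "fst a'" "fst a''" "snd a" "snd a'" "snd a''" x]
    by (cases a; cases a'; cases a'') (auto simp: hom1_def hom_psfun_def)
next
  case (12 a X Y x)
  then show ?case by (auto simp: hom1_def hom_psfun_def)
next
  case (13 a X Y x)
  then show ?case by (auto simp: hom1_def hom_psfun_def)
qed

end


section \<open>Pseudo-slices and bi-initial objects\<close>

lemma (in two_category) inv2_vcomp_rev:
  assumes "iso2 \<alpha>" "iso2 \<beta>" "cod2 C \<alpha> = dom2 C \<beta>"
  shows "inv2 (\<beta> \<bullet> \<alpha>) = inv2 \<alpha> \<bullet> inv2 \<beta>"
  by (rule inv2_unique) (use assms iso2_Cell[OF assms(1)] iso2_Cell[OF assms(2)] in simp_all)

lemma coslice_sel: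
  "(X, f) \<in> Ob (pseudo_coslice A I) \<longleftrightarrow> X \<in> Ob A \<and> f \<in> hom1 A I X"
  "((X, f), (X', f'), a, \<psi>) \<in> Mor (pseudo_coslice A I) \<longleftrightarrow> X \<in> Ob A \<and> f \<in> hom1 A I X \<and> X' \<in> Ob A
    \<and> f' \<in> hom1 A I X' \<and> a \<in> hom1 A X X' \<and> \<psi> \<in> hom2 A f' (a \<odot>\<^bsub>A\<^esub> f) \<and> is_iso (cat2 A) \<psi>"
  "(((X, f), p', a, \<psi>), (q, q', b, \<phi>), \<beta>) \<in> Cell (pseudo_coslice A I) \<longleftrightarrow>
    ((X, f), p', a, \<psi>) \<in> Mor (pseudo_coslice A I) \<and> (q, q', b, \<phi>) \<in> Mor (pseudo_coslice A I)
    \<and> (X, f) = q \<and> p' = q' \<and> \<beta> \<in> hom2 A a b \<and> (\<beta> \<star>\<^bsub>A\<^esub> id2 A f) \<bullet>\<^bsub>A\<^esub> \<psi> = \<phi>"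
  "src (pseudo_coslice A I) (p, q, a, \<psi>) = p" "tgt (pseudo_coslice A I) (p, q, a, \<psi>) = q"
  "dom2 (pseudo_coslice A I) (m, n, \<beta>) = m" "cod2 (pseudo_coslice A I) (m, n, \<beta>) = n"
  "id1 (pseudo_coslice A I) (X, f) = ((X, f), (X, f), id1 A X, id2 A f)"
  "id2 (pseudo_coslice A I) (p, q, a, \<psi>) = ((p, q, a, \<psi>), (p, q, a, \<psi>), id2 A a)"
  "comp1 (pseudo_coslice A I) (p', q', a', \<psi>') (p, q, a, \<psi>)
    = (p, q', a' \<odot>\<^bsub>A\<^esub> a, (id2 A a' \<star>\<^bsub>A\<^esub> \<psi>) \<bullet>\<^bsub>A\<^esub> \<psi>')"
  "vcomp (pseudo_coslice A I) (m', n', \<beta>') (m, n, \<beta>) = (m, n', \<beta>' \<bullet>\<^bsub>A\<^esub> \<beta>)"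
  "hcomp (pseudo_coslice A I) (m', n', \<beta>') (m, n, \<beta>) = (comp1 (pseudo_coslice A I) m' m,
    comp1 (pseudo_coslice A I) n' n, \<beta>' \<star>\<^bsub>A\<^esub> \<beta>)"
  unfolding pseudo_coslice_def by (auto simp: Let_def)

lemma coslice_CellE:
  assumes "\<alpha> \<in> Cell (pseudo_coslice A I)"
  obtains X f X' f' a \<psi> b \<beta> where
    "\<alpha> = (((X, f), (X', f'), a, \<psi>), ((X, f), (X', f'), b, (\<beta> \<star>\<^bsub>A\<^esub> id2 A f) \<bullet>\<^bsub>A\<^esub> \<psi>), \<beta>)"
    "((X, f), (X', f'), a, \<psi>) \<in> Mor (pseudo_coslice A I)"
    "((X, f), (X', f'), b, (\<beta> \<star>\<^bsub>A\<^esub> id2 A f) \<bullet>\<^bsub>A\<^esub> \<psi>) \<in> Mor (pseudo_coslice A I)"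
    "\<beta> \<in> hom2 A a b"
proof -
  obtain p p' a \<psi> q q' b \<phi> \<beta> where \<alpha>: "\<alpha> = ((p, p', a, \<psi>), (q, q', b, \<phi>), \<beta>)"
    by (cases \<alpha>) auto
  obtain X f X' f' where "p = (X, f)" "p' = (X', f')" by (cases p; cases p')
  with \<alpha> assms that[of X f X' f' a \<psi> b \<beta>] show thesis by (simp add: coslice_sel(3)) blast
qed

lemma coslice_Cell_boundary:
  assumes "(m, n, \<beta>) \<in> Cell (pseudo_coslice A I)"
  shows "m \<in> Mor (pseudo_coslice A I)" "n \<in> Mor (pseudo_coslice A I)"
    "src (pseudo_coslice A I) n = src (pseudo_coslice A I) m"
    "tgt (pseudo_coslice A I) n = tgt (pseudo_coslice A I) m"
    "\<beta> \<in> Cell A" "src A (dom2 A \<beta>) = fst (src (pseudo_coslice A I) m)"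
    "tgt A (dom2 A \<beta>) = fst (tgt (pseudo_coslice A I) m)"
  by (rule coslice_CellE[OF assms], simp add: coslice_sel hom1_def hom2_def)+

lemma two_category_coslice:
  assumes "two_category A"
  shows "two_category (pseudo_coslice A I)"
proof -
  interpret A: two_category A by (rule assms)
  have hcomp_cell: "(\<beta>' \<star>\<^bsub>A\<^esub> (\<beta> \<star>\<^bsub>A\<^esub> id2 A f)) \<bullet>\<^bsub>A\<^esub> ((id2 A a' \<star>\<^bsub>A\<^esub> \<psi>) \<bullet>\<^bsub>A\<^esub> \<psi>')
      = (id2 A b' \<star>\<^bsub>A\<^esub> ((\<beta> \<star>\<^bsub>A\<^esub> id2 A f) \<bullet>\<^bsub>A\<^esub> \<psi>)) \<bullet>\<^bsub>A\<^esub> ((\<beta>' \<star>\<^bsub>A\<^esub> id2 A f') \<bullet>\<^bsub>A\<^esub> \<psi>')"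
    if "\<beta> \<in> Cell A" "\<beta>' \<in> Cell A" "\<psi> \<in> Cell A" "\<psi>' \<in> Cell A" "f \<in> Mor A" "f' \<in> Mor A" "f'' \<in> Mor A"
      "tgt A f = src A (dom2 A \<beta>)" "tgt A (dom2 A \<beta>) = src A (dom2 A \<beta>')" "dom2 A \<psi> = f'"
      "cod2 A \<psi> = dom2 A \<beta> \<odot>\<^bsub>A\<^esub> f" "tgt A f' = src A (dom2 A \<beta>')" "dom2 A \<psi>' = f''"
      "cod2 A \<psi>' = dom2 A \<beta>' \<odot>\<^bsub>A\<^esub> f'" "dom2 A \<beta>' = a'" "cod2 A \<beta>' = b'"
    for \<beta> \<beta>' \<psi> \<psi>' f f' f'' a' b'
  proof -
    have ab: "a' \<in> Mor A" "b' \<in> Mor A" "src A b' = src A a'" "tgt A b' = tgt A a'"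
      using that A.dom2_Mor[of \<beta>'] A.cod2_Mor[of \<beta>'] A.src_cod2[of \<beta>'] A.tgt_cod2[of \<beta>'] by metis+
    let ?\<phi> = "(\<beta> \<star>\<^bsub>A\<^esub> id2 A f) \<bullet>\<^bsub>A\<^esub> \<psi>"
    have "(id2 A b' \<star>\<^bsub>A\<^esub> ?\<phi>) \<bullet>\<^bsub>A\<^esub> ((\<beta>' \<star>\<^bsub>A\<^esub> id2 A f') \<bullet>\<^bsub>A\<^esub> \<psi>') = (\<beta>' \<star>\<^bsub>A\<^esub> ?\<phi>) \<bullet>\<^bsub>A\<^esub> \<psi>'"
      using that ab by (intro A.vcomp_replace) (simp_all add: A.interchange')
    also have "\<dots> = (\<beta>' \<star>\<^bsub>A\<^esub> (\<beta> \<star>\<^bsub>A\<^esub> id2 A f)) \<bullet>\<^bsub>A\<^esub> ((id2 A a' \<star>\<^bsub>A\<^esub> \<psi>) \<bullet>\<^bsub>A\<^esub> \<psi>')"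
      using that ab by (intro A.vcomp_replace[symmetric]) (simp_all add: A.interchange')
    finally show ?thesis by simp
  qed
  let ?S = "pseudo_coslice A I"
  have assoc: "comp1 ?S (comp1 ?S h g) f = comp1 ?S h (comp1 ?S g f)"
    if "f \<in> Mor ?S" "g \<in> Mor ?S" "h \<in> Mor ?S" "tgt ?S f = src ?S g" "tgt ?S g = src ?S h" for f g h
    using that by (cases f; cases g; cases h)
      (auto simp: coslice_sel hom1_def hom2_def A.whisker_left_vcomp A.whisker_comp1)
  show ?thesis
  proof (rule two_categoryI, goal_cases)
    case (10 f g h)
    then show ?case by (rule assoc)
  next
    case (21 \<alpha> \<beta> \<gamma>)
    obtain m n \<alpha>0 m' n' \<beta>0 m'' n'' \<gamma>0 where
      c: "\<alpha> = (m, n, \<alpha>0)" "\<beta> = (m', n', \<beta>0)" "\<gamma> = (m'', n'', \<gamma>0)"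
      by (cases \<alpha>; cases \<beta>; cases \<gamma>)
    note b = coslice_Cell_boundary[OF 21(1)[unfolded c]] coslice_Cell_boundary[OF 21(2)[unfolded c]]
      coslice_Cell_boundary[OF 21(3)[unfolded c]]
    show ?case
      using b 21(4,5) unfolding c coslice_sel by (simp add: assoc)
  next
    case (12 \<alpha> \<beta>)
    then show ?case by (cases \<alpha>; cases \<beta>) (auto simp: coslice_sel hom1_def hom2_def A.whisker_right_vcomp)
  next
    case (16 \<alpha> \<beta>)
    from 16(1) show ?case
    proof (cases rule: coslice_CellE)
      case \<alpha>: (1 X f X' f' a \<psi> b \<alpha>0)
      from 16(2) show ?thesis
      proof (cases rule: coslice_CellE)
        case \<beta>: (1 Z h Z' h' a' \<psi>' b' \<beta>0)
        have "Z = X'" "h = f'" using 16(3) \<alpha>(1) \<beta>(1) by (simp_all add: coslice_sel)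
        then show ?thesis
          using \<alpha> \<beta> hcomp_cell[of \<alpha>0 \<beta>0 \<psi> \<psi>' f f' h' a' b'] by (simp add: coslice_sel hom1_def hom2_def)
      qed
    qed
  next
    case (18 \<alpha> \<alpha>' \<beta> \<beta>')
    then show ?case by (cases \<alpha>; cases \<alpha>'; cases \<beta>; cases \<beta>') (auto simp: coslice_sel hom1_def hom2_def A.interchange')
  qed (auto simp: coslice_sel hom1_def hom2_def)
qed

lemma slice_sel:
  "(X, f) \<in> Ob (pseudo_slice C D L Y) \<longleftrightarrow> X \<in> Ob C \<and> f \<in> hom1 D (ap0 L X) Y"
  "((X, f), (X', f'), c, \<psi>) \<in> Mor (pseudo_slice C D L Y) \<longleftrightarrow> X \<in> Ob C \<and> f \<in> hom1 D (ap0 L X) Y \<and> X' \<in> Ob C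
    \<and> f' \<in> hom1 D (ap0 L X') Y \<and> c \<in> hom1 C X X' \<and> \<psi> \<in> hom2 D (f' \<odot>\<^bsub>D\<^esub> ap1 L c) f \<and> is_iso (cat2 D) \<psi>"
  "((p, (X', f'), c, \<psi>), (q, q', d, \<phi>), \<beta>) \<in> Cell (pseudo_slice C D L Y) \<longleftrightarrow>
    (p, (X', f'), c, \<psi>) \<in> Mor (pseudo_slice C D L Y) \<and> (q, q', d, \<phi>) \<in> Mor (pseudo_slice C D L Y)
    \<and> p = q \<and> (X', f') = q' \<and> \<beta> \<in> hom2 C c d \<and> \<phi> \<bullet>\<^bsub>D\<^esub> (id2 D f' \<star>\<^bsub>D\<^esub> ap2 L \<beta>) = \<psi>"
  "src (pseudo_slice C D L Y) (p, q, c, \<psi>) = p" "tgt (pseudo_slice C D L Y) (p, q, c, \<psi>) = q"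
  "dom2 (pseudo_slice C D L Y) (m, n, \<beta>) = m" "cod2 (pseudo_slice C D L Y) (m, n, \<beta>) = n"
  "id1 (pseudo_slice C D L Y) (X, f) = ((X, f), (X, f), id1 C X, id2 D f)"
  "id2 (pseudo_slice C D L Y) (p, q, c, \<psi>) = ((p, q, c, \<psi>), (p, q, c, \<psi>), id2 C c)"
  "comp1 (pseudo_slice C D L Y) (p', (X'', f''), c', \<psi>') (p, q, c, \<psi>) = (p, (X'', f''), c' \<odot>\<^bsub>C\<^esub> c,
    \<psi> \<bullet>\<^bsub>D\<^esub> (\<psi>' \<star>\<^bsub>D\<^esub> id2 D (ap1 L c)) \<bullet>\<^bsub>D\<^esub> (id2 D f'' \<star>\<^bsub>D\<^esub> the_inverse (cat2 D) (cpt L c c')))"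
  "vcomp (pseudo_slice C D L Y) (m', n', \<beta>') (m, n, \<beta>) = (m, n', \<beta>' \<bullet>\<^bsub>C\<^esub> \<beta>)"
  "hcomp (pseudo_slice C D L Y) (m', n', \<beta>') (m, n, \<beta>) = (comp1 (pseudo_slice C D L Y) m' m,
    comp1 (pseudo_slice C D L Y) n' n, \<beta>' \<star>\<^bsub>C\<^esub> \<beta>)"
  unfolding pseudo_slice_def by (auto simp: Let_def)

lemma slice_MorE:
  assumes "m \<in> Mor (pseudo_slice C D L Y)"
  obtains X f X' f' c \<psi> where "m = ((X, f), (X', f'), c, \<psi>)" "X \<in> Ob C" "f \<in> hom1 D (ap0 L X) Y"
    "X' \<in> Ob C" "f' \<in> hom1 D (ap0 L X') Y" "c \<in> hom1 C X X'" "\<psi> \<in> hom2 D (f' \<odot>\<^bsub>D\<^esub> ap1 L c) f"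
    "is_iso (cat2 D) \<psi>"
proof -
  obtain p q c \<psi> where m: "m = (p, q, c, \<psi>)" by (cases m) auto
  obtain X f X' f' where "p = (X, f)" "q = (X', f')" by (cases p; cases q)
  with m assms that[of X f X' f' c \<psi>] show thesis by (simp add: slice_sel(2))
qed

lemma slice_CellE:
  assumes "\<alpha> \<in> Cell (pseudo_slice C D L Y)"
  obtains X f X' f' c d \<phi> \<beta> where
    "\<alpha> = (((X, f), (X', f'), c, \<phi> \<bullet>\<^bsub>D\<^esub> (id2 D f' \<star>\<^bsub>D\<^esub> ap2 L \<beta>)), ((X, f), (X', f'), d, \<phi>), \<beta>)"
    "((X, f), (X', f'), c, \<phi> \<bullet>\<^bsub>D\<^esub> (id2 D f' \<star>\<^bsub>D\<^esub> ap2 L \<beta>)) \<in> Mor (pseudo_slice C D L Y)"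
    "((X, f), (X', f'), d, \<phi>) \<in> Mor (pseudo_slice C D L Y)"
    "\<beta> \<in> hom2 C c d"
proof -
  obtain p p' c \<psi> q q' d \<phi> \<beta> where \<alpha>: "\<alpha> = ((p, p', c, \<psi>), (q, q', d, \<phi>), \<beta>)"
    by (cases \<alpha>) auto
  obtain X f X' f' where "p = (X, f)" "p' = (X', f')" by (cases p; cases p')
  with \<alpha> assms that[of X f X' f' c \<phi> \<beta> d] show thesis by (simp add: slice_sel(3)) blast
qed

lemma slice_Cell_boundary:
  assumes "(m, n, \<beta>) \<in> Cell (pseudo_slice C D L Y)"
  shows "m \<in> Mor (pseudo_slice C D L Y)" "n \<in> Mor (pseudo_slice C D L Y)"
    "src (pseudo_slice C D L Y) n = src (pseudo_slice C D L Y) m"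
    "tgt (pseudo_slice C D L Y) n = tgt (pseudo_slice C D L Y) m"
    "\<beta> \<in> Cell C" "src C (dom2 C \<beta>) = fst (src (pseudo_slice C D L Y) m)"
    "tgt C (dom2 C \<beta>) = fst (tgt (pseudo_slice C D L Y) m)"
  by (rule slice_CellE[OF assms], simp add: slice_sel hom1_def hom2_def)+

context normal_pseudo_functor
begin

lemma inv_cpt_natural:
  assumes "\<alpha> \<in> Cell A" "\<alpha>' \<in> Cell A" "tgt A (dom2 A \<alpha>) = src A (dom2 A \<alpha>')"
    and "dom2 A \<alpha> = a" "dom2 A \<alpha>' = a'" "cod2 A \<alpha> = b" "cod2 A \<alpha>' = b'"
  shows "B.inv2 (cpt F b b') \<bullet>\<^bsub>B\<^esub> ap2 F (\<alpha>' \<star>\<^bsub>A\<^esub> \<alpha>) = (ap2 F \<alpha>' \<star>\<^bsub>B\<^esub> ap2 F \<alpha>) \<bullet>\<^bsub>B\<^esub> B.inv2 (cpt F a a')"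
proof -
  have ab: "a \<in> Mor A" "a' \<in> Mor A" "b \<in> Mor A" "b' \<in> Mor A" "tgt A a = src A a'" "tgt A b = src A b'"
      "src A b = src A a" "tgt A b' = tgt A a'"
    using assms A.dom2_Mor[of \<alpha>] A.cod2_Mor[of \<alpha>] A.dom2_Mor[of \<alpha>'] A.cod2_Mor[of \<alpha>']
      A.tgt_cod2[of \<alpha>] A.src_cod2[of \<alpha>'] A.src_cod2[of \<alpha>] A.tgt_cod2[of \<alpha>'] by metis+
  show ?thesis
  proof (rule B.iso2_left_cancel[of "cpt F b b'"])
    have "cpt F b b' \<bullet>\<^bsub>B\<^esub> ((ap2 F \<alpha>' \<star>\<^bsub>B\<^esub> ap2 F \<alpha>) \<bullet>\<^bsub>B\<^esub> B.inv2 (cpt F a a'))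
        = (ap2 F (\<alpha>' \<star>\<^bsub>A\<^esub> \<alpha>) \<bullet>\<^bsub>B\<^esub> cpt F a a') \<bullet>\<^bsub>B\<^esub> B.inv2 (cpt F a a')"
      using assms ab by (intro B.vcomp_replace cpt_natural') simp_all
    then show "cpt F b b' \<bullet>\<^bsub>B\<^esub> (B.inv2 (cpt F b b') \<bullet>\<^bsub>B\<^esub> ap2 F (\<alpha>' \<star>\<^bsub>A\<^esub> \<alpha>))
        = cpt F b b' \<bullet>\<^bsub>B\<^esub> ((ap2 F \<alpha>' \<star>\<^bsub>B\<^esub> ap2 F \<alpha>) \<bullet>\<^bsub>B\<^esub> B.inv2 (cpt F a a'))"
      using assms ab by simp
  qed (use assms ab in simp_all)
qed

lemma inv_cpt_assoc:
  assumes "a \<in> Mor A" "a' \<in> Mor A" "a'' \<in> Mor A" "tgt A a = src A a'" "tgt A a' = src A a''"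
  shows "(B.inv2 (cpt F a' a'') \<star>\<^bsub>B\<^esub> id2 B (ap1 F a)) \<bullet>\<^bsub>B\<^esub> B.inv2 (cpt F a (a'' \<odot>\<^bsub>A\<^esub> a'))
    = (id2 B (ap1 F a'') \<star>\<^bsub>B\<^esub> B.inv2 (cpt F a a')) \<bullet>\<^bsub>B\<^esub> B.inv2 (cpt F (a' \<odot>\<^bsub>A\<^esub> a) a'')"
  using arg_cong[OF cpt_assoc'[OF assms], of B.inv2] assms
  by (simp add: B.inv2_vcomp_rev B.hcomp_inv2(2))

text \<open>
  Associativity of composition in \<open>F \<down> Y\<close>: the 2-cell \<open>\<psi>''\<close> is moved past the inverse compositor of
  \<open>c\<close> and \<open>c'\<close> by interchange, and what remains is the associativity law of the inverse compositors.
\<close>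

lemma slice_assoc:
  assumes c: "c \<in> Mor A" "c' \<in> Mor A" "c'' \<in> Mor A" "tgt A c = src A c'" "tgt A c' = src A c''"
    and f: "f \<in> Mor B" "f' \<in> Mor B" "f'' \<in> Mor B" "f''' \<in> Mor B"
      "src B f = ap0 F (src A c)" "src B f' = ap0 F (src A c')" "src B f'' = ap0 F (src A c'')" "src B f''' = ap0 F (tgt A c'')"
    and \<psi>: "\<psi> \<in> Cell B" "dom2 B \<psi> = f' \<odot>\<^bsub>B\<^esub> ap1 F c" "cod2 B \<psi> = f"
      "\<psi>' \<in> Cell B" "dom2 B \<psi>' = f'' \<odot>\<^bsub>B\<^esub> ap1 F c'" "cod2 B \<psi>' = f'"
      "\<psi>'' \<in> Cell B" "dom2 B \<psi>'' = f''' \<odot>\<^bsub>B\<^esub> ap1 F c''" "cod2 B \<psi>'' = f''"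
  shows "\<psi> \<bullet>\<^bsub>B\<^esub> (((\<psi>' \<bullet>\<^bsub>B\<^esub> ((\<psi>'' \<star>\<^bsub>B\<^esub> id2 B (ap1 F c')) \<bullet>\<^bsub>B\<^esub> (id2 B f''' \<star>\<^bsub>B\<^esub> B.inv2 (cpt F c' c'')))) \<star>\<^bsub>B\<^esub> id2 B (ap1 F c))
      \<bullet>\<^bsub>B\<^esub> (id2 B f''' \<star>\<^bsub>B\<^esub> B.inv2 (cpt F c (c'' \<odot>\<^bsub>A\<^esub> c'))))
    = \<psi> \<bullet>\<^bsub>B\<^esub> ((\<psi>' \<star>\<^bsub>B\<^esub> id2 B (ap1 F c)) \<bullet>\<^bsub>B\<^esub> ((id2 B f'' \<star>\<^bsub>B\<^esub> B.inv2 (cpt F c c')) \<bullet>\<^bsub>B\<^esub>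
       ((\<psi>'' \<star>\<^bsub>B\<^esub> id2 B (ap1 F (c' \<odot>\<^bsub>A\<^esub> c))) \<bullet>\<^bsub>B\<^esub> (id2 B f''' \<star>\<^bsub>B\<^esub> B.inv2 (cpt F (c' \<odot>\<^bsub>A\<^esub> c) c'')))))"
proof -
  have t: "tgt B f' = tgt B f" "tgt B f'' = tgt B f" "tgt B f''' = tgt B f"
    using assms B.tgt_cod2[of \<psi>] B.tgt_cod2[of \<psi>'] B.tgt_cod2[of \<psi>''] by simp_all
  let ?a = "id2 B f''' \<star>\<^bsub>B\<^esub> (B.inv2 (cpt F c' c'') \<star>\<^bsub>B\<^esub> id2 B (ap1 F c))"
  let ?b = "id2 B f''' \<star>\<^bsub>B\<^esub> B.inv2 (cpt F c (c'' \<odot>\<^bsub>A\<^esub> c'))"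
  let ?d = "\<psi>'' \<star>\<^bsub>B\<^esub> id2 B (ap1 F c' \<odot>\<^bsub>B\<^esub> ap1 F c)"
  let ?e = "id2 B f''' \<star>\<^bsub>B\<^esub> (id2 B (ap1 F c'') \<star>\<^bsub>B\<^esub> B.inv2 (cpt F c c'))"
  let ?h = "id2 B f''' \<star>\<^bsub>B\<^esub> B.inv2 (cpt F (c' \<odot>\<^bsub>A\<^esub> c) c'')"
  have 1: "?a \<bullet>\<^bsub>B\<^esub> ?b = ?e \<bullet>\<^bsub>B\<^esub> ?h"
    using assms t inv_cpt_assoc[OF c] by (simp add: B.whisker_left_vcomp[symmetric])
  have 2: "(id2 B f'' \<star>\<^bsub>B\<^esub> B.inv2 (cpt F c c')) \<bullet>\<^bsub>B\<^esub> (\<psi>'' \<star>\<^bsub>B\<^esub> id2 B (ap1 F (c' \<odot>\<^bsub>A\<^esub> c))) = ?d \<bullet>\<^bsub>B\<^esub> ?e"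
    using assms t B.hcomp_assoc'[of "B.inv2 (cpt F c c')" "id2 B (ap1 F c'')" "id2 B f'''"]
    by (simp add: B.interchange' B.whisker_comp1[symmetric] del: B.hcomp_assoc')
  have "(id2 B f'' \<star>\<^bsub>B\<^esub> B.inv2 (cpt F c c')) \<bullet>\<^bsub>B\<^esub> ((\<psi>'' \<star>\<^bsub>B\<^esub> id2 B (ap1 F (c' \<odot>\<^bsub>A\<^esub> c))) \<bullet>\<^bsub>B\<^esub> ?h)
      = (?d \<bullet>\<^bsub>B\<^esub> ?e) \<bullet>\<^bsub>B\<^esub> ?h"
    using assms t by (intro B.vcomp_replace 2) simp_all
  also have "\<dots> = ?d \<bullet>\<^bsub>B\<^esub> (?a \<bullet>\<^bsub>B\<^esub> ?b)"
    unfolding 1 using assms t by simp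
  finally show ?thesis
    using assms t by (simp add: B.whisker_right_vcomp)
qed

text \<open>
  The horizontal composite of two 2-cells of \<open>F \<down> Y\<close> satisfies the triangle condition of a 2-cell,
  because inverse compositors are natural.
\<close>

lemma slice_hcomp:
  assumes \<beta>: "\<beta> \<in> Cell A" "\<beta>' \<in> Cell A" "tgt A (dom2 A \<beta>) = src A (dom2 A \<beta>')"
      "dom2 A \<beta> = c" "cod2 A \<beta> = d" "dom2 A \<beta>' = c'" "cod2 A \<beta>' = d'"
    and f: "f \<in> Mor B" "f' \<in> Mor B" "f'' \<in> Mor B"
      "src B f = ap0 F (src A c)" "src B f' = ap0 F (src A c')" "src B f'' = ap0 F (tgt A c')"
    and \<phi>: "\<phi> \<in> Cell B" "dom2 B \<phi> = f' \<odot>\<^bsub>B\<^esub> ap1 F d" "cod2 B \<phi> = f"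
      "\<phi>' \<in> Cell B" "dom2 B \<phi>' = f'' \<odot>\<^bsub>B\<^esub> ap1 F d'" "cod2 B \<phi>' = f'"
  shows "\<phi> \<bullet>\<^bsub>B\<^esub> ((\<phi>' \<star>\<^bsub>B\<^esub> id2 B (ap1 F d)) \<bullet>\<^bsub>B\<^esub> ((id2 B f'' \<star>\<^bsub>B\<^esub> B.inv2 (cpt F d d')) \<bullet>\<^bsub>B\<^esub> (id2 B f'' \<star>\<^bsub>B\<^esub> ap2 F (\<beta>' \<star>\<^bsub>A\<^esub> \<beta>))))
    = \<phi> \<bullet>\<^bsub>B\<^esub> ((id2 B f' \<star>\<^bsub>B\<^esub> ap2 F \<beta>) \<bullet>\<^bsub>B\<^esub> (((\<phi>' \<bullet>\<^bsub>B\<^esub> (id2 B f'' \<star>\<^bsub>B\<^esub> ap2 F \<beta>')) \<star>\<^bsub>B\<^esub> id2 B (ap1 F c))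
       \<bullet>\<^bsub>B\<^esub> (id2 B f'' \<star>\<^bsub>B\<^esub> B.inv2 (cpt F c c'))))"
proof -
  have cd: "c \<in> Mor A" "d \<in> Mor A" "c' \<in> Mor A" "d' \<in> Mor A" "src A d = src A c" "tgt A d = tgt A c"
      "src A d' = src A c'" "tgt A d' = tgt A c'" "tgt A c = src A c'"
    using \<beta> A.dom2_Mor[of \<beta>] A.cod2_Mor[of \<beta>] A.dom2_Mor[of \<beta>'] A.cod2_Mor[of \<beta>']
      A.src_cod2[of \<beta>] A.tgt_cod2[of \<beta>] A.src_cod2[of \<beta>'] A.tgt_cod2[of \<beta>'] by metis+
  have t: "tgt B f' = tgt B f" "tgt B f'' = tgt B f"
    using assms cd B.tgt_cod2[of \<phi>] B.tgt_cod2[of \<phi>'] by simp_all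
  let ?h = "id2 B f'' \<star>\<^bsub>B\<^esub> B.inv2 (cpt F c c')"
  let ?e = "id2 B f'' \<star>\<^bsub>B\<^esub> (ap2 F \<beta>' \<star>\<^bsub>B\<^esub> ap2 F \<beta>)"
  have 1: "(id2 B f'' \<star>\<^bsub>B\<^esub> B.inv2 (cpt F d d')) \<bullet>\<^bsub>B\<^esub> (id2 B f'' \<star>\<^bsub>B\<^esub> ap2 F (\<beta>' \<star>\<^bsub>A\<^esub> \<beta>)) = ?e \<bullet>\<^bsub>B\<^esub> ?h"
    using assms cd t inv_cpt_natural[of \<beta> \<beta>'] by (simp add: B.whisker_left_vcomp[symmetric])
  have 2: "(\<phi>' \<star>\<^bsub>B\<^esub> id2 B (ap1 F d)) \<bullet>\<^bsub>B\<^esub> ?e = (id2 B f' \<star>\<^bsub>B\<^esub> ap2 F \<beta>) \<bullet>\<^bsub>B\<^esub> ((\<phi>' \<bullet>\<^bsub>B\<^esub> (id2 B f'' \<star>\<^bsub>B\<^esub> ap2 F \<beta>')) \<star>\<^bsub>B\<^esub> id2 B (ap1 F c))"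
    using assms cd t B.hcomp_assoc'[of "ap2 F \<beta>" "ap2 F \<beta>'" "id2 B f''", symmetric]
    by (simp add: B.interchange' del: B.hcomp_assoc')
  have "(\<phi>' \<star>\<^bsub>B\<^esub> id2 B (ap1 F d)) \<bullet>\<^bsub>B\<^esub> (?e \<bullet>\<^bsub>B\<^esub> ?h)
      = ((id2 B f' \<star>\<^bsub>B\<^esub> ap2 F \<beta>) \<bullet>\<^bsub>B\<^esub> ((\<phi>' \<bullet>\<^bsub>B\<^esub> (id2 B f'' \<star>\<^bsub>B\<^esub> ap2 F \<beta>')) \<star>\<^bsub>B\<^esub> id2 B (ap1 F c))) \<bullet>\<^bsub>B\<^esub> ?h"
    using assms cd t by (intro B.vcomp_replace 2) simp_all
  then show ?thesis unfolding 1 using assms cd t by simp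
qed

lemma slice_comp1_assoc:
  assumes "f \<in> Mor (pseudo_slice A B F Y)" "g \<in> Mor (pseudo_slice A B F Y)" "h \<in> Mor (pseudo_slice A B F Y)"
    and "tgt (pseudo_slice A B F Y) f = src (pseudo_slice A B F Y) g"
    and "tgt (pseudo_slice A B F Y) g = src (pseudo_slice A B F Y) h"
  shows "comp1 (pseudo_slice A B F Y) (comp1 (pseudo_slice A B F Y) h g) f
    = comp1 (pseudo_slice A B F Y) h (comp1 (pseudo_slice A B F Y) g f)"
  using assms(1)
  proof (cases rule: slice_MorE)
    case f: (1 X x X' x' c \<psi>)
    show ?thesis using assms(2)
    proof (cases rule: slice_MorE)
      case g: (1 Z z Z' z' c' \<psi>')
      show ?thesis using assms(3)
      proof (cases rule: slice_MorE)
        case h: (1 W w W' w' c'' \<psi>'')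
        have "Z = X'" "z = x'" "W = Z'" "w = z'"
          using assms(4,5) f(1) g(1) h(1) by (simp_all add: slice_sel)
        then show ?thesis
          using f g h slice_assoc[of c c' c'' x x' z' w' \<psi> \<psi>' \<psi>''] by (simp add: slice_sel hom1_def hom2_def)
      qed
    qed
  qed

lemma two_category_slice: "two_category (pseudo_slice A B F Y)"
proof (rule two_categoryI, goal_cases)
  case (10 f g h)
  then show ?case by (rule slice_comp1_assoc)
next
  case (21 \<alpha> \<beta> \<gamma>)
  obtain m n \<alpha>0 m' n' \<beta>0 m'' n'' \<gamma>0 where
    c: "\<alpha> = (m, n, \<alpha>0)" "\<beta> = (m', n', \<beta>0)" "\<gamma> = (m'', n'', \<gamma>0)"
    by (cases \<alpha>; cases \<beta>; cases \<gamma>)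
  note b = slice_Cell_boundary[OF 21(1)[unfolded c]] slice_Cell_boundary[OF 21(2)[unfolded c]]
    slice_Cell_boundary[OF 21(3)[unfolded c]]
  show ?case
    using b 21(4,5) unfolding c slice_sel by (simp add: slice_comp1_assoc)
next
  case (16 \<alpha> \<beta>)
  from 16(1) show ?case
  proof (cases rule: slice_CellE)
    case \<alpha>: (1 X f X' f' c d \<phi> \<alpha>0)
    from 16(2) show ?thesis
    proof (cases rule: slice_CellE)
      case \<beta>: (1 Z h Z' h' c' d' \<phi>' \<beta>0)
      have "Z = X'" "h = f'" using 16(3) \<alpha>(1) \<beta>(1) by (simp_all add: slice_sel)
      moreover from this have "B.iso2 ((\<phi> \<bullet>\<^bsub>B\<^esub> (id2 B f' \<star>\<^bsub>B\<^esub> ap2 F \<alpha>0)) \<bullet>\<^bsub>B\<^esub>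
          (((\<phi>' \<bullet>\<^bsub>B\<^esub> (id2 B h' \<star>\<^bsub>B\<^esub> ap2 F \<beta>0)) \<star>\<^bsub>B\<^esub> id2 B (ap1 F c)) \<bullet>\<^bsub>B\<^esub> (id2 B h' \<star>\<^bsub>B\<^esub> B.inv2 (cpt F c c'))))"
        using \<alpha>(2-) \<beta>(2-) by (intro B.iso2_vcomp[of "_ \<bullet>\<^bsub>B\<^esub> _"]) (auto simp: slice_sel hom1_def hom2_def)[3]
      ultimately show ?thesis
        using \<alpha> \<beta> slice_hcomp[of \<alpha>0 \<beta>0 c d c' d' f f' h' \<phi> \<phi>'] by (simp add: slice_sel hom1_def hom2_def)
    qed
  qed
next
  case (12 \<alpha> \<beta>)
  from 12(1) show ?case
  proof (cases rule: slice_CellE)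
    case \<alpha>: (1 X f X' f' c d \<phi> \<alpha>0)
    from 12(2) show ?thesis
    proof (cases rule: slice_CellE)
      case \<beta>: (1 Z h Z' h' c' d' \<phi>' \<beta>0)
      have "Z = X" "h = f" "Z' = X'" "h' = f'" "c' = d" and \<phi>: "\<phi> = \<phi>' \<bullet>\<^bsub>B\<^esub> (id2 B h' \<star>\<^bsub>B\<^esub> ap2 F \<beta>0)"
        using 12(3) \<alpha>(1) \<beta>(1) by (simp_all add: slice_sel)
      moreover from this have "\<phi> \<bullet>\<^bsub>B\<^esub> (id2 B f' \<star>\<^bsub>B\<^esub> ap2 F \<alpha>0)
          = \<phi>' \<bullet>\<^bsub>B\<^esub> ((id2 B f' \<star>\<^bsub>B\<^esub> ap2 F \<beta>0) \<bullet>\<^bsub>B\<^esub> (id2 B f' \<star>\<^bsub>B\<^esub> ap2 F \<alpha>0))"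
        using \<alpha>(2-) \<beta>(3-) by (simp add: slice_sel hom1_def hom2_def)
      ultimately show ?thesis
        using \<alpha>(2-) \<beta>(2-) unfolding \<alpha>(1) \<beta>(1)
        by (simp add: slice_sel hom1_def hom2_def B.whisker_left_vcomp)
    qed
  qed
next
  case (18 \<alpha> \<alpha>' \<beta> \<beta>')
  then show ?case by (cases \<alpha>; cases \<alpha>'; cases \<beta>; cases \<beta>') (auto simp: slice_sel hom1_def hom2_def A.interchange')
qed (auto simp: slice_sel hom1_def hom2_def)

end


lemma coslice_MorE:
  assumes "m \<in> Mor (pseudo_coslice A I)"
  obtains X f X' f' a \<psi> where "m = ((X, f), (X', f'), a, \<psi>)" "X \<in> Ob A" "f \<in> hom1 A I X"
    "X' \<in> Ob A" "f' \<in> hom1 A I X'" "a \<in> hom1 A X X'" "\<psi> \<in> hom2 A f' (a \<odot>\<^bsub>A\<^esub> f)" "is_iso (cat2 A) \<psi>"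
proof -
  obtain p q a \<psi> where m: "m = (p, q, a, \<psi>)" by (cases m) auto
  obtain X f X' f' where "p = (X, f)" "q = (X', f')" by (cases p; cases q)
  with m assms that[of X f X' f' a \<psi>] show thesis by (simp add: coslice_sel(2))
qed

lemma coslice_projection_sel:
  "ap0 (coslice_projection A) (X, f) = X" "ap1 (coslice_projection A) (p, q, a, \<psi>) = a"
  "ap2 (coslice_projection A) (m, n, \<beta>) = \<beta>"
  "cpt (coslice_projection A) (p, q, a, \<psi>) (p', q', a', \<psi>') = id2 A (a' \<odot>\<^bsub>A\<^esub> a)"
  by (simp_all add: coslice_projection_def)

lemma two_functor_coslice_projection:
  assumes "two_category A"
  shows "two_functor (pseudo_coslice A I) A (coslice_projection A)"
proof -
  interpret A: two_category A by (rule assms)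
  interpret S: two_category "pseudo_coslice A I" by (rule two_category_coslice[OF assms])
  let ?S = "pseudo_coslice A I" and ?P = "coslice_projection A"
  have P1: "ap1 ?P m \<in> hom1 A (ap0 ?P p) (ap0 ?P q)" if "m \<in> hom1 ?S p q" for m p q
    using that by (auto simp: hom1_def coslice_sel coslice_projection_sel elim!: coslice_MorE)
  have P2: "ap2 ?P \<alpha> \<in> hom2 A (ap1 ?P m) (ap1 ?P n)" if "\<alpha> \<in> hom2 ?S m n" for \<alpha> m n
    using that by (auto simp: hom2_def coslice_sel coslice_projection_sel elim!: coslice_CellE)
  have comp: "ap1 ?P (m' \<odot>\<^bsub>?S\<^esub> m) = ap1 ?P m' \<odot>\<^bsub>A\<^esub> ap1 ?P m"
      and cpt: "cpt ?P m m' = id2 A (ap1 ?P (m' \<odot>\<^bsub>?S\<^esub> m))" for m m'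
    by (cases m; cases m'; simp add: coslice_sel coslice_projection_sel)+
  have id1: "ap1 ?P (id1 ?S p) = id1 A (ap0 ?P p)" for p
    by (cases p) (simp add: coslice_sel coslice_projection_sel)
  have id2: "ap2 ?P (id2 ?S m) = id2 A (ap1 ?P m)" for m
    by (cases m) (simp add: coslice_sel coslice_projection_sel)
  have vcomp: "ap2 ?P (\<beta> \<bullet>\<^bsub>?S\<^esub> \<alpha>) = ap2 ?P \<beta> \<bullet>\<^bsub>A\<^esub> ap2 ?P \<alpha>"
      and hcomp: "ap2 ?P (\<beta> \<star>\<^bsub>?S\<^esub> \<alpha>) = ap2 ?P \<beta> \<star>\<^bsub>A\<^esub> ap2 ?P \<alpha>" for \<alpha> \<beta>
    by (cases \<alpha>; cases \<beta>; simp add: coslice_sel coslice_projection_sel)+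
  have P0: "ap0 ?P p \<in> Ob A" if "p \<in> Ob ?S" for p
    using that by (cases p) (simp add: coslice_sel coslice_projection_sel)
  have local: "cat_functor (hom_cat ?S p q) (hom_cat A (ap0 ?P p) (ap0 ?P q)) \<lparr>fob = ap1 ?P, far = ap2 ?P\<rparr>" for p q
    by (intro cat_functor.intro S.category_hom_cat A.category_hom_cat)
      (auto simp: S.arrows_hom_cat A.arrows_hom_cat P1 P2 id2 vcomp split: if_splits)
  have hom1D: "\<And>a X Y. a \<in> hom1 A X Y \<Longrightarrow> a \<in> Mor A \<and> src A a = X \<and> tgt A a = Y"
    and hom2D: "\<And>\<alpha> f g. \<alpha> \<in> hom2 A f g \<Longrightarrow> \<alpha> \<in> Cell A \<and> dom2 A \<alpha> = f \<and> cod2 A \<alpha> = g"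
    by (auto simp: hom1_def hom2_def)
  show ?thesis
  proof (intro two_functor.intro normal_pseudo_functor.intro two_functor_axioms.intro, goal_cases)
    case (6 a X Y a' Z)
    show ?case using hom1D[OF P1[OF 6(1)]] hom1D[OF P1[OF 6(2)]] by (simp add: cpt comp hom2_def)
  next
    case (7 a X Y a' Z)
    show ?case using hom1D[OF P1[OF 7(1)]] hom1D[OF P1[OF 7(2)]] by (simp add: cpt comp)
  next
    case (8 a X Y a' Z \<alpha> b \<alpha>' b')
    show ?case
      using hom1D[OF P1[OF 8(1)]] hom1D[OF P1[OF 8(2)]] hom2D[OF P2[OF 8(3)]] hom2D[OF P2[OF 8(4)]]
        A.src_cod2[of "ap2 ?P \<alpha>"] A.tgt_cod2[of "ap2 ?P \<alpha>"] A.src_cod2[of "ap2 ?P \<alpha>'"] A.tgt_cod2[of "ap2 ?P \<alpha>'"]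
      by (simp add: cpt comp hcomp)
  next
    case (9 a W X a' Y a'' Z)
    show ?case
      using hom1D[OF P1[OF 9(1)]] hom1D[OF P1[OF 9(2)]] hom1D[OF P1[OF 9(3)]]
      by (simp add: cpt comp)
  next
    case (10 a X Y)
    then show ?case using hom1D[OF P1[OF 10]] S.tgt_Ob[of a] by (simp add: cpt comp id1 hom1_def)
  next
    case (11 a X Y)
    then show ?case using hom1D[OF P1[OF 11]] S.src_Ob[of a] by (simp add: cpt comp id1 hom1_def)
  next
    case (12 a X Y a' Z)
    show ?case by (rule cpt)
  qed (use assms S.two_category_axioms P0 local id1 in simp_all)
qed

text \<open>
  Bi-initiality of \<open>I\<close> is a property of the hom-categories \<open>A(I, X)\<close>, namely that they are equivalent to
  the terminal category.  Fullness of the projection gives a 2-cell between any two 1-cells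
  \<open>f, g : I \<rightarrow> X\<close> by lifting \<open>g\<close> to a 1-cell of \<open>I \<down> A\<close> from \<open>id : I \<rightarrow> I\<close> to \<open>f\<close>; full faithfulness gives
  its uniqueness.  Conversely, 2-cells that exist uniquely in both directions are invertible.
\<close>

lemma bi_initial_iff:
  assumes A: "two_category A"
  shows "bi_initial A I \<longleftrightarrow> I \<in> Ob A \<and> (\<forall>X \<in> Ob A. (\<exists>f. f \<in> hom1 A I X) \<and>
    (\<forall>f \<in> hom1 A I X. \<forall>g \<in> hom1 A I X. \<exists>!\<alpha>. \<alpha> \<in> hom2 A f g))"
    (is "_ \<longleftrightarrow> _ \<and> ?contractible")
proof
  interpret A: two_category A by (rule A)
  let ?S = "pseudo_coslice A I" and ?P = "coslice_projection A"
  assume "bi_initial A I"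
  then have I: "I \<in> Ob A" and fib: "trivial_fibration ?S A ?P"
    by (simp_all add: bi_initial_def)
  interpret P: trivial_fibration ?S A ?P by (rule fib)
  have iI: "(I, id1 A I) \<in> Ob ?S" using I by (simp add: coslice_sel hom1_def)
  have "\<exists>f. f \<in> hom1 A I X" if X: "X \<in> Ob A" for X
    using P.surjective_on_objects[OF X] by (auto simp: coslice_sel coslice_projection_sel)
  moreover have "\<exists>!\<alpha>. \<alpha> \<in> hom2 A f g"
    if X: "X \<in> Ob A" and f: "f \<in> hom1 A I X" and g: "g \<in> hom1 A I X" for X f g
  proof -
    have lift: "\<exists>\<psi>. ((I, id1 A I), (X, f), h, \<psi>) \<in> Mor ?S" if "h \<in> hom1 A I X" for h
    proof -
      obtain m where "m \<in> hom1 ?S (I, id1 A I) (X, f)" "ap1 ?P m = h"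
        using P.full_on_morphisms[OF iI, of "(X, f)" h] X f \<open>h \<in> hom1 A I X\<close>
        by (auto simp: coslice_sel coslice_projection_sel)
      then show ?thesis
        by (cases m) (auto simp: hom1_def[of ?S] coslice_sel(4,5) coslice_projection_sel)
    qed
    obtain \<psi> where \<psi>: "((I, id1 A I), (X, f), g, \<psi>) \<in> Mor ?S" using lift[OF g] by blast
    have fid: "((I, id1 A I), (X, f), f, id2 A f) \<in> Mor ?S"
      using I X f by (simp add: coslice_sel hom1_def hom2_def)
    have ff: "f \<odot>\<^bsub>A\<^esub> id1 A I = f" "g \<odot>\<^bsub>A\<^esub> id1 A I = g" using f g by (simp_all add: hom1_def)
    show ?thesis
    proof (rule ex1I[of _ \<psi>])
      show "\<psi> \<in> hom2 A f g" using \<psi> ff by (simp add: coslice_sel)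
    next
      fix \<alpha> assume \<alpha>: "\<alpha> \<in> hom2 A f g"
      obtain \<alpha>' where "\<alpha>' \<in> hom2 ?S ((I, id1 A I), (X, f), f, id2 A f) ((I, id1 A I), (X, f), g, \<psi>)"
          "ap2 ?P \<alpha>' = \<alpha>"
        using P.fully_faithful_on_cells[of "((I, id1 A I), (X, f), f, id2 A f)" "(I, id1 A I)" "(X, f)"
            "((I, id1 A I), (X, f), g, \<psi>)" \<alpha>] \<alpha> fid \<psi>
        unfolding hom1_def[of ?S] by (simp add: coslice_sel(4,5) coslice_projection_sel) blast
      then have "(((I, id1 A I), (X, f), f, id2 A f), ((I, id1 A I), (X, f), g, \<psi>), \<alpha>) \<in> Cell ?S"
        by (cases \<alpha>') (auto simp: hom2_def coslice_sel(6,7) coslice_projection_sel)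
      then have "(\<alpha> \<star>\<^bsub>A\<^esub> id2 A (id1 A I)) \<bullet>\<^bsub>A\<^esub> id2 A f = \<psi>" by (simp add: coslice_sel)
      then show "\<alpha> = \<psi>" using \<alpha> f by (simp add: hom1_def hom2_def)
    qed
  qed
  ultimately show "I \<in> Ob A \<and> ?contractible" using I by blast
next
  interpret A: two_category A by (rule A)
  let ?S = "pseudo_coslice A I" and ?P = "coslice_projection A"
  assume "I \<in> Ob A \<and> ?contractible"
  then have I: "I \<in> Ob A" and nonempty: "\<And>X. X \<in> Ob A \<Longrightarrow> \<exists>f. f \<in> hom1 A I X"
    and unique: "\<And>X f g. \<lbrakk>X \<in> Ob A; f \<in> hom1 A I X; g \<in> hom1 A I X\<rbrakk> \<Longrightarrow> \<exists>!\<alpha>. \<alpha> \<in> hom2 A f g"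
    by blast+
  interpret P: two_functor ?S A ?P by (rule two_functor_coslice_projection[OF A])
  have iso: "A.iso2 \<alpha>" if X: "X \<in> Ob A" and f: "f \<in> hom1 A I X" and g: "g \<in> hom1 A I X" and \<alpha>: "\<alpha> \<in> hom2 A f g"
    for X f g \<alpha>
  proof -
    obtain \<beta> where \<beta>: "\<beta> \<in> hom2 A g f" using unique[OF X g f] by blast
    have "\<beta> \<bullet>\<^bsub>A\<^esub> \<alpha> \<in> hom2 A f f" "\<alpha> \<bullet>\<^bsub>A\<^esub> \<beta> \<in> hom2 A g g" "id2 A f \<in> hom2 A f f" "id2 A g \<in> hom2 A g g"
      using \<alpha> \<beta> f g by (simp_all add: hom1_def hom2_def)
    then have "\<beta> \<bullet>\<^bsub>A\<^esub> \<alpha> = id2 A f" "\<alpha> \<bullet>\<^bsub>A\<^esub> \<beta> = id2 A g"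
      using unique[OF X f f] unique[OF X g g] by blast+
    then show ?thesis using A.iso2I[of \<alpha> \<beta>] \<alpha> \<beta> by (simp add: hom2_def)
  qed
  have "trivial_fibration ?S A ?P"
  proof (intro trivial_fibration.intro P.two_functor_axioms trivial_fibration_axioms.intro, goal_cases)
    case (1 X)
    then obtain f where "f \<in> hom1 A I X" using nonempty by blast
    then show ?case using 1 by (auto simp: coslice_sel coslice_projection_sel intro!: bexI[of _ "(X, f)"])
  next
    case (2 p q a)
    obtain X f X' f' where pq: "p = (X, f)" "q = (X', f')" by (cases p; cases q)
    have f: "X \<in> Ob A" "f \<in> hom1 A I X" "X' \<in> Ob A" "f' \<in> hom1 A I X'" and a: "a \<in> hom1 A X X'"
      using 2 by (simp_all add: pq coslice_sel coslice_projection_sel)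
    then have af: "a \<odot>\<^bsub>A\<^esub> f \<in> hom1 A I X'" by (simp add: hom1_def)
    obtain \<psi> where \<psi>: "\<psi> \<in> hom2 A f' (a \<odot>\<^bsub>A\<^esub> f)" using unique[OF f(3,4) af] by blast
    then have "((X, f), (X', f'), a, \<psi>) \<in> hom1 ?S p q"
      using f a iso[OF f(3,4) af] by (simp add: hom1_def[of ?S] pq coslice_sel)
    then show ?case by (intro bexI[of _ "((X, f), (X', f'), a, \<psi>)"]) (simp_all add: coslice_projection_sel)
  next
    case (3 m p q n \<beta>)
    have mS: "m \<in> Mor ?S" and nS: "n \<in> Mor ?S" and bd: "src ?S m = p" "tgt ?S m = q" "src ?S n = p" "tgt ?S n = q"
      using 3 by (simp_all add: hom1_def)
    show ?case
    proof (rule coslice_MorE[OF mS], rule coslice_MorE[OF nS])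
      fix X f X' f' a \<psi> Z g Z' g' b \<phi>
      assume m: "m = ((X, f), (X', f'), a, \<psi>)" "X \<in> Ob A" "f \<in> hom1 A I X" "X' \<in> Ob A" "f' \<in> hom1 A I X'"
          "a \<in> hom1 A X X'" "\<psi> \<in> hom2 A f' (a \<odot>\<^bsub>A\<^esub> f)" "A.iso2 \<psi>"
        and n: "n = ((Z, g), (Z', g'), b, \<phi>)" "Z \<in> Ob A" "g \<in> hom1 A I Z" "Z' \<in> Ob A" "g' \<in> hom1 A I Z'"
          "b \<in> hom1 A Z Z'" "\<phi> \<in> hom2 A g' (b \<odot>\<^bsub>A\<^esub> g)" "A.iso2 \<phi>"
      have e: "Z = X" "g = f" "Z' = X'" "g' = f'" using bd by (auto simp: m(1) n(1) coslice_sel(4,5))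
      have \<beta>: "\<beta> \<in> hom2 A a b" using 3(3) by (simp add: m(1) n(1) coslice_projection_sel)
      have bf: "b \<odot>\<^bsub>A\<^esub> f \<in> hom1 A I X'" using n m e by (simp add: hom1_def)
      have "(\<beta> \<star>\<^bsub>A\<^esub> id2 A f) \<bullet>\<^bsub>A\<^esub> \<psi> \<in> hom2 A f' (b \<odot>\<^bsub>A\<^esub> f)"
        using \<beta> m(2-8) by (simp add: hom1_def hom2_def)
      then have "(\<beta> \<star>\<^bsub>A\<^esub> id2 A f) \<bullet>\<^bsub>A\<^esub> \<psi> = \<phi>" using unique[OF m(4,5) bf] n(7) e by blast
      then have "(m, n, \<beta>) \<in> hom2 ?S m n"
        using mS nS \<beta> unfolding m(1) n(1) e by (simp add: hom2_def[of ?S] coslice_sel(3,6,7))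
      moreover have "\<alpha> = (m, n, \<beta>)" if "\<alpha> \<in> hom2 ?S m n" "ap2 ?P \<alpha> = \<beta>" for \<alpha>
        using that by (cases \<alpha>) (auto simp: hom2_def coslice_sel(6,7) coslice_projection_sel)
      ultimately show ?thesis
        using coslice_projection_sel(3)[of A m n \<beta>] by (intro ex1I[of _ "(m, n, \<beta>)"]) blast+
    qed
  qed
  then show "bi_initial A I" using I by (simp add: bi_initial_def)
qed

text \<open>
  Bi-terminality of \<open>(X, \<epsilon>)\<close> in \<open>F \<down> Y\<close>, stated in \<open>A\<close> and \<open>B\<close>.  The lifting property concerns
  invertible 2-cells because the 2-cell in a 1-cell of \<open>F \<down> Y\<close> is invertible.
\<close>

definition (in normal_pseudo_functor) universal_arrow :: "'o' \<Rightarrow> 'o \<Rightarrow> 'm' \<Rightarrow> bool" where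
  "universal_arrow Y X \<epsilon> \<longleftrightarrow> X \<in> Ob A \<and> \<epsilon> \<in> hom1 B (ap0 F X) Y
    \<and> (\<forall>Z \<in> Ob A. \<forall>f \<in> hom1 B (ap0 F Z) Y. \<exists>c \<in> hom1 A Z X. \<exists>\<psi> \<in> hom2 B (\<epsilon> \<odot>\<^bsub>B\<^esub> ap1 F c) f. is_iso (cat2 B) \<psi>)
    \<and> (\<forall>Z \<in> Ob A. \<forall>c \<in> hom1 A Z X. \<forall>d \<in> hom1 A Z X. \<forall>\<chi> \<in> hom2 B (\<epsilon> \<odot>\<^bsub>B\<^esub> ap1 F c) (\<epsilon> \<odot>\<^bsub>B\<^esub> ap1 F d).
         is_iso (cat2 B) \<chi> \<longrightarrow> (\<exists>!\<beta>. \<beta> \<in> hom2 A c d \<and> id2 B \<epsilon> \<star>\<^bsub>B\<^esub> ap2 F \<beta> = \<chi>))"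

lemma ex1_triple: "(\<exists>!\<gamma>. \<exists>\<beta>. \<gamma> = (m, n, \<beta>) \<and> P \<beta>) \<longleftrightarrow> (\<exists>!\<beta>. P \<beta>)"
proof
  assume "\<exists>!\<beta>. P \<beta>"
  then obtain \<beta> where "P \<beta>" "\<And>\<beta>'. P \<beta>' \<Longrightarrow> \<beta>' = \<beta>" by blast
  then show "\<exists>!\<gamma>. \<exists>\<beta>. \<gamma> = (m, n, \<beta>) \<and> P \<beta>" by blast
qed blast

text \<open>
  The 2-cells \<open>(c, \<psi>) \<Rightarrow> (d, \<phi>)\<close> of the slice are the lifts of \<open>\<phi>\<^sup>-\<^sup>1 \<psi>\<close>.  Every invertible 2-cell
  \<open>\<chi> : \<epsilon> (F c) \<Rightarrow> \<epsilon> (F d)\<close> has this form, with \<open>\<phi> = id\<close> and \<open>\<psi> = \<chi>\<close>.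
\<close>

lemma (in normal_pseudo_functor) bi_terminal_slice_iff:
  assumes X: "X \<in> Ob A" and \<epsilon>: "\<epsilon> \<in> hom1 B (ap0 F X) Y"
  shows "bi_terminal (pseudo_slice A B F Y) (X, \<epsilon>) \<longleftrightarrow> universal_arrow Y X \<epsilon>"
proof -
  let ?S = "pseudo_slice A B F Y"
  have op: "two_category (op2 ?S)" by (rule two_category_op2[OF two_category_slice])
  have I: "(X, \<epsilon>) \<in> Ob ?S" using X \<epsilon> by (simp add: slice_sel)
  have hom1: "m \<in> hom1 ?S (Z, f) (X, \<epsilon>) \<longleftrightarrow>
      (\<exists>c \<psi>. m = ((Z, f), (X, \<epsilon>), c, \<psi>) \<and> c \<in> hom1 A Z X \<and> \<psi> \<in> hom2 B (\<epsilon> \<odot>\<^bsub>B\<^esub> ap1 F c) f \<and> B.iso2 \<psi>)"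
    if "(Z, f) \<in> Ob ?S" for m Z f
    using that I by (cases m) (auto simp: hom1_def[of ?S] slice_sel(1,2,4,5))
  have hom2: "\<gamma> \<in> hom2 ?S ((Z, f), (X, \<epsilon>), c, \<psi>) ((Z, f), (X, \<epsilon>), d, \<phi>) \<longleftrightarrow>
      (\<exists>\<beta>. \<gamma> = (((Z, f), (X, \<epsilon>), c, \<psi>), ((Z, f), (X, \<epsilon>), d, \<phi>), \<beta>) \<and> \<beta> \<in> hom2 A c d
        \<and> id2 B \<epsilon> \<star>\<^bsub>B\<^esub> ap2 F \<beta> = B.inv2 \<phi> \<bullet>\<^bsub>B\<^esub> \<psi>)"
    if m: "((Z, f), (X, \<epsilon>), c, \<psi>) \<in> hom1 ?S (Z, f) (X, \<epsilon>)" and n: "((Z, f), (X, \<epsilon>), d, \<phi>) \<in> hom1 ?S (Z, f) (X, \<epsilon>)"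
    for \<gamma> Z f c \<psi> d \<phi>
  proof -
    have mn: "((Z, f), (X, \<epsilon>), c, \<psi>) \<in> Mor ?S" "((Z, f), (X, \<epsilon>), d, \<phi>) \<in> Mor ?S"
      using m n by (simp_all add: hom1_def[of ?S])
    then have c: "c \<in> hom1 A Z X" "d \<in> hom1 A Z X" and iso: "B.iso2 \<psi>" "B.iso2 \<phi>"
        and \<psi>\<phi>: "\<psi> \<in> hom2 B (\<epsilon> \<odot>\<^bsub>B\<^esub> ap1 F c) f" "\<phi> \<in> hom2 B (\<epsilon> \<odot>\<^bsub>B\<^esub> ap1 F d) f"
      by (simp_all add: slice_sel(2))
    have eq: "\<phi> \<bullet>\<^bsub>B\<^esub> (id2 B \<epsilon> \<star>\<^bsub>B\<^esub> ap2 F \<beta>) = \<psi> \<longleftrightarrow> id2 B \<epsilon> \<star>\<^bsub>B\<^esub> ap2 F \<beta> = B.inv2 \<phi> \<bullet>\<^bsub>B\<^esub> \<psi>"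
      if \<beta>: "\<beta> \<in> hom2 A c d" for \<beta>
    proof -
      have t: "id2 B \<epsilon> \<star>\<^bsub>B\<^esub> ap2 F \<beta> \<in> Cell B" "cod2 B (id2 B \<epsilon> \<star>\<^bsub>B\<^esub> ap2 F \<beta>) = dom2 B \<phi>"
          "\<psi> \<in> Cell B" "cod2 B \<psi> = cod2 B \<phi>"
        using c \<psi>\<phi> \<beta> \<epsilon> by (simp_all add: hom1_def hom2_def)
      show ?thesis
        using B.inv2_vcomp_cancel(1)[OF iso(2) t(1,2)] B.inv2_vcomp_cancel(2)[OF iso(2) t(3,4)] by metis
    qed
    have "\<gamma> \<in> hom2 ?S ((Z, f), (X, \<epsilon>), c, \<psi>) ((Z, f), (X, \<epsilon>), d, \<phi>) \<longleftrightarrow>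
      (\<exists>\<beta>. \<gamma> = (((Z, f), (X, \<epsilon>), c, \<psi>), ((Z, f), (X, \<epsilon>), d, \<phi>), \<beta>) \<and> \<beta> \<in> hom2 A c d
        \<and> \<phi> \<bullet>\<^bsub>B\<^esub> (id2 B \<epsilon> \<star>\<^bsub>B\<^esub> ap2 F \<beta>) = \<psi>)"
      using mn by (cases \<gamma>) (auto simp: hom2_def[of ?S] slice_sel(3,6,7))
    then show ?thesis using eq by metis
  qed
  have unique: "(\<exists>!\<gamma>. \<gamma> \<in> hom2 ?S ((Z, f), (X, \<epsilon>), c, \<psi>) ((Z, f), (X, \<epsilon>), d, \<phi>)) \<longleftrightarrow>
      (\<exists>!\<beta>. \<beta> \<in> hom2 A c d \<and> id2 B \<epsilon> \<star>\<^bsub>B\<^esub> ap2 F \<beta> = B.inv2 \<phi> \<bullet>\<^bsub>B\<^esub> \<psi>)"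
    if m: "((Z, f), (X, \<epsilon>), c, \<psi>) \<in> hom1 ?S (Z, f) (X, \<epsilon>)" and n: "((Z, f), (X, \<epsilon>), d, \<phi>) \<in> hom1 ?S (Z, f) (X, \<epsilon>)"
    for Z f c \<psi> d \<phi>
    unfolding hom2[OF m n] by (rule ex1_triple)
  have op_hom: "hom1 (op2 ?S) p q = hom1 ?S q p" "hom2 (op2 ?S) m n = hom2 ?S m n" for p q m n
    unfolding hom1_def hom2_def op2_sel by blast+
  show ?thesis
  proof
    assume "bi_terminal ?S (X, \<epsilon>)"
    then have nonempty: "\<And>p. p \<in> Ob ?S \<Longrightarrow> \<exists>m. m \<in> hom1 ?S p (X, \<epsilon>)"
      and contr: "\<And>p m n. \<lbrakk>p \<in> Ob ?S; m \<in> hom1 ?S p (X, \<epsilon>); n \<in> hom1 ?S p (X, \<epsilon>)\<rbrakk> \<Longrightarrow> \<exists>!\<gamma>. \<gamma> \<in> hom2 ?S m n"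
      by (simp_all add: bi_terminal_def bi_initial_iff[OF op] op_hom)
    show "universal_arrow Y X \<epsilon>"
      unfolding universal_arrow_def
    proof (intro conjI ballI impI X \<epsilon>)
      fix Z f assume "Z \<in> Ob A" "f \<in> hom1 B (ap0 F Z) Y"
      then have p: "(Z, f) \<in> Ob ?S" by (simp add: slice_sel)
      show "\<exists>c \<in> hom1 A Z X. \<exists>\<psi> \<in> hom2 B (\<epsilon> \<odot>\<^bsub>B\<^esub> ap1 F c) f. B.iso2 \<psi>"
        using nonempty[OF p] unfolding hom1[OF p] by blast
    next
      fix Z c d \<chi> assume Z: "Z \<in> Ob A" and c: "c \<in> hom1 A Z X" and d: "d \<in> hom1 A Z X"
        and \<chi>: "\<chi> \<in> hom2 B (\<epsilon> \<odot>\<^bsub>B\<^esub> ap1 F c) (\<epsilon> \<odot>\<^bsub>B\<^esub> ap1 F d)" "B.iso2 \<chi>"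
      let ?f = "\<epsilon> \<odot>\<^bsub>B\<^esub> ap1 F d"
      have f: "?f \<in> hom1 B (ap0 F Z) Y" using \<epsilon> d by (simp add: hom1_def)
      then have p: "(Z, ?f) \<in> Ob ?S" using Z by (simp add: slice_sel)
      have m: "((Z, ?f), (X, \<epsilon>), c, \<chi>) \<in> hom1 ?S (Z, ?f) (X, \<epsilon>)" using hom1[OF p] c \<chi> by simp
      have n: "((Z, ?f), (X, \<epsilon>), d, id2 B ?f) \<in> hom1 ?S (Z, ?f) (X, \<epsilon>)"
        using hom1[OF p] d f by (simp add: hom1_def[of B] hom2_def)
      have "B.inv2 (id2 B ?f) \<bullet>\<^bsub>B\<^esub> \<chi> = \<chi>" using f \<chi> by (simp add: hom1_def hom2_def)
      then show "\<exists>!\<beta>. \<beta> \<in> hom2 A c d \<and> id2 B \<epsilon> \<star>\<^bsub>B\<^esub> ap2 F \<beta> = \<chi>"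
        using unique[OF m n] contr[OF p m n] by simp
    qed
  next
    assume u: "universal_arrow Y X \<epsilon>"
    have "(\<exists>m. m \<in> hom1 ?S p (X, \<epsilon>)) \<and> (\<forall>m \<in> hom1 ?S p (X, \<epsilon>). \<forall>n \<in> hom1 ?S p (X, \<epsilon>). \<exists>!\<gamma>. \<gamma> \<in> hom2 ?S m n)"
      if p: "p \<in> Ob ?S" for p
    proof (intro conjI ballI)
      obtain Z f where Zf: "p = (Z, f)" by (cases p)
      have Z: "Z \<in> Ob A" and f: "f \<in> hom1 B (ap0 F Z) Y" using p by (simp_all add: Zf slice_sel)
      show "\<exists>m. m \<in> hom1 ?S p (X, \<epsilon>)"
        using u Z f unfolding Zf hom1[OF p[unfolded Zf]] universal_arrow_def by blast
      fix m n assume m: "m \<in> hom1 ?S p (X, \<epsilon>)" and n: "n \<in> hom1 ?S p (X, \<epsilon>)"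
      obtain c \<psi> where c: "m = ((Z, f), (X, \<epsilon>), c, \<psi>)" "c \<in> hom1 A Z X" "\<psi> \<in> hom2 B (\<epsilon> \<odot>\<^bsub>B\<^esub> ap1 F c) f" "B.iso2 \<psi>"
        using m hom1[OF p[unfolded Zf]] unfolding Zf by blast
      obtain d \<phi> where d: "n = ((Z, f), (X, \<epsilon>), d, \<phi>)" "d \<in> hom1 A Z X" "\<phi> \<in> hom2 B (\<epsilon> \<odot>\<^bsub>B\<^esub> ap1 F d) f" "B.iso2 \<phi>"
        using n hom1[OF p[unfolded Zf]] unfolding Zf by blast
      have \<chi>: "B.inv2 \<phi> \<bullet>\<^bsub>B\<^esub> \<psi> \<in> hom2 B (\<epsilon> \<odot>\<^bsub>B\<^esub> ap1 F c) (\<epsilon> \<odot>\<^bsub>B\<^esub> ap1 F d)" "B.iso2 (B.inv2 \<phi> \<bullet>\<^bsub>B\<^esub> \<psi>)"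
        using c d by (simp_all add: hom2_def)
      have "\<exists>!\<beta>. \<beta> \<in> hom2 A c d \<and> id2 B \<epsilon> \<star>\<^bsub>B\<^esub> ap2 F \<beta> = B.inv2 \<phi> \<bullet>\<^bsub>B\<^esub> \<psi>"
        using u Z c(2) d(2) \<chi> unfolding universal_arrow_def by blast
      then show "\<exists>!\<gamma>. \<gamma> \<in> hom2 ?S m n"
        using unique[of Z f c \<psi> d \<phi>] m n unfolding c(1) d(1) Zf by blast
    qed
    then show "bi_terminal ?S (X, \<epsilon>)"
      using I by (simp add: bi_terminal_def bi_initial_iff[OF op] op_hom)
  qed
qed


section \<open>Bi-adjoints give universal arrows\<close>

lemma fully_faithful_nat_iso:
  assumes \<alpha>: "nat_iso A B F G \<alpha>" and G: "fully_faithful A B G"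
  shows "fully_faithful A B F"
proof -
  interpret \<alpha>: nat_iso A B F G \<alpha> by (rule \<alpha>)
  interpret B: category B by (rule \<alpha>.dom_fun.cod_category)
  show ?thesis
    unfolding fully_faithful_def
  proof (intro ballI)
    fix x y b assume x: "x \<in> Obj A" and y: "y \<in> Obj A" and b: "b \<in> arrows B (fob F x) (fob F y)"
    note \<alpha>x = \<alpha>.component_in[OF x] \<alpha>.component_iso[OF x] and \<alpha>y = \<alpha>.component_in[OF y] \<alpha>.component_iso[OF y]
    define b' where "b' = (\<alpha> y \<cdot>\<^bsub>B\<^esub> b) \<cdot>\<^bsub>B\<^esub> the_inverse B (\<alpha> x)"
    have b': "b' \<in> arrows B (fob G x) (fob G y)"
      unfolding b'_def using B.Comp_in[OF B.the_inverse(1)[OF \<alpha>x] B.Comp_in[OF b \<alpha>y(1)]] .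
    have b'\<alpha>: "b' \<cdot>\<^bsub>B\<^esub> \<alpha> x = \<alpha> y \<cdot>\<^bsub>B\<^esub> b"
      unfolding b'_def using B.Comp_assoc[OF \<alpha>x(1) B.the_inverse(1)[OF \<alpha>x] B.Comp_in[OF b \<alpha>y(1)]]
        B.the_inverse(2)[OF \<alpha>x] B.Ident_right[OF B.Comp_in[OF b \<alpha>y(1)]] by simp
    have "far F a = b \<longleftrightarrow> far G a = b'" if a: "a \<in> arrows A x y" for a
    proof -
      note Fa = \<alpha>.dom_fun.far_in[OF a] and Ga = \<alpha>.cod_fun.far_in[OF a]
      have "far F a = b \<longleftrightarrow> \<alpha> y \<cdot>\<^bsub>B\<^esub> far F a = \<alpha> y \<cdot>\<^bsub>B\<^esub> b"
        using B.iso_left_cancel[OF \<alpha>y Fa b] by blast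
      also have "\<dots> \<longleftrightarrow> far G a \<cdot>\<^bsub>B\<^esub> \<alpha> x = b' \<cdot>\<^bsub>B\<^esub> \<alpha> x"
        using \<alpha>.naturality[OF a] b'\<alpha> by simp
      also have "\<dots> \<longleftrightarrow> far G a = b'"
        using B.iso_right_cancel[OF \<alpha>x Ga b'] by blast
      finally show ?thesis .
    qed
    moreover have "\<exists>!a. a \<in> arrows A x y \<and> far G a = b'"
      using G x y b' unfolding fully_faithful_def by blast
    ultimately show "\<exists>!a. a \<in> arrows A x y \<and> far F a = b" by blast
  qed
qed

lemma essentially_surjective_nat_iso:
  assumes \<alpha>: "nat_iso A B F G \<alpha>" and G: "essentially_surjective A B G"
  shows "essentially_surjective A B F"
proof -
  interpret \<alpha>: nat_iso A B F G \<alpha> by (rule \<alpha>)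
  interpret B: category B by (rule \<alpha>.dom_fun.cod_category)
  show ?thesis
    unfolding essentially_surjective_def
  proof
    fix y assume "y \<in> Obj B"
    then obtain x b where x: "x \<in> Obj A" and b: "b \<in> arrows B (fob G x) y" "is_iso B b"
      using G unfolding essentially_surjective_def by blast
    note \<alpha>x = \<alpha>.component_in[OF x] \<alpha>.component_iso[OF x]
    show "\<exists>x \<in> Obj A. \<exists>b \<in> arrows B (fob F x) y. is_iso B b"
      using x B.Comp_in[OF \<alpha>x(1) b(1)] B.iso_Comp[OF \<alpha>x b] by blast
  qed
qed

text \<open>
  If \<open>\<epsilon> : F X \<rightarrow> Y\<close> is a universal arrow, these functors \<open>A(Z, X) \<rightarrow> B(F Z, Y)\<close> are essentially
  surjective, but universality makes them fully faithful for invertible 2-cells only.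
\<close>

definition transposition :: "('p, 'n, 'd) twocat \<Rightarrow> ('o, 'm, 'c, 'p, 'n, 'd) psfun \<Rightarrow> 'n \<Rightarrow>
    ('m, 'c, 'n, 'd) fun_data" where
  "transposition B F \<epsilon> = \<lparr>fob = \<lambda>c. \<epsilon> \<odot>\<^bsub>B\<^esub> ap1 F c, far = \<lambda>\<beta>. id2 B \<epsilon> \<star>\<^bsub>B\<^esub> ap2 F \<beta>\<rparr>"

context normal_pseudo_functor
begin

lemma cat_functor_transposition:
  assumes "\<epsilon> \<in> hom1 B (ap0 F X) Y"
  shows "cat_functor (hom_cat A Z X) (hom_cat B (ap0 F Z) Y) (transposition B F \<epsilon>)"
  by (intro cat_functor.intro A.category_hom_cat B.category_hom_cat)
    (use assms in \<open>auto simp: transposition_def A.arrows_hom_cat B.arrows_hom_cat hom1_def hom2_def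
      B.whisker_left_vcomp split: if_splits\<close>)

lemma universal_arrow_if_equivalence:
  assumes X: "X \<in> Ob A" and \<epsilon>: "\<epsilon> \<in> hom1 B (ap0 F X) Y"
    and ff: "\<And>Z. Z \<in> Ob A \<Longrightarrow> fully_faithful (hom_cat A Z X) (hom_cat B (ap0 F Z) Y) (transposition B F \<epsilon>)"
    and es: "\<And>Z. Z \<in> Ob A \<Longrightarrow> essentially_surjective (hom_cat A Z X) (hom_cat B (ap0 F Z) Y) (transposition B F \<epsilon>)"
  shows "universal_arrow Y X \<epsilon>"
  unfolding universal_arrow_def
proof (intro conjI ballI impI X \<epsilon>)
  fix Z f assume Z: "Z \<in> Ob A" and f: "f \<in> hom1 B (ap0 F Z) Y"
  obtain c \<psi> where c: "c \<in> hom1 A Z X" and \<psi>: "\<psi> \<in> arrows (hom_cat B (ap0 F Z) Y) (\<epsilon> \<odot>\<^bsub>B\<^esub> ap1 F c) f"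
      and iso: "is_iso (hom_cat B (ap0 F Z) Y) \<psi>"
    using es[OF Z] f unfolding essentially_surjective_def by (auto simp: transposition_def)
  have "\<epsilon> \<odot>\<^bsub>B\<^esub> ap1 F c \<in> hom1 B (ap0 F Z) Y" using c \<epsilon> by (simp add: hom1_def)
  then have "\<psi> \<in> hom2 B (\<epsilon> \<odot>\<^bsub>B\<^esub> ap1 F c) f" "B.iso2 \<psi>"
    using \<psi> iso B.is_iso_hom_cat[of \<psi> "ap0 F Z" Y] by (auto simp: B.arrows_hom_cat hom2_def)
  with c show "\<exists>c \<in> hom1 A Z X. \<exists>\<psi> \<in> hom2 B (\<epsilon> \<odot>\<^bsub>B\<^esub> ap1 F c) f. B.iso2 \<psi>" by blast
next
  fix Z c d \<chi> assume Z: "Z \<in> Ob A" and c: "c \<in> hom1 A Z X" and d: "d \<in> hom1 A Z X"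
    and \<chi>: "\<chi> \<in> hom2 B (\<epsilon> \<odot>\<^bsub>B\<^esub> ap1 F c) (\<epsilon> \<odot>\<^bsub>B\<^esub> ap1 F d)" "B.iso2 \<chi>"
  have "\<epsilon> \<odot>\<^bsub>B\<^esub> ap1 F c \<in> hom1 B (ap0 F Z) Y" using c \<epsilon> by (simp add: hom1_def)
  then show "\<exists>!\<beta>. \<beta> \<in> hom2 A c d \<and> id2 B \<epsilon> \<star>\<^bsub>B\<^esub> ap2 F \<beta> = \<chi>"
    using ff[OF Z] c d \<chi> unfolding fully_faithful_def
    by (simp add: transposition_def A.arrows_hom_cat B.arrows_hom_cat)
qed

end

text \<open>
  The counit of a bi-adjunction is \<open>\<epsilon> = \<Phi>(id)\<close>.  The constraint of \<open>\<Phi>\<close> at \<open>(c, id)\<close>, evaluated at the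
  identity of \<open>R Y\<close>, is a natural isomorphism \<open>\<epsilon> (L c) \<cong> \<Phi> c\<close> (a bicategorical Yoneda argument), so
  transposition along \<open>\<epsilon>\<close> is an equivalence because \<open>\<Phi>\<close> is.
\<close>

lemma (in bi_adjunction) universal_arrow_counit:
  assumes Y: "Y \<in> Ob D"
  defines "X \<equiv> ap0 R Y"
  defines "\<epsilon>' \<equiv> fob (\<Phi> (X, Y)) (id1 C X)"
  shows "left_psfun.universal_arrow Y X \<epsilon>'"
proof -
  have X: "X \<in> Ob C" using Y by (simp add: X_def)
  have \<Phi>: "cat_functor (hom_cat C Z X) (hom_cat D (ap0 L Z) Y) (\<Phi> (Z, Y))" if "Z \<in> Ob C" for Z
    using component[of "(Z, Y)"] that Y by (simp add: hom_right_def hom_left_def X_def)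
  have idX: "id1 C X \<in> hom1 C X X" using X by (simp add: hom1_def)
  have \<epsilon>: "\<epsilon>' \<in> hom1 D (ap0 L X) Y"
    using cat_functor.fob_in[OF \<Phi>[OF X]] idX by (simp add: \<epsilon>'_def)
  define t where "t c = \<theta> (c, id1 D Y) (id1 C X)" for c
  have iso: "nat_iso (hom_cat C Z X) (hom_cat D (ap0 L Z) Y) (transposition D L \<epsilon>') (\<Phi> (Z, Y)) t"
    if Z: "Z \<in> Ob C" for Z
  proof -
    have t: "t c \<in> arrows (hom_cat D (ap0 L Z) Y) (\<epsilon>' \<odot>\<^bsub>D\<^esub> ap1 L c) (fob (\<Phi> (Z, Y)) c)
        \<and> is_iso (hom_cat D (ap0 L Z) Y) (t c)" if c: "c \<in> hom1 C Z X" for c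
    proof -
      have "(c, id1 D Y) \<in> hom1 (prod2 (op2 C) D) (X, Y) (Z, Y)" using c Y by (simp add: hom1_def)
      from constraint[OF this] interpret \<theta>: nat_iso "hom_cat C X X" "hom_cat D (ap0 L Z) Y"
        "fun_comp (at_mor (hom_left D L) (c, id1 D Y)) (\<Phi> (X, Y))"
        "fun_comp (\<Phi> (Z, Y)) (at_mor (hom_right C R) (c, id1 D Y))" "\<theta> (c, id1 D Y)"
        by (simp add: hom_right_def hom_left_def X_def)
      show ?thesis
        using \<theta>.component_in[of "id1 C X"] \<theta>.component_iso[of "id1 C X"] idX c \<epsilon> Y
        by (simp add: t_def hom_right_def hom_left_def fun_comp_def hom1_def X_def[symmetric] \<epsilon>'_def[symmetric])
    qed
    have nat: "t d \<bullet>\<^bsub>D\<^esub> (id2 D \<epsilon>' \<star>\<^bsub>D\<^esub> ap2 L \<beta>) = far (\<Phi> (Z, Y)) \<beta> \<bullet>\<^bsub>D\<^esub> t c"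
      if c: "c \<in> hom1 C Z X" and \<beta>: "\<beta> \<in> hom2 C c d" for c d \<beta>
    proof -
      have c': "(c, id1 D Y) \<in> hom1 (prod2 (op2 C) D) (X, Y) (Z, Y)" using c Y by (simp add: hom1_def)
      have \<beta>': "(\<beta>, id2 D (id1 D Y)) \<in> hom2 (prod2 (op2 C) D) (c, id1 D Y) (d, id1 D Y)"
        using \<beta> Y by (simp add: hom2_def)
      show ?thesis
        using constraint_natural[OF c' \<beta>', of "id1 C X"] idX c \<beta> \<epsilon> Y
        by (simp add: t_def hom_right_def hom_left_def hom1_def hom2_def X_def[symmetric] \<epsilon>'_def[symmetric])
    qed
    show ?thesis
      by (intro nat_iso.intro nat_trans.intro left_psfun.cat_functor_transposition[OF \<epsilon>] \<Phi>[OF Z]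
          nat_trans_axioms.intro nat_iso_axioms.intro)
        (use t nat in \<open>auto simp: transposition_def left_psfun.A.arrows_hom_cat split: if_splits\<close>)
  qed
  have eq: "adjoint_equivalence (hom_cat C Z X) (hom_cat D (ap0 L Z) Y) (\<Phi> (Z, Y)) (\<Psi> (Z, Y)) (\<eta> (Z, Y)) (\<epsilon> (Z, Y))"
    if "Z \<in> Ob C" for Z
    using component_equivalence[OF that Y] by (simp add: X_def)
  show ?thesis
    by (rule left_psfun.universal_arrow_if_equivalence[OF X \<epsilon>])
      (use fully_faithful_nat_iso[OF iso] essentially_surjective_nat_iso[OF iso]
        adjoint_equivalence.fully_faithful[OF eq] adjoint_equivalence.essentially_surjective[OF eq] in blast)+
qed


section \<open>Tensors by the arrow category\<close>

text \<open>
  The universal property of a tensor by \<open>\<two>\<close> without functor categories: 1-cells out of \<open>T\<close> are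
  2-cells between 1-cells out of \<open>X\<close>, and 2-cells out of \<open>T\<close> are commutative squares of these.
\<close>

definition arrow_tensor :: "('o, 'm, 'c) twocat \<Rightarrow> 'o \<Rightarrow> 'o \<Rightarrow> 'm \<Rightarrow> 'm \<Rightarrow> 'c \<Rightarrow> bool" where
  "arrow_tensor C X T z0 z1 z \<longleftrightarrow> T \<in> Ob C \<and> z0 \<in> hom1 C X T \<and> z1 \<in> hom1 C X T \<and> z \<in> hom2 C z0 z1
    \<and> (\<forall>Y \<in> Ob C. \<forall>f \<in> hom1 C X Y. \<forall>g \<in> hom1 C X Y. \<forall>\<chi> \<in> hom2 C f g.
        \<exists>h \<in> hom1 C T Y. h \<odot>\<^bsub>C\<^esub> z0 = f \<and> h \<odot>\<^bsub>C\<^esub> z1 = g \<and> id2 C h \<star>\<^bsub>C\<^esub> z = \<chi>)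
    \<and> (\<forall>Y \<in> Ob C. \<forall>h \<in> hom1 C T Y. \<forall>k \<in> hom1 C T Y.
        \<forall>\<rho>0 \<in> hom2 C (h \<odot>\<^bsub>C\<^esub> z0) (k \<odot>\<^bsub>C\<^esub> z0). \<forall>\<rho>1 \<in> hom2 C (h \<odot>\<^bsub>C\<^esub> z1) (k \<odot>\<^bsub>C\<^esub> z1).
        \<rho>1 \<bullet>\<^bsub>C\<^esub> (id2 C h \<star>\<^bsub>C\<^esub> z) = (id2 C k \<star>\<^bsub>C\<^esub> z) \<bullet>\<^bsub>C\<^esub> \<rho>0 \<longrightarrow>
        (\<exists>!\<rho>. \<rho> \<in> hom2 C h k \<and> \<rho> \<star>\<^bsub>C\<^esub> id2 C z0 = \<rho>0 \<and> \<rho> \<star>\<^bsub>C\<^esub> id2 C z1 = \<rho>1))"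

lemma walking_arrow_sel [simp]:
  "Obj walking_arrow = UNIV" "(i, j) \<in> Arr walking_arrow \<longleftrightarrow> i \<le> j" "Dom walking_arrow = fst" "Cod walking_arrow = snd"
  "Ident walking_arrow i = (i, i)" "Comp walking_arrow (j', k) (i, j) = (i, k)"
  by (simp_all add: walking_arrow_def)

lemma arrows_walking_arrow: "u \<in> arrows walking_arrow i j \<longleftrightarrow> u = (i, j) \<and> i \<le> j"
  by (cases u) (auto simp: arrows_def)

text \<open>
  A functor from \<open>\<two>\<close> is determined by an arrow and a natural transformation between two such functors
  by a commutative square, so the universal property is that of \<open>is_tensor\<close> on objects and on arrows.
\<close>

lemma arrow_tensor_if_is_tensor:
  assumes C: "two_category C" and T: "is_tensor C walking_arrow X T \<zeta>"
  shows "arrow_tensor C X T (fob \<zeta> False) (fob \<zeta> True) (far \<zeta> (False, True))"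
proof -
  interpret C: two_category C by (rule C)
  let ?W = walking_arrow and ?s = "fob \<zeta> False" and ?t = "fob \<zeta> True" and ?z = "far \<zeta> (False, True)"
  let ?K = "tensor_comparison C ?W \<zeta>"
  interpret \<zeta>: cat_functor ?W "hom_cat C X T" \<zeta> using T by (simp add: is_tensor_def)
  interpret W: category ?W by (rule \<zeta>.dom_category)
  have TX: "X \<in> Ob C" "T \<in> Ob C" using T by (simp_all add: is_tensor_def)
  have z01: "fob \<zeta> i \<in> hom1 C X T" for i using \<zeta>.fob_in[of i] by simp
  have z: "far \<zeta> (i, j) \<in> hom2 C (fob \<zeta> i) (fob \<zeta> j)" if "i \<le> j" for i j
    using \<zeta>.far_in[of "(i, j)" i j] that z01 by (simp add: arrows_walking_arrow C.arrows_hom_cat)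
  have zid: "far \<zeta> (i, i) = id2 C (fob \<zeta> i)" for i
    using \<zeta>.far_Ident[of i] by simp
  have K_fob: "fob ?K h = \<lparr>fob = \<lambda>i. h \<odot>\<^bsub>C\<^esub> fob \<zeta> i, far = \<lambda>u \<in> Arr ?W. id2 C h \<star>\<^bsub>C\<^esub> far \<zeta> u\<rparr>"
    and K_far: "far ?K \<gamma> = (fob ?K (dom2 C \<gamma>), fob ?K (cod2 C \<gamma>), \<lambda>i. \<gamma> \<star>\<^bsub>C\<^esub> id2 C (fob \<zeta> i))" for h \<gamma>
    by (simp_all add: tensor_comparison_def Let_def restrict_UNIV)
  have iso: "iso_of_categories (hom_cat C T Y) (functor_cat ?W (hom_cat C X Y)) ?K" if "Y \<in> Ob C" for Y
    using T that by (simp add: is_tensor_def)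
  have one: "\<exists>h \<in> hom1 C T Y. h \<odot>\<^bsub>C\<^esub> ?s = f \<and> h \<odot>\<^bsub>C\<^esub> ?t = g \<and> id2 C h \<star>\<^bsub>C\<^esub> ?z = \<chi>"
    if Y: "Y \<in> Ob C" and f: "f \<in> hom1 C X Y" and g: "g \<in> hom1 C X Y" and \<chi>: "\<chi> \<in> hom2 C f g" for Y f g \<chi>
  proof -
    define P where "P = \<lparr>fob = \<lambda>i. if i then g else f,
      far = \<lambda>u \<in> Arr ?W. if fst u then id2 C g else if snd u then \<chi> else id2 C f\<rparr>"
    have P: "P \<in> Obj (functor_cat ?W (hom_cat C X Y))"
    proof -
      have "cat_functor ?W (hom_cat C X Y) P"
        by (intro cat_functor.intro W.category_axioms C.category_hom_cat)
          (use f g \<chi> in \<open>auto simp: P_def arrows_walking_arrow C.arrows_hom_cat hom1_def hom2_def\<close>)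
      then show ?thesis by (simp add: functor_cat_def Let_def P_def)
    qed
    obtain G where G: "cat_functor (functor_cat ?W (hom_cat C X Y)) (hom_cat C T Y) G"
        "fob ?K (fob G P) = P"
      using iso[OF Y] P unfolding iso_of_categories_def by blast
    define h where "h = fob G P"
    have h: "h \<in> hom1 C T Y" "fob ?K h = P"
      using cat_functor.fob_in[OF G(1) P] G(2) by (simp_all add: h_def)
    then have "h \<odot>\<^bsub>C\<^esub> fob \<zeta> i = (if i then g else f)" "(\<lambda>u \<in> Arr ?W. id2 C h \<star>\<^bsub>C\<^esub> far \<zeta> u) = far P" for i
      using h(2) unfolding K_fob P_def by (simp_all add: fun_eq_iff)
    note 1 = this(1)[of False] this(1)[of True] fun_cong[OF this(2), of "(False, True)"]
    show ?thesis using h 1 by (intro bexI[of _ h]) (simp_all add: P_def)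
  qed
  have two: "\<exists>!\<rho>. \<rho> \<in> hom2 C h k \<and> \<rho> \<star>\<^bsub>C\<^esub> id2 C ?s = \<rho>0 \<and> \<rho> \<star>\<^bsub>C\<^esub> id2 C ?t = \<rho>1"
    if Y: "Y \<in> Ob C" and h: "h \<in> hom1 C T Y" and k: "k \<in> hom1 C T Y"
      and \<rho>0: "\<rho>0 \<in> hom2 C (h \<odot>\<^bsub>C\<^esub> ?s) (k \<odot>\<^bsub>C\<^esub> ?s)" and \<rho>1: "\<rho>1 \<in> hom2 C (h \<odot>\<^bsub>C\<^esub> ?t) (k \<odot>\<^bsub>C\<^esub> ?t)"
      and square: "\<rho>1 \<bullet>\<^bsub>C\<^esub> (id2 C h \<star>\<^bsub>C\<^esub> ?z) = (id2 C k \<star>\<^bsub>C\<^esub> ?z) \<bullet>\<^bsub>C\<^esub> \<rho>0" for Y h k \<rho>0 \<rho>1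
  proof -
    let ?F = "functor_cat ?W (hom_cat C X Y)"
    obtain G where K: "cat_functor (hom_cat C T Y) ?F ?K" and G: "cat_functor ?F (hom_cat C T Y) G"
      and GK: "\<And>x. x \<in> hom1 C T Y \<Longrightarrow> fob G (fob ?K x) = x"
        "\<And>\<gamma>. \<lbrakk>\<gamma> \<in> Cell C; dom2 C \<gamma> \<in> hom1 C T Y\<rbrakk> \<Longrightarrow> far G (far ?K \<gamma>) = \<gamma>"
      and KG: "\<And>\<alpha>. \<alpha> \<in> Arr ?F \<Longrightarrow> far ?K (far G \<alpha>) = \<alpha>"
      using iso[OF Y] unfolding iso_of_categories_def by auto
    interpret K: cat_functor "hom_cat C T Y" ?F ?K by (rule K)
    interpret G: cat_functor ?F "hom_cat C T Y" G by (rule G)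
    define \<alpha> where "\<alpha> = (fob ?K h, fob ?K k, \<lambda>i. if i then \<rho>1 else \<rho>0)"
    have Khk: "fob ?K h \<in> Obj ?F" "fob ?K k \<in> Obj ?F" using K.fob_in h k by simp_all
    have hz: "h \<odot>\<^bsub>C\<^esub> fob \<zeta> i \<in> hom1 C X Y" "k \<odot>\<^bsub>C\<^esub> fob \<zeta> i \<in> hom1 C X Y" for i
      using z01[of i] h k by (simp_all add: hom1_def)
    have nat: "far (fob ?K k) (i, j) \<bullet>\<^bsub>C\<^esub> (if i then \<rho>1 else \<rho>0) = (if j then \<rho>1 else \<rho>0) \<bullet>\<^bsub>C\<^esub> far (fob ?K h) (i, j)"
      if "i \<le> j" for i j
    proof (cases "i = j")
      case True
      then show ?thesis
        using \<rho>0 \<rho>1 h k z01[of i] hz[of i] by (auto simp: K_fob zid hom1_def hom2_def)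
    next
      case False
      then have "\<not> i" "j" using \<open>i \<le> j\<close> by auto
      then show ?thesis using square by (simp add: K_fob)
    qed
    have "nat_trans ?W (hom_cat C X Y) (fob ?K h) (fob ?K k) (\<lambda>i. if i then \<rho>1 else \<rho>0)"
    proof (intro nat_trans.intro nat_trans_axioms.intro)
      show "cat_functor ?W (hom_cat C X Y) (fob ?K h)" "cat_functor ?W (hom_cat C X Y) (fob ?K k)"
        using Khk by (simp_all add: functor_cat_def Let_def)
      show "(if i then \<rho>1 else \<rho>0) \<in> arrows (hom_cat C X Y) (fob (fob ?K h) i) (fob (fob ?K k) i)" for i
        using \<rho>0 \<rho>1 hz by (simp add: K_fob C.arrows_hom_cat)
    qed (use nat in \<open>auto simp: arrows_walking_arrow\<close>)
    then have \<alpha>: "\<alpha> \<in> arrows ?F (fob ?K h) (fob ?K k)"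
      using Khk by (simp add: arrows_def functor_cat_def Let_def \<alpha>_def)
    have \<alpha>': "far G \<alpha> \<in> hom2 C h k"
      using G.far_in[OF \<alpha>] GK(1)[OF h] GK(1)[OF k] h by (simp add: C.arrows_hom_cat)
    have K\<alpha>: "far ?K (far G \<alpha>) = \<alpha>" using KG \<alpha> by (simp add: arrows_def)
    have iff: "far ?K \<rho> = \<alpha> \<longleftrightarrow> \<rho> \<star>\<^bsub>C\<^esub> id2 C ?s = \<rho>0 \<and> \<rho> \<star>\<^bsub>C\<^esub> id2 C ?t = \<rho>1" if "\<rho> \<in> hom2 C h k" for \<rho>
      using that by (auto simp: K_far \<alpha>_def hom2_def fun_eq_iff)
    show ?thesis
    proof (rule ex1I[of _ "far G \<alpha>"])
      show "far G \<alpha> \<in> hom2 C h k \<and> far G \<alpha> \<star>\<^bsub>C\<^esub> id2 C ?s = \<rho>0 \<and> far G \<alpha> \<star>\<^bsub>C\<^esub> id2 C ?t = \<rho>1"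
        using \<alpha>' K\<alpha> iff by blast
    next
      fix \<rho> assume "\<rho> \<in> hom2 C h k \<and> \<rho> \<star>\<^bsub>C\<^esub> id2 C ?s = \<rho>0 \<and> \<rho> \<star>\<^bsub>C\<^esub> id2 C ?t = \<rho>1"
      then have "\<rho> \<in> hom2 C h k" "far ?K \<rho> = \<alpha>" using iff by blast+
      then show "\<rho> = far G \<alpha>" using GK(2)[of \<rho>] h by (simp add: hom2_def)
    qed
  qed
  show ?thesis
    unfolding arrow_tensor_def using TX z01 z[of False True] one two by simp
qed

text \<open>
  Preservation of a tensor \<open>T\<close> is stated by an isomorphism of \<open>L T\<close> with a tensor in \<open>D\<close>.  Precomposition
  with the isomorphism and with its inverse carries the universal property over to \<open>L T\<close> itself.
\<close>

lemma arrow_tensor_transport: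
  assumes C: "two_category C" and S: "arrow_tensor C X S w0 w1 w"
    and i: "i \<in> hom1 C T S" "is_iso (cat1 C) i"
    and z: "z0 \<in> hom1 C X T" "z1 \<in> hom1 C X T" "z \<in> hom2 C z0 z1"
    and w: "i \<odot>\<^bsub>C\<^esub> z0 = w0" "i \<odot>\<^bsub>C\<^esub> z1 = w1" "id2 C i \<star>\<^bsub>C\<^esub> z = w"
  shows "arrow_tensor C X T z0 z1 z"
proof -
  interpret C: two_category C by (rule C)
  define j where "j = the_inverse (cat1 C) i"
  have j: "j \<in> hom1 C S T" "j \<odot>\<^bsub>C\<^esub> i = id1 C T" "i \<odot>\<^bsub>C\<^esub> j = id1 C S"
    using C.cat1.the_inverse[of i T S] i unfolding j_def by simp_all
  have T: "T \<in> Ob C" using i by (auto simp: hom1_def)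
  have jw: "j \<odot>\<^bsub>C\<^esub> w0 = z0" "j \<odot>\<^bsub>C\<^esub> w1 = z1" "id2 C j \<star>\<^bsub>C\<^esub> w = z"
  proof -
    have "j \<odot>\<^bsub>C\<^esub> (i \<odot>\<^bsub>C\<^esub> y) = y" if "y \<in> hom1 C X T" for y
      using C.comp1_assoc[of y i j] i j that by (simp add: hom1_def)
    then show "j \<odot>\<^bsub>C\<^esub> w0 = z0" "j \<odot>\<^bsub>C\<^esub> w1 = z1" using w z by auto
    show "id2 C j \<star>\<^bsub>C\<^esub> w = z"
      using C.whisker_comp1[of i j z] i j z unfolding w(3)[symmetric] by (simp add: hom1_def hom2_def)
  qed
  have one: "\<exists>h \<in> hom1 C T Y. h \<odot>\<^bsub>C\<^esub> z0 = f \<and> h \<odot>\<^bsub>C\<^esub> z1 = g \<and> id2 C h \<star>\<^bsub>C\<^esub> z = \<chi>"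
    if Y: "Y \<in> Ob C" and f: "f \<in> hom1 C X Y" and g: "g \<in> hom1 C X Y" and \<chi>: "\<chi> \<in> hom2 C f g" for Y f g \<chi>
  proof -
    obtain h where h: "h \<in> hom1 C S Y" "h \<odot>\<^bsub>C\<^esub> w0 = f" "h \<odot>\<^bsub>C\<^esub> w1 = g" "id2 C h \<star>\<^bsub>C\<^esub> w = \<chi>"
      using S Y f g \<chi> unfolding arrow_tensor_def by blast
    have "id2 C (h \<odot>\<^bsub>C\<^esub> i) \<star>\<^bsub>C\<^esub> z = \<chi>"
      using C.whisker_comp1[of i h z] h(1) i z w(3) h(4) by (simp add: hom1_def hom2_def)
    then show ?thesis
      using h i z w by (intro bexI[of _ "h \<odot>\<^bsub>C\<^esub> i"]) (simp_all add: hom1_def)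
  qed
  have two: "\<exists>!\<rho>. \<rho> \<in> hom2 C h k \<and> \<rho> \<star>\<^bsub>C\<^esub> id2 C z0 = \<rho>0 \<and> \<rho> \<star>\<^bsub>C\<^esub> id2 C z1 = \<rho>1"
    if Y: "Y \<in> Ob C" and h: "h \<in> hom1 C T Y" and k: "k \<in> hom1 C T Y"
      and \<rho>0: "\<rho>0 \<in> hom2 C (h \<odot>\<^bsub>C\<^esub> z0) (k \<odot>\<^bsub>C\<^esub> z0)" and \<rho>1: "\<rho>1 \<in> hom2 C (h \<odot>\<^bsub>C\<^esub> z1) (k \<odot>\<^bsub>C\<^esub> z1)"
      and square: "\<rho>1 \<bullet>\<^bsub>C\<^esub> (id2 C h \<star>\<^bsub>C\<^esub> z) = (id2 C k \<star>\<^bsub>C\<^esub> z) \<bullet>\<^bsub>C\<^esub> \<rho>0" for Y h k \<rho>0 \<rho>1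
  proof -
    have hj: "h \<odot>\<^bsub>C\<^esub> j \<in> hom1 C S Y" "k \<odot>\<^bsub>C\<^esub> j \<in> hom1 C S Y" using h k j by (simp_all add: hom1_def)
    have ws: "w0 \<in> hom1 C X S" "w1 \<in> hom1 C X S" "w \<in> hom2 C w0 w1" using S by (simp_all add: arrow_tensor_def)
    have e: "(y \<odot>\<^bsub>C\<^esub> j) \<odot>\<^bsub>C\<^esub> w0 = y \<odot>\<^bsub>C\<^esub> z0" "(y \<odot>\<^bsub>C\<^esub> j) \<odot>\<^bsub>C\<^esub> w1 = y \<odot>\<^bsub>C\<^esub> z1"
        "id2 C (y \<odot>\<^bsub>C\<^esub> j) \<star>\<^bsub>C\<^esub> w = id2 C y \<star>\<^bsub>C\<^esub> z" "(y \<odot>\<^bsub>C\<^esub> j) \<odot>\<^bsub>C\<^esub> i = y" if "y \<in> hom1 C T Y" for y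
      using that j ws jw i C.whisker_comp1[of j y w] by (simp_all add: hom1_def hom2_def)
    have ex1: "\<exists>!\<rho>. \<rho> \<in> hom2 C (h \<odot>\<^bsub>C\<^esub> j) (k \<odot>\<^bsub>C\<^esub> j) \<and> \<rho> \<star>\<^bsub>C\<^esub> id2 C w0 = \<rho>0 \<and> \<rho> \<star>\<^bsub>C\<^esub> id2 C w1 = \<rho>1"
      using S Y hj \<rho>0 \<rho>1 square e[OF h] e[OF k] unfolding arrow_tensor_def by simp
    have wi: "id2 C i \<star>\<^bsub>C\<^esub> id2 C z0 = id2 C w0" "id2 C i \<star>\<^bsub>C\<^esub> id2 C z1 = id2 C w1"
        "id2 C j \<star>\<^bsub>C\<^esub> id2 C w0 = id2 C z0" "id2 C j \<star>\<^bsub>C\<^esub> id2 C w1 = id2 C z1"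
      using i j z ws w jw by (simp_all add: hom1_def)
    from ex1 obtain \<rho> where \<rho>: "\<rho> \<in> hom2 C (h \<odot>\<^bsub>C\<^esub> j) (k \<odot>\<^bsub>C\<^esub> j)" "\<rho> \<star>\<^bsub>C\<^esub> id2 C w0 = \<rho>0" "\<rho> \<star>\<^bsub>C\<^esub> id2 C w1 = \<rho>1" by blast
    show ?thesis
    proof (rule ex1I[of _ "\<rho> \<star>\<^bsub>C\<^esub> id2 C i"])
      have "\<rho> \<star>\<^bsub>C\<^esub> id2 C i \<in> hom2 C h k"
        using \<rho>(1) hj i e(4)[OF h] e(4)[OF k] by (simp add: hom1_def hom2_def)
      moreover have "(\<rho> \<star>\<^bsub>C\<^esub> id2 C i) \<star>\<^bsub>C\<^esub> id2 C z0 = \<rho>0" "(\<rho> \<star>\<^bsub>C\<^esub> id2 C i) \<star>\<^bsub>C\<^esub> id2 C z1 = \<rho>1"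
        using C.hcomp_assoc'[of "id2 C z0" "id2 C i" \<rho>] C.hcomp_assoc'[of "id2 C z1" "id2 C i" \<rho>] \<rho> hj i z wi
        by (simp_all add: hom1_def hom2_def w)
      ultimately show "\<rho> \<star>\<^bsub>C\<^esub> id2 C i \<in> hom2 C h k \<and> (\<rho> \<star>\<^bsub>C\<^esub> id2 C i) \<star>\<^bsub>C\<^esub> id2 C z0 = \<rho>0 \<and>
        (\<rho> \<star>\<^bsub>C\<^esub> id2 C i) \<star>\<^bsub>C\<^esub> id2 C z1 = \<rho>1" by blast
    next
      fix \<sigma> assume \<sigma>: "\<sigma> \<in> hom2 C h k \<and> \<sigma> \<star>\<^bsub>C\<^esub> id2 C z0 = \<rho>0 \<and> \<sigma> \<star>\<^bsub>C\<^esub> id2 C z1 = \<rho>1"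
      have "\<sigma> \<star>\<^bsub>C\<^esub> id2 C j \<in> hom2 C (h \<odot>\<^bsub>C\<^esub> j) (k \<odot>\<^bsub>C\<^esub> j)"
        using \<sigma> h k j by (simp add: hom1_def hom2_def)
      moreover have "(\<sigma> \<star>\<^bsub>C\<^esub> id2 C j) \<star>\<^bsub>C\<^esub> id2 C w0 = \<rho>0" "(\<sigma> \<star>\<^bsub>C\<^esub> id2 C j) \<star>\<^bsub>C\<^esub> id2 C w1 = \<rho>1"
        using C.hcomp_assoc'[of "id2 C w0" "id2 C j" \<sigma>] C.hcomp_assoc'[of "id2 C w1" "id2 C j" \<sigma>] \<sigma> h k j ws wi
        by (simp_all add: hom1_def hom2_def jw)
      ultimately have "\<sigma> \<star>\<^bsub>C\<^esub> id2 C j = \<rho>" using ex1 \<rho> by blast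
      then have "\<rho> \<star>\<^bsub>C\<^esub> id2 C i = \<sigma> \<star>\<^bsub>C\<^esub> (id2 C j \<star>\<^bsub>C\<^esub> id2 C i)"
        using \<sigma> h j i by (auto simp: hom1_def hom2_def simp del: C.hcomp_id2')
      then show "\<sigma> = \<rho> \<star>\<^bsub>C\<^esub> id2 C i" using \<sigma> h i j by (simp add: hom1_def hom2_def)
    qed
  qed
  show ?thesis unfolding arrow_tensor_def using T z one two by simp
qed

lemma preserved_arrow_tensor:
  assumes L: "normal_pseudo_functor C D L" and pres: "preserves_tensors C D L walking_arrow" and X: "X \<in> Ob C"
  obtains T z0 z1 z where "arrow_tensor C X T z0 z1 z"
    "arrow_tensor D (ap0 L X) (ap0 L T) (ap1 L z0) (ap1 L z1) (ap2 L z)"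
proof -
  interpret L: normal_pseudo_functor C D L by (rule L)
  obtain T \<zeta> S \<xi> i where T: "is_tensor C walking_arrow X T \<zeta>" and S: "is_tensor D walking_arrow (ap0 L X) S \<xi>"
    and i: "i \<in> hom1 D (ap0 L T) S" "is_iso (cat1 D) i"
    and \<zeta>\<xi>: "\<And>x. i \<odot>\<^bsub>D\<^esub> ap1 L (fob \<zeta> x) = fob \<xi> x"
      "\<And>u. u \<in> Arr walking_arrow \<Longrightarrow> id2 D i \<star>\<^bsub>D\<^esub> ap2 L (far \<zeta> u) = far \<xi> u"
    using pres X unfolding preserves_tensors_def by auto
  note T' = arrow_tensor_if_is_tensor[OF L.A.two_category_axioms T]
    and S' = arrow_tensor_if_is_tensor[OF L.B.two_category_axioms S]
  have "arrow_tensor D (ap0 L X) (ap0 L T) (ap1 L (fob \<zeta> False)) (ap1 L (fob \<zeta> True)) (ap2 L (far \<zeta> (False, True)))"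
    by (rule arrow_tensor_transport[OF L.B.two_category_axioms S' i])
      (use T' \<zeta>\<xi> in \<open>auto simp: arrow_tensor_def hom1_def hom2_def\<close>)
  with T' show thesis by (rule that)
qed


text \<open>
  A commutative square with invertible sides comes from an invertible 2-cell: the inverse sides also
  form a square, and uniqueness shows that the 2-cells of the two squares are mutually inverse.
\<close>

lemma arrow_tensor_iso:
  assumes C: "two_category C" and T: "arrow_tensor C X T z0 z1 z"
    and h: "h \<in> hom1 C T Y" and k: "k \<in> hom1 C T Y"
    and \<rho>0: "\<rho>0 \<in> hom2 C (h \<odot>\<^bsub>C\<^esub> z0) (k \<odot>\<^bsub>C\<^esub> z0)" "is_iso (cat2 C) \<rho>0"
    and \<rho>1: "\<rho>1 \<in> hom2 C (h \<odot>\<^bsub>C\<^esub> z1) (k \<odot>\<^bsub>C\<^esub> z1)" "is_iso (cat2 C) \<rho>1"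
    and square: "\<rho>1 \<bullet>\<^bsub>C\<^esub> (id2 C h \<star>\<^bsub>C\<^esub> z) = (id2 C k \<star>\<^bsub>C\<^esub> z) \<bullet>\<^bsub>C\<^esub> \<rho>0"
  obtains \<rho> where "\<rho> \<in> hom2 C h k" "is_iso (cat2 C) \<rho>" "\<rho> \<star>\<^bsub>C\<^esub> id2 C z0 = \<rho>0" "\<rho> \<star>\<^bsub>C\<^esub> id2 C z1 = \<rho>1"
proof -
  interpret C: two_category C by (rule C)
  have Y: "Y \<in> Ob C" using h by (auto simp: hom1_def)
  have z: "z0 \<in> hom1 C X T" "z1 \<in> hom1 C X T" "z \<in> hom2 C z0 z1" using T by (simp_all add: arrow_tensor_def)
  note simps = hom1_def hom2_def
  have ex1: "\<exists>!\<rho>. \<rho> \<in> hom2 C h k \<and> \<rho> \<star>\<^bsub>C\<^esub> id2 C z0 = \<rho>0 \<and> \<rho> \<star>\<^bsub>C\<^esub> id2 C z1 = \<rho>1"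
    if "h \<in> hom1 C T Y" "k \<in> hom1 C T Y" "\<rho>0 \<in> hom2 C (h \<odot>\<^bsub>C\<^esub> z0) (k \<odot>\<^bsub>C\<^esub> z0)" "\<rho>1 \<in> hom2 C (h \<odot>\<^bsub>C\<^esub> z1) (k \<odot>\<^bsub>C\<^esub> z1)"
      "\<rho>1 \<bullet>\<^bsub>C\<^esub> (id2 C h \<star>\<^bsub>C\<^esub> z) = (id2 C k \<star>\<^bsub>C\<^esub> z) \<bullet>\<^bsub>C\<^esub> \<rho>0" for h k \<rho>0 \<rho>1
    using T that Y unfolding arrow_tensor_def by blast
  have inv: "C.inv2 \<rho>0 \<in> hom2 C (k \<odot>\<^bsub>C\<^esub> z0) (h \<odot>\<^bsub>C\<^esub> z0)" "C.inv2 \<rho>1 \<in> hom2 C (k \<odot>\<^bsub>C\<^esub> z1) (h \<odot>\<^bsub>C\<^esub> z1)"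
    using \<rho>0 \<rho>1 by (simp_all add: hom2_def)
  have square': "C.inv2 \<rho>1 \<bullet>\<^bsub>C\<^esub> (id2 C k \<star>\<^bsub>C\<^esub> z) = (id2 C h \<star>\<^bsub>C\<^esub> z) \<bullet>\<^bsub>C\<^esub> C.inv2 \<rho>0"
  proof (rule C.iso2_left_cancel[of \<rho>1])
    have "\<rho>1 \<bullet>\<^bsub>C\<^esub> ((id2 C h \<star>\<^bsub>C\<^esub> z) \<bullet>\<^bsub>C\<^esub> C.inv2 \<rho>0) = ((id2 C k \<star>\<^bsub>C\<^esub> z) \<bullet>\<^bsub>C\<^esub> \<rho>0) \<bullet>\<^bsub>C\<^esub> C.inv2 \<rho>0"
      using \<rho>0 \<rho>1 h k z by (intro C.vcomp_replace square) (simp_all add: simps)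
    then show "\<rho>1 \<bullet>\<^bsub>C\<^esub> (C.inv2 \<rho>1 \<bullet>\<^bsub>C\<^esub> (id2 C k \<star>\<^bsub>C\<^esub> z)) = \<rho>1 \<bullet>\<^bsub>C\<^esub> ((id2 C h \<star>\<^bsub>C\<^esub> z) \<bullet>\<^bsub>C\<^esub> C.inv2 \<rho>0)"
      using \<rho>0 \<rho>1 h k z by (simp add: simps)
  qed (use \<rho>0 \<rho>1 h k z in \<open>simp_all add: simps\<close>)
  obtain \<rho> where \<rho>: "\<rho> \<in> hom2 C h k" "\<rho> \<star>\<^bsub>C\<^esub> id2 C z0 = \<rho>0" "\<rho> \<star>\<^bsub>C\<^esub> id2 C z1 = \<rho>1"
    using ex1[OF h k \<rho>0(1) \<rho>1(1) square] by blast
  obtain \<sigma> where \<sigma>: "\<sigma> \<in> hom2 C k h" "\<sigma> \<star>\<^bsub>C\<^esub> id2 C z0 = C.inv2 \<rho>0" "\<sigma> \<star>\<^bsub>C\<^esub> id2 C z1 = C.inv2 \<rho>1"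
    using ex1[OF k h inv square'] by blast
  have comp: "\<tau>' \<bullet>\<^bsub>C\<^esub> \<tau> = id2 C f"
    if f: "f \<in> hom1 C T Y" and g: "g \<in> hom1 C T Y" and \<tau>: "\<tau> \<in> hom2 C f g" "\<tau>' \<in> hom2 C g f"
      and e: "(\<tau>' \<star>\<^bsub>C\<^esub> id2 C z0) \<bullet>\<^bsub>C\<^esub> (\<tau> \<star>\<^bsub>C\<^esub> id2 C z0) = id2 C (f \<odot>\<^bsub>C\<^esub> z0)"
      "(\<tau>' \<star>\<^bsub>C\<^esub> id2 C z1) \<bullet>\<^bsub>C\<^esub> (\<tau> \<star>\<^bsub>C\<^esub> id2 C z1) = id2 C (f \<odot>\<^bsub>C\<^esub> z1)" for f g \<tau> \<tau>'
  proof -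
    have "\<exists>!\<rho>. \<rho> \<in> hom2 C f f \<and> \<rho> \<star>\<^bsub>C\<^esub> id2 C z0 = id2 C (f \<odot>\<^bsub>C\<^esub> z0) \<and> \<rho> \<star>\<^bsub>C\<^esub> id2 C z1 = id2 C (f \<odot>\<^bsub>C\<^esub> z1)"
      by (rule ex1[OF f f]) (use f z in \<open>simp_all add: simps\<close>)
    moreover have "\<tau>' \<bullet>\<^bsub>C\<^esub> \<tau> \<in> hom2 C f f" "(\<tau>' \<bullet>\<^bsub>C\<^esub> \<tau>) \<star>\<^bsub>C\<^esub> id2 C z0 = id2 C (f \<odot>\<^bsub>C\<^esub> z0)"
        "(\<tau>' \<bullet>\<^bsub>C\<^esub> \<tau>) \<star>\<^bsub>C\<^esub> id2 C z1 = id2 C (f \<odot>\<^bsub>C\<^esub> z1)"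
      using f g z \<tau> e by (simp_all add: simps C.whisker_right_vcomp)
    moreover have "id2 C f \<in> hom2 C f f" "id2 C f \<star>\<^bsub>C\<^esub> id2 C z0 = id2 C (f \<odot>\<^bsub>C\<^esub> z0)"
        "id2 C f \<star>\<^bsub>C\<^esub> id2 C z1 = id2 C (f \<odot>\<^bsub>C\<^esub> z1)"
      using f z by (simp_all add: simps)
    ultimately show ?thesis by blast
  qed
  have "\<sigma> \<bullet>\<^bsub>C\<^esub> \<rho> = id2 C h" "\<rho> \<bullet>\<^bsub>C\<^esub> \<sigma> = id2 C k"
    by (rule comp[OF h k \<rho>(1) \<sigma>(1)] comp[OF k h \<sigma>(1) \<rho>(1)]; use \<rho> \<sigma> \<rho>0 \<rho>1 in \<open>simp add: simps\<close>)+
  then have "C.iso2 \<rho>" using C.iso2I[of \<rho> \<sigma>] \<rho>(1) \<sigma>(1) by (simp add: simps)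
  with \<rho> show thesis using that by blast
qed

section \<open>Universal arrows and full faithfulness\<close>

context normal_pseudo_functor
begin

lemma transposed_cpt_natural:
  assumes "e \<in> Mor B" "\<beta> \<in> Cell A" "\<gamma> \<in> Cell A" "src B e = ap0 F (tgt A (dom2 A \<beta>))"
    "tgt A (dom2 A \<gamma>) = src A (dom2 A \<beta>)" "dom2 A \<gamma> = c" "cod2 A \<gamma> = c'" "dom2 A \<beta> = g" "cod2 A \<beta> = g'"
  shows "(id2 B e \<star>\<^bsub>B\<^esub> cpt F c' g') \<bullet>\<^bsub>B\<^esub> (id2 B e \<star>\<^bsub>B\<^esub> (ap2 F \<beta> \<star>\<^bsub>B\<^esub> ap2 F \<gamma>))
    = (id2 B e \<star>\<^bsub>B\<^esub> ap2 F (\<beta> \<star>\<^bsub>A\<^esub> \<gamma>)) \<bullet>\<^bsub>B\<^esub> (id2 B e \<star>\<^bsub>B\<^esub> cpt F c g)"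
proof -
  have "c \<in> Mor A" "c' \<in> Mor A" "g \<in> Mor A" "g' \<in> Mor A" "src A g = tgt A c" "src A g' = tgt A c'"
      "tgt A c' = tgt A c" "tgt A g' = tgt A g"
    using assms A.dom2_Mor[of \<beta>] A.cod2_Mor[of \<beta>] A.dom2_Mor[of \<gamma>] A.cod2_Mor[of \<gamma>]
      A.src_cod2[of \<beta>] A.tgt_cod2[of \<beta>] A.src_cod2[of \<gamma>] A.tgt_cod2[of \<gamma>] by metis+
  then show ?thesis
    using assms cpt_natural'[of \<gamma> \<beta>] by (simp add: B.whisker_left_vcomp[symmetric])
qed

text \<open>
  Universality lifts invertible 2-cells only.  A 2-cell \<open>\<chi>\<close> between transposes is a 1-cell \<open>h\<close> out of
  the preserved tensor \<open>F T\<close>, and \<open>h\<close> lifts up to isomorphism to a 1-cell \<open>k\<close> out of \<open>T\<close>, which is a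
  2-cell again; correcting its boundary by invertible 2-cells gives a lift of \<open>\<chi>\<close>.  Two lifts of the
  same 2-cell are 1-cells \<open>k, k'\<close> out of \<open>T\<close> with isomorphic transposes; that isomorphism lifts to
  \<open>k \<Rightarrow> k'\<close>, restricts to identities at both ends, and so identifies the lifts.
\<close>

lemma fully_faithful_transposition:
  assumes pres: "preserves_tensors A B F walking_arrow" and u: "universal_arrow Y X \<epsilon>" and Z: "Z \<in> Ob A"
  shows "fully_faithful (hom_cat A Z X) (hom_cat B (ap0 F Z) Y) (transposition B F \<epsilon>)"
proof -
  note simps = hom1_def hom2_def
  have X: "X \<in> Ob A" and \<epsilon>: "\<epsilon> \<in> hom1 B (ap0 F X) Y"
    and lift1: "\<And>Z f. \<lbrakk>Z \<in> Ob A; f \<in> hom1 B (ap0 F Z) Y\<rbrakk> \<Longrightarrow>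
      \<exists>c \<in> hom1 A Z X. \<exists>\<psi> \<in> hom2 B (\<epsilon> \<odot>\<^bsub>B\<^esub> ap1 F c) f. B.iso2 \<psi>"
    and lift2: "\<And>Z c d \<chi>. \<lbrakk>Z \<in> Ob A; c \<in> hom1 A Z X; d \<in> hom1 A Z X;
      \<chi> \<in> hom2 B (\<epsilon> \<odot>\<^bsub>B\<^esub> ap1 F c) (\<epsilon> \<odot>\<^bsub>B\<^esub> ap1 F d); B.iso2 \<chi>\<rbrakk> \<Longrightarrow>
      \<exists>!\<beta>. \<beta> \<in> hom2 A c d \<and> id2 B \<epsilon> \<star>\<^bsub>B\<^esub> ap2 F \<beta> = \<chi>"
    using u unfolding universal_arrow_def by blast+
  have Y: "Y \<in> Ob B" using \<epsilon> by (auto simp: simps)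
  obtain T z0 z1 z where TA: "arrow_tensor A Z T z0 z1 z"
    and TB: "arrow_tensor B (ap0 F Z) (ap0 F T) (ap1 F z0) (ap1 F z1) (ap2 F z)"
    using preserved_arrow_tensor[OF normal_pseudo_functor_axioms pres Z] .
  have T: "T \<in> Ob A" and z: "z0 \<in> hom1 A Z T" "z1 \<in> hom1 A Z T" "z \<in> hom2 A z0 z1"
    using TA by (simp_all add: arrow_tensor_def)
  let ?E = "\<lambda>c. \<epsilon> \<odot>\<^bsub>B\<^esub> ap1 F c" and ?E2 = "\<lambda>\<beta>. id2 B \<epsilon> \<star>\<^bsub>B\<^esub> ap2 F \<beta>" and ?m = "\<lambda>c g. id2 B \<epsilon> \<star>\<^bsub>B\<^esub> cpt F c g"
  have m: "?m y k \<in> hom2 B (?E k \<odot>\<^bsub>B\<^esub> ap1 F y) (?E (k \<odot>\<^bsub>A\<^esub> y))" "B.iso2 (?m y k)"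
    if "k \<in> hom1 A T X" "y \<in> hom1 A Z T" for k y
    using that \<epsilon> by (simp_all add: simps)
  have m_nat: "?m z1 k \<bullet>\<^bsub>B\<^esub> (id2 B (?E k) \<star>\<^bsub>B\<^esub> ap2 F z) = ?E2 (id2 A k \<star>\<^bsub>A\<^esub> z) \<bullet>\<^bsub>B\<^esub> ?m z0 k"
    if k: "k \<in> hom1 A T X" for k
    using transposed_cpt_natural[of \<epsilon> "id2 A k" z z0 z1 k k] k z \<epsilon> by (simp add: simps B.whisker_comp1)
  have full: "\<exists>\<beta>. \<beta> \<in> hom2 A c d \<and> ?E2 \<beta> = \<chi>"
    if c: "c \<in> hom1 A Z X" and d: "d \<in> hom1 A Z X" and \<chi>: "\<chi> \<in> hom2 B (?E c) (?E d)" for c d \<chi>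
  proof -
    have E: "?E c \<in> hom1 B (ap0 F Z) Y" "?E d \<in> hom1 B (ap0 F Z) Y" using c d \<epsilon> by (simp_all add: simps)
    obtain h where h: "h \<in> hom1 B (ap0 F T) Y" "h \<odot>\<^bsub>B\<^esub> ap1 F z0 = ?E c" "h \<odot>\<^bsub>B\<^esub> ap1 F z1 = ?E d"
        and h\<chi>: "id2 B h \<star>\<^bsub>B\<^esub> ap2 F z = \<chi>"
      using TB Y E \<chi> unfolding arrow_tensor_def by blast
    obtain k \<psi> where k: "k \<in> hom1 A T X" and \<psi>: "\<psi> \<in> hom2 B (?E k) h" "B.iso2 \<psi>"
      using lift1[OF T h(1)] by blast
    let ?s = "\<psi> \<star>\<^bsub>B\<^esub> id2 B (ap1 F z0)" and ?t = "\<psi> \<star>\<^bsub>B\<^esub> id2 B (ap1 F z1)"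
    have s: "?s \<in> hom2 B (?E k \<odot>\<^bsub>B\<^esub> ap1 F z0) (?E c)" "B.iso2 ?s"
      and t: "?t \<in> hom2 B (?E k \<odot>\<^bsub>B\<^esub> ap1 F z1) (?E d)" "B.iso2 ?t"
      using \<psi> k z \<epsilon> h(2,3) by (simp_all add: simps)
    note m0 = m[OF k z(1)] and m1 = m[OF k z(2)]
    have kz: "k \<odot>\<^bsub>A\<^esub> z0 \<in> hom1 A Z X" "k \<odot>\<^bsub>A\<^esub> z1 \<in> hom1 A Z X" using k z by (simp_all add: simps)
    obtain \<alpha>0 where \<alpha>0: "\<alpha>0 \<in> hom2 A c (k \<odot>\<^bsub>A\<^esub> z0)" "?E2 \<alpha>0 = ?m z0 k \<bullet>\<^bsub>B\<^esub> B.inv2 ?s"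
      using lift2[OF Z c kz(1), of "?m z0 k \<bullet>\<^bsub>B\<^esub> B.inv2 ?s"] m0 s by (auto simp: hom2_def)
    obtain \<alpha>1 where \<alpha>1: "\<alpha>1 \<in> hom2 A (k \<odot>\<^bsub>A\<^esub> z1) d" "?E2 \<alpha>1 = ?t \<bullet>\<^bsub>B\<^esub> B.inv2 (?m z1 k)"
      using lift2[OF Z kz(2) d, of "?t \<bullet>\<^bsub>B\<^esub> B.inv2 (?m z1 k)"] m1 t by (auto simp: hom2_def)
    let ?\<beta> = "\<alpha>1 \<bullet>\<^bsub>A\<^esub> ((id2 A k \<star>\<^bsub>A\<^esub> z) \<bullet>\<^bsub>A\<^esub> \<alpha>0)"
    have "?\<beta> \<in> hom2 A c d" using \<alpha>0 \<alpha>1 k z by (simp add: simps)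
    moreover have "?E2 ?\<beta> = \<chi>"
    proof -
      let ?n = "id2 B (?E k) \<star>\<^bsub>B\<^esub> ap2 F z"
      have n: "?n \<in> hom2 B (?E k \<odot>\<^bsub>B\<^esub> ap1 F z0) (?E k \<odot>\<^bsub>B\<^esub> ap1 F z1)"
        using k z \<epsilon> by (simp add: simps)
      have "?E2 ?\<beta> = ?E2 \<alpha>1 \<bullet>\<^bsub>B\<^esub> (?E2 (id2 A k \<star>\<^bsub>A\<^esub> z) \<bullet>\<^bsub>B\<^esub> ?E2 \<alpha>0)"
        using \<alpha>0(1) \<alpha>1(1) k z c d \<epsilon> by (simp add: simps B.whisker_left_vcomp)
      also have "\<dots> = ?E2 \<alpha>1 \<bullet>\<^bsub>B\<^esub> ((?E2 (id2 A k \<star>\<^bsub>A\<^esub> z) \<bullet>\<^bsub>B\<^esub> ?m z0 k) \<bullet>\<^bsub>B\<^esub> B.inv2 ?s)"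
        unfolding \<alpha>0(2) using m0 s(1) s(2) k z \<epsilon> by (simp add: simps)
      also have "\<dots> = (?t \<bullet>\<^bsub>B\<^esub> B.inv2 (?m z1 k)) \<bullet>\<^bsub>B\<^esub> ((?m z1 k \<bullet>\<^bsub>B\<^esub> ?n) \<bullet>\<^bsub>B\<^esub> B.inv2 ?s)"
        unfolding \<alpha>1(2) m_nat[OF k] ..
      also have "\<dots> = ?t \<bullet>\<^bsub>B\<^esub> (?n \<bullet>\<^bsub>B\<^esub> B.inv2 ?s)"
        using m1 s t n by (simp add: hom2_def)
      also have "\<dots> = (?t \<bullet>\<^bsub>B\<^esub> ?n) \<bullet>\<^bsub>B\<^esub> B.inv2 ?s"
        using s t n by (simp add: hom2_def)
      also have "?t \<bullet>\<^bsub>B\<^esub> ?n = \<chi> \<bullet>\<^bsub>B\<^esub> ?s"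
        using B.hcomp_whisker[of "ap2 F z" \<psi> "ap1 F z0" "ap1 F z1" "?E k" h] h\<chi> \<psi> k z \<epsilon> by (simp add: simps)
      also have "(\<chi> \<bullet>\<^bsub>B\<^esub> ?s) \<bullet>\<^bsub>B\<^esub> B.inv2 ?s = \<chi>"
        using s \<chi> by (simp add: hom2_def)
      finally show ?thesis .
    qed
    ultimately show ?thesis by blast
  qed
  have faithful: "\<beta> = \<beta>'"
    if c: "c \<in> hom1 A Z X" and d: "d \<in> hom1 A Z X" and \<beta>: "\<beta> \<in> hom2 A c d" "\<beta>' \<in> hom2 A c d"
      and eq: "?E2 \<beta> = ?E2 \<beta>'" for c d \<beta> \<beta>'
  proof -
    obtain k where k: "k \<in> hom1 A T X" and kz: "k \<odot>\<^bsub>A\<^esub> z0 = c" "k \<odot>\<^bsub>A\<^esub> z1 = d" "id2 A k \<star>\<^bsub>A\<^esub> z = \<beta>"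
      using TA X c d \<beta>(1) unfolding arrow_tensor_def by blast
    obtain k' where k': "k' \<in> hom1 A T X" and kz': "k' \<odot>\<^bsub>A\<^esub> z0 = c" "k' \<odot>\<^bsub>A\<^esub> z1 = d" "id2 A k' \<star>\<^bsub>A\<^esub> z = \<beta>'"
      using TA X c d \<beta>(2) unfolding arrow_tensor_def by blast
    note m0 = m[OF k z(1)] and m1 = m[OF k z(2)] and m0' = m[OF k' z(1)] and m1' = m[OF k' z(2)]
    have E: "?E k \<in> hom1 B (ap0 F T) Y" "?E k' \<in> hom1 B (ap0 F T) Y" using k k' \<epsilon> by (simp_all add: simps)
    \<comment> \<open>\<open>k\<close> and \<open>k'\<close> have the same ends, so the compositors identify the ends of their transposes;
      equality of the transposes of \<open>\<beta>\<close> and \<open>\<beta>'\<close> makes these identifications a square.\<close>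
    let ?r = "\<lambda>y. B.inv2 (?m y k') \<bullet>\<^bsub>B\<^esub> ?m y k"
    let ?n = "id2 B (?E k) \<star>\<^bsub>B\<^esub> ap2 F z" and ?n' = "id2 B (?E k') \<star>\<^bsub>B\<^esub> ap2 F z"
    have n: "?n \<in> hom2 B (?E k \<odot>\<^bsub>B\<^esub> ap1 F z0) (?E k \<odot>\<^bsub>B\<^esub> ap1 F z1)"
      and n': "?n' \<in> hom2 B (?E k' \<odot>\<^bsub>B\<^esub> ap1 F z0) (?E k' \<odot>\<^bsub>B\<^esub> ap1 F z1)"
      using k k' z \<epsilon> by (simp_all add: simps)
    have \<rho>0: "?r z0 \<in> hom2 B (?E k \<odot>\<^bsub>B\<^esub> ap1 F z0) (?E k' \<odot>\<^bsub>B\<^esub> ap1 F z0)" "B.iso2 (?r z0)"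
      and \<rho>1: "?r z1 \<in> hom2 B (?E k \<odot>\<^bsub>B\<^esub> ap1 F z1) (?E k' \<odot>\<^bsub>B\<^esub> ap1 F z1)" "B.iso2 (?r z1)"
      using m0 m1 m0' m1' kz kz' by (simp_all add: hom2_def)
    have E\<beta>: "?E2 \<beta> \<in> hom2 B (?E c) (?E d)" using \<beta> c d \<epsilon> by (simp add: simps)
    have "?r z1 \<bullet>\<^bsub>B\<^esub> ?n = B.inv2 (?m z1 k') \<bullet>\<^bsub>B\<^esub> (?m z1 k \<bullet>\<^bsub>B\<^esub> ?n)"
      using m1 m1' n kz kz' by (simp add: hom2_def)
    also have "\<dots> = B.inv2 (?m z1 k') \<bullet>\<^bsub>B\<^esub> (?E2 \<beta>' \<bullet>\<^bsub>B\<^esub> ?m z0 k)"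
      using m_nat[OF k] kz eq by simp
    also have "\<dots> = B.inv2 (?m z1 k') \<bullet>\<^bsub>B\<^esub> ((?E2 \<beta>' \<bullet>\<^bsub>B\<^esub> ?m z0 k') \<bullet>\<^bsub>B\<^esub> ?r z0)"
      using m0 m0' kz kz' E\<beta> eq by (simp add: hom2_def)
    also have "\<dots> = B.inv2 (?m z1 k') \<bullet>\<^bsub>B\<^esub> ((?m z1 k' \<bullet>\<^bsub>B\<^esub> ?n') \<bullet>\<^bsub>B\<^esub> ?r z0)"
      using m_nat[OF k'] kz' by simp
    also have "\<dots> = ?n' \<bullet>\<^bsub>B\<^esub> ?r z0"
      using m1' n' \<rho>0(1) by (simp add: hom2_def)
    finally have square: "?r z1 \<bullet>\<^bsub>B\<^esub> ?n = ?n' \<bullet>\<^bsub>B\<^esub> ?r z0" .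
    obtain \<rho> where \<rho>: "\<rho> \<in> hom2 B (?E k) (?E k')" "B.iso2 \<rho>" and \<rho>z: "\<rho> \<star>\<^bsub>B\<^esub> id2 B (ap1 F z0) = ?r z0"
        "\<rho> \<star>\<^bsub>B\<^esub> id2 B (ap1 F z1) = ?r z1"
      using arrow_tensor_iso[OF B.two_category_axioms TB E \<rho>0 \<rho>1 square] by blast
    obtain \<gamma> where \<gamma>: "\<gamma> \<in> hom2 A k k'" "?E2 \<gamma> = \<rho>" using lift2[OF T k k' \<rho>] by blast
    have ends: "\<gamma> \<star>\<^bsub>A\<^esub> id2 A y = id2 A (k \<odot>\<^bsub>A\<^esub> y)"
      if y: "y \<in> hom1 A Z T" and ky: "k' \<odot>\<^bsub>A\<^esub> y = k \<odot>\<^bsub>A\<^esub> y"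
        and \<rho>y: "\<rho> \<star>\<^bsub>B\<^esub> id2 B (ap1 F y) = ?r y" for y
    proof -
      have kyX: "k \<odot>\<^bsub>A\<^esub> y \<in> hom1 A Z X" using k y by (simp add: simps)
      have \<gamma>y: "\<gamma> \<star>\<^bsub>A\<^esub> id2 A y \<in> hom2 A (k \<odot>\<^bsub>A\<^esub> y) (k \<odot>\<^bsub>A\<^esub> y)"
        using \<gamma>(1) y k k' ky by (simp add: simps)
      then have E\<gamma>y: "?E2 (\<gamma> \<star>\<^bsub>A\<^esub> id2 A y) \<in> hom2 B (?E (k \<odot>\<^bsub>A\<^esub> y)) (?E (k \<odot>\<^bsub>A\<^esub> y))"
        using kyX \<epsilon> by (simp add: simps)
      have "?E2 (\<gamma> \<star>\<^bsub>A\<^esub> id2 A y) \<bullet>\<^bsub>B\<^esub> ?m y k = ?m y k' \<bullet>\<^bsub>B\<^esub> (?E2 \<gamma> \<star>\<^bsub>B\<^esub> id2 B (ap1 F y))"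
        using transposed_cpt_natural[of \<epsilon> \<gamma> "id2 A y" y y k k'] y k k' \<gamma>(1) \<epsilon> by (simp add: simps)
      also have "\<dots> = ?m y k" using \<rho>y \<gamma>(2) m[OF k y] m[OF k' y] ky by (simp add: hom2_def)
      finally have "?E2 (\<gamma> \<star>\<^bsub>A\<^esub> id2 A y) \<bullet>\<^bsub>B\<^esub> ?m y k = id2 B (?E (k \<odot>\<^bsub>A\<^esub> y)) \<bullet>\<^bsub>B\<^esub> ?m y k"
        using m[OF k y] by (simp add: hom2_def)
      then have "?E2 (\<gamma> \<star>\<^bsub>A\<^esub> id2 A y) = id2 B (?E (k \<odot>\<^bsub>A\<^esub> y))"
        using B.iso2_right_cancel[OF m(2)[OF k y]] m[OF k y] E\<gamma>y kyX \<epsilon> by (simp add: simps)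
      moreover have "?E2 (id2 A (k \<odot>\<^bsub>A\<^esub> y)) = id2 B (?E (k \<odot>\<^bsub>A\<^esub> y))" using kyX \<epsilon> by (simp add: simps)
      moreover have "id2 A (k \<odot>\<^bsub>A\<^esub> y) \<in> hom2 A (k \<odot>\<^bsub>A\<^esub> y) (k \<odot>\<^bsub>A\<^esub> y)" using kyX by (simp add: simps)
      moreover have "\<exists>!\<beta>. \<beta> \<in> hom2 A (k \<odot>\<^bsub>A\<^esub> y) (k \<odot>\<^bsub>A\<^esub> y) \<and> ?E2 \<beta> = id2 B (?E (k \<odot>\<^bsub>A\<^esub> y))"
        by (rule lift2[OF Z kyX kyX]) (use kyX \<epsilon> in \<open>simp_all add: simps\<close>)
      ultimately show ?thesis using \<gamma>y by blast
    qed
    have "(\<gamma> \<star>\<^bsub>A\<^esub> id2 A z1) \<bullet>\<^bsub>A\<^esub> (id2 A k \<star>\<^bsub>A\<^esub> z) = (id2 A k' \<star>\<^bsub>A\<^esub> z) \<bullet>\<^bsub>A\<^esub> (\<gamma> \<star>\<^bsub>A\<^esub> id2 A z0)"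
      using A.hcomp_whisker[of z \<gamma> z0 z1 k k'] z \<gamma>(1) k k' by (simp add: simps)
    then show "\<beta> = \<beta>'"
      using ends[OF z(1)] ends[OF z(2)] kz kz' \<rho>z \<beta> by (simp add: hom2_def)
  qed
  show ?thesis
    unfolding fully_faithful_def
  proof (intro ballI ex_ex1I)
    fix c d \<chi>
    assume cd: "c \<in> Obj (hom_cat A Z X)" "d \<in> Obj (hom_cat A Z X)"
      and \<chi>: "\<chi> \<in> arrows (hom_cat B (ap0 F Z) Y) (fob (transposition B F \<epsilon>) c) (fob (transposition B F \<epsilon>) d)"
    have "\<chi> \<in> hom2 B (?E c) (?E d)" using \<chi> by (simp add: transposition_def B.arrows_hom_cat split: if_splits)
    then show "\<exists>\<beta>. \<beta> \<in> arrows (hom_cat A Z X) c d \<and> far (transposition B F \<epsilon>) \<beta> = \<chi>"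
      using full cd by (simp add: transposition_def A.arrows_hom_cat)
    show "\<beta> = \<beta>'" if "\<beta> \<in> arrows (hom_cat A Z X) c d \<and> far (transposition B F \<epsilon>) \<beta> = \<chi>"
        "\<beta>' \<in> arrows (hom_cat A Z X) c d \<and> far (transposition B F \<epsilon>) \<beta>' = \<chi>" for \<beta> \<beta>'
      using faithful[of c d \<beta> \<beta>'] that cd by (simp add: transposition_def A.arrows_hom_cat)
  qed
qed

lemma essentially_surjective_transposition:
  assumes u: "universal_arrow Y X \<epsilon>" and Z: "Z \<in> Ob A"
  shows "essentially_surjective (hom_cat A Z X) (hom_cat B (ap0 F Z) Y) (transposition B F \<epsilon>)"
  unfolding essentially_surjective_def
proof
  fix f assume "f \<in> Obj (hom_cat B (ap0 F Z) Y)"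
  then have "f \<in> hom1 B (ap0 F Z) Y" by simp
  then obtain c \<psi> where c: "c \<in> hom1 A Z X" and \<psi>: "\<psi> \<in> hom2 B (\<epsilon> \<odot>\<^bsub>B\<^esub> ap1 F c) f" "B.iso2 \<psi>"
    using u Z unfolding universal_arrow_def by blast
  moreover have "\<epsilon> \<in> hom1 B (ap0 F X) Y" using u by (simp add: universal_arrow_def)
  then have "\<epsilon> \<odot>\<^bsub>B\<^esub> ap1 F c \<in> hom1 B (ap0 F Z) Y" using c by (simp add: hom1_def)
  ultimately show "\<exists>c \<in> Obj (hom_cat A Z X). \<exists>\<psi> \<in> arrows (hom_cat B (ap0 F Z) Y) (fob (transposition B F \<epsilon>) c) f.
      is_iso (hom_cat B (ap0 F Z) Y) \<psi>"
    using B.is_iso_hom_cat[of \<psi> "ap0 F Z" Y]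
    by (intro bexI[of _ c] bexI[of _ \<psi>]) (simp_all add: transposition_def B.arrows_hom_cat hom2_def)
qed

end


section \<open>The right bi-adjoint built from universal arrows\<close>

text \<open>
  The data from which \<open>R\<close> is built: universal arrows \<open>e Y\<close>, and for every 1-cell \<open>d\<close> of \<open>D\<close> a lift
  \<open>R1 d\<close> of \<open>d (e Y)\<close> with its isomorphism \<open>\<sigma> d\<close>.  The lifts of identities are required to be
  identities in order that \<open>R\<close> becomes normal.
\<close>

locale universal_family = L: normal_pseudo_functor C D L
  for C :: "('o, 'm, 'c) twocat" and D :: "('p, 'n, 'd) twocat" and L :: "('o, 'm, 'c, 'p, 'n, 'd) psfun" +
  fixes R0 :: "'p \<Rightarrow> 'o" and e :: "'p \<Rightarrow> 'n" and R1 :: "'n \<Rightarrow> 'm" and \<sigma> :: "'n \<Rightarrow> 'd"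
  assumes R0_in: "Y \<in> Ob D \<Longrightarrow> R0 Y \<in> Ob C"
    and e_in: "Y \<in> Ob D \<Longrightarrow> e Y \<in> hom1 D (ap0 L (R0 Y)) Y"
    and transposition_ff: "\<lbrakk>Y \<in> Ob D; Z \<in> Ob C\<rbrakk> \<Longrightarrow>
      fully_faithful (hom_cat C Z (R0 Y)) (hom_cat D (ap0 L Z) Y) (transposition D L (e Y))"
    and transposition_es: "\<lbrakk>Y \<in> Ob D; Z \<in> Ob C\<rbrakk> \<Longrightarrow>
      essentially_surjective (hom_cat C Z (R0 Y)) (hom_cat D (ap0 L Z) Y) (transposition D L (e Y))"
    and R1_in: "d \<in> hom1 D Y Y' \<Longrightarrow> R1 d \<in> hom1 C (R0 Y) (R0 Y')"
    and \<sigma>_in: "d \<in> hom1 D Y Y' \<Longrightarrow> \<sigma> d \<in> hom2 D (d \<odot>\<^bsub>D\<^esub> e Y) (e Y' \<odot>\<^bsub>D\<^esub> ap1 L (R1 d))"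
    and \<sigma>_iso: "d \<in> Mor D \<Longrightarrow> is_iso (cat2 D) (\<sigma> d)"
    and R1_id1: "Y \<in> Ob D \<Longrightarrow> R1 (id1 D Y) = id1 C (R0 Y)"
    and \<sigma>_id1: "Y \<in> Ob D \<Longrightarrow> \<sigma> (id1 D Y) = id2 D (e Y)"
begin

declare R0_in [simp] R1_id1 [simp] \<sigma>_id1 [simp] \<sigma>_iso [simp]

lemma e_type [simp]:
  assumes "Y \<in> Ob D"
  shows "e Y \<in> Mor D" "src D (e Y) = ap0 L (R0 Y)" "tgt D (e Y) = Y"
  using e_in[OF assms] by (simp_all add: hom1_def)

lemma R1_type [simp]:
  assumes "d \<in> Mor D"
  shows "R1 d \<in> Mor C" "src C (R1 d) = R0 (src D d)" "tgt C (R1 d) = R0 (tgt D d)"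
  using R1_in[of d "src D d" "tgt D d"] assms by (simp_all add: hom1_def)

lemma \<sigma>_type [simp]:
  assumes "d \<in> Mor D"
  shows "\<sigma> d \<in> Cell D" "dom2 D (\<sigma> d) = d \<odot>\<^bsub>D\<^esub> e (src D d)" "cod2 D (\<sigma> d) = e (tgt D d) \<odot>\<^bsub>D\<^esub> ap1 L (R1 d)"
  using \<sigma>_in[of d "src D d" "tgt D d"] assms by (simp_all add: hom1_def hom2_def)

text \<open>
  \<open>E1\<close> and \<open>E2\<close> are transposition on 1-cells and 2-cells.  The 2-cell \<open>mu Y c g : E1 Y g (L c) \<Rightarrow> E1 Y (g c)\<close>
  expresses that transposition respects precomposition up to a compositor of \<open>L\<close>.
\<close>

abbreviation E1 :: "'p \<Rightarrow> 'm \<Rightarrow> 'n" where "E1 Y g \<equiv> e Y \<odot>\<^bsub>D\<^esub> ap1 L g"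
abbreviation E2 :: "'p \<Rightarrow> 'c \<Rightarrow> 'd" where "E2 Y \<beta> \<equiv> id2 D (e Y) \<star>\<^bsub>D\<^esub> ap2 L \<beta>"
abbreviation mu :: "'p \<Rightarrow> 'm \<Rightarrow> 'm \<Rightarrow> 'd" where "mu Y c g \<equiv> id2 D (e Y) \<star>\<^bsub>D\<^esub> cpt L c g"

lemma unique_lift:
  assumes "Y \<in> Ob D" "g \<in> Mor C" "g' \<in> Mor C" "src C g' = src C g" "tgt C g = R0 Y" "tgt C g' = R0 Y"
    and "\<chi> \<in> Cell D" "dom2 D \<chi> = E1 Y g" "cod2 D \<chi> = E1 Y g'"
  shows "\<exists>!\<beta>. \<beta> \<in> Cell C \<and> dom2 C \<beta> = g \<and> cod2 C \<beta> = g' \<and> E2 Y \<beta> = \<chi>"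
  using transposition_ff[of Y "src C g"] assms unfolding fully_faithful_def
  by (auto simp: transposition_def L.A.arrows_hom_cat L.B.arrows_hom_cat hom1_def hom2_def)

definition lift :: "'p \<Rightarrow> 'm \<Rightarrow> 'm \<Rightarrow> 'd \<Rightarrow> 'c" where
  "lift Y g g' \<chi> = (THE \<beta>. \<beta> \<in> Cell C \<and> dom2 C \<beta> = g \<and> cod2 C \<beta> = g' \<and> E2 Y \<beta> = \<chi>)"

lemma lift:
  assumes "Y \<in> Ob D" "g \<in> Mor C" "g' \<in> Mor C" "src C g' = src C g" "tgt C g = R0 Y" "tgt C g' = R0 Y"
    and "\<chi> \<in> Cell D" "dom2 D \<chi> = E1 Y g" "cod2 D \<chi> = E1 Y g'"
  shows "lift Y g g' \<chi> \<in> Cell C" "dom2 C (lift Y g g' \<chi>) = g" "cod2 C (lift Y g g' \<chi>) = g'"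
    "E2 Y (lift Y g g' \<chi>) = \<chi>"
  using theI'[OF unique_lift[OF assms]] unfolding lift_def by blast+

lemma lift_eq:
  assumes "Y \<in> Ob D" "\<beta> \<in> Cell C" "\<beta>' \<in> Cell C" "tgt C (dom2 C \<beta>) = R0 Y" "dom2 C \<beta>' = dom2 C \<beta>"
    "cod2 C \<beta>' = cod2 C \<beta>" "E2 Y \<beta> = E2 Y \<beta>'"
  shows "\<beta> = \<beta>'"
proof -
  have "\<exists>!\<gamma>. \<gamma> \<in> Cell C \<and> dom2 C \<gamma> = dom2 C \<beta> \<and> cod2 C \<gamma> = cod2 C \<beta> \<and> E2 Y \<gamma> = E2 Y \<beta>"
    by (rule unique_lift) (use assms in simp_all)
  then show ?thesis using assms by metis
qed

text \<open>
  All coherence laws of \<open>R\<close> are proved by this rule: the isomorphism \<open>p\<close> is chosen such that the defining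
  equations of \<open>R2\<close> and of the compositors apply.
\<close>

lemma lift_eqI:
  assumes Y: "Y \<in> Ob D" and \<beta>: "\<beta> \<in> Cell C" "\<beta>' \<in> Cell C" "tgt C (dom2 C \<beta>) = R0 Y" "dom2 C \<beta>' = dom2 C \<beta>"
      "cod2 C \<beta>' = cod2 C \<beta>"
    and p: "L.B.iso2 p" "cod2 D p = E1 Y (dom2 C \<beta>)" and eq: "E2 Y \<beta> \<bullet>\<^bsub>D\<^esub> p = E2 Y \<beta>' \<bullet>\<^bsub>D\<^esub> p"
  shows "\<beta> = \<beta>'"
  by (rule lift_eq[OF Y \<beta>], rule L.B.iso2_right_cancel[OF p(1) _ _ _ _ eq])
    (use Y \<beta> p in simp_all)

lemma iso2_if_transpose:
  assumes Y: "Y \<in> Ob D" and \<beta>: "\<beta> \<in> Cell C" "tgt C (dom2 C \<beta>) = R0 Y" and iso: "L.B.iso2 (E2 Y \<beta>)"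
  shows "L.A.iso2 \<beta>"
proof -
  define \<gamma> where "\<gamma> = lift Y (cod2 C \<beta>) (dom2 C \<beta>) (L.B.inv2 (E2 Y \<beta>))"
  have \<gamma>: "\<gamma> \<in> Cell C" "dom2 C \<gamma> = cod2 C \<beta>" "cod2 C \<gamma> = dom2 C \<beta>" "E2 Y \<gamma> = L.B.inv2 (E2 Y \<beta>)"
    using lift[of Y "cod2 C \<beta>" "dom2 C \<beta>" "L.B.inv2 (E2 Y \<beta>)"] Y \<beta> iso by (simp_all add: \<gamma>_def)
  have "E2 Y (\<gamma> \<bullet>\<^bsub>C\<^esub> \<beta>) = E2 Y \<gamma> \<bullet>\<^bsub>D\<^esub> E2 Y \<beta>" "E2 Y (\<beta> \<bullet>\<^bsub>C\<^esub> \<gamma>) = E2 Y \<beta> \<bullet>\<^bsub>D\<^esub> E2 Y \<gamma>"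
    using Y \<beta> \<gamma>(1-3) by (simp_all add: L.B.whisker_left_vcomp)
  then have "E2 Y (\<gamma> \<bullet>\<^bsub>C\<^esub> \<beta>) = E2 Y (id2 C (dom2 C \<beta>))" "E2 Y (\<beta> \<bullet>\<^bsub>C\<^esub> \<gamma>) = E2 Y (id2 C (cod2 C \<beta>))"
    using Y \<beta> iso unfolding \<gamma>(4) by simp_all
  then have "\<gamma> \<bullet>\<^bsub>C\<^esub> \<beta> = id2 C (dom2 C \<beta>)" "\<beta> \<bullet>\<^bsub>C\<^esub> \<gamma> = id2 C (cod2 C \<beta>)"
    using Y \<beta> \<gamma>(1-3) by (auto intro!: lift_eq[OF Y])
  then show ?thesis using L.A.iso2I[OF \<beta>(1) \<gamma>(1)] \<gamma> by simp
qed

text \<open>\<open>R2 \<delta>\<close> is the lift of \<open>\<delta> (e Y)\<close> conjugated with \<open>\<sigma>\<close>, which is what makes \<open>\<sigma>\<close> natural.\<close>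

definition R2 :: "'d \<Rightarrow> 'c" where
  "R2 \<delta> = lift (tgt D (dom2 D \<delta>)) (R1 (dom2 D \<delta>)) (R1 (cod2 D \<delta>))
    (\<sigma> (cod2 D \<delta>) \<bullet>\<^bsub>D\<^esub> ((\<delta> \<star>\<^bsub>D\<^esub> id2 D (e (src D (dom2 D \<delta>)))) \<bullet>\<^bsub>D\<^esub> L.B.inv2 (\<sigma> (dom2 D \<delta>))))"

lemma R2:
  assumes "\<delta> \<in> Cell D"
  shows R2_type [simp]: "R2 \<delta> \<in> Cell C" "dom2 C (R2 \<delta>) = R1 (dom2 D \<delta>)" "cod2 C (R2 \<delta>) = R1 (cod2 D \<delta>)"
    and R2_transpose: "E2 (tgt D (dom2 D \<delta>)) (R2 \<delta>) \<bullet>\<^bsub>D\<^esub> \<sigma> (dom2 D \<delta>)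
      = \<sigma> (cod2 D \<delta>) \<bullet>\<^bsub>D\<^esub> (\<delta> \<star>\<^bsub>D\<^esub> id2 D (e (src D (dom2 D \<delta>))))"
proof -
  let ?\<chi> = "\<sigma> (cod2 D \<delta>) \<bullet>\<^bsub>D\<^esub> ((\<delta> \<star>\<^bsub>D\<^esub> id2 D (e (src D (dom2 D \<delta>)))) \<bullet>\<^bsub>D\<^esub> L.B.inv2 (\<sigma> (dom2 D \<delta>)))"
  note l = lift[of "tgt D (dom2 D \<delta>)" "R1 (dom2 D \<delta>)" "R1 (cod2 D \<delta>)" ?\<chi>]
  show "R2 \<delta> \<in> Cell C" "dom2 C (R2 \<delta>) = R1 (dom2 D \<delta>)" "cod2 C (R2 \<delta>) = R1 (cod2 D \<delta>)"
    using l assms unfolding R2_def by simp_all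
  have "E2 (tgt D (dom2 D \<delta>)) (R2 \<delta>) = ?\<chi>" unfolding R2_def by (rule l(4)) (use assms in simp_all)
  then show "E2 (tgt D (dom2 D \<delta>)) (R2 \<delta>) \<bullet>\<^bsub>D\<^esub> \<sigma> (dom2 D \<delta>)
      = \<sigma> (cod2 D \<delta>) \<bullet>\<^bsub>D\<^esub> (\<delta> \<star>\<^bsub>D\<^esub> id2 D (e (src D (dom2 D \<delta>))))"
    using assms by simp
qed

text \<open>
  \<open>S d g : d (e (L g)) \<Rightarrow> e (L (R1 d g))\<close> extends \<open>\<sigma> d\<close> from the identity of \<open>R0 (src d)\<close> to all \<open>g\<close>
  into this object.  Its naturality (\<open>S_natural\<close>), its compatibility with the right action of \<open>C\<close>
  (\<open>S_precomp\<close>) and later with composition in \<open>D\<close> (\<open>S_comp\<close>) are all that the coherence laws of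
  \<open>R\<close> and \<open>\<Phi>\<close> rest on.
\<close>

definition S :: "'n \<Rightarrow> 'm \<Rightarrow> 'd" where
  "S d g = mu (tgt D d) g (R1 d) \<bullet>\<^bsub>D\<^esub> (\<sigma> d \<star>\<^bsub>D\<^esub> id2 D (ap1 L g))"

lemma S_type [simp]:
  assumes "d \<in> Mor D" "g \<in> Mor C" "tgt C g = R0 (src D d)"
  shows "S d g \<in> Cell D" "dom2 D (S d g) = d \<odot>\<^bsub>D\<^esub> (e (src D d) \<odot>\<^bsub>D\<^esub> ap1 L g)"
    "cod2 D (S d g) = e (tgt D d) \<odot>\<^bsub>D\<^esub> ap1 L (R1 d \<odot>\<^bsub>C\<^esub> g)" "L.B.iso2 (S d g)"
  using assms by (simp_all add: S_def)

lemma S_id [simp]: "d \<in> Mor D \<Longrightarrow> X = R0 (src D d) \<Longrightarrow> S d (id1 C X) = \<sigma> d"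
  by (simp add: S_def)

lemma S_id1 [simp]: "\<lbrakk>Y \<in> Ob D; g \<in> Mor C; tgt C g = R0 Y\<rbrakk> \<Longrightarrow> S (id1 D Y) g = id2 D (e Y \<odot>\<^bsub>D\<^esub> ap1 L g)"
  by (simp add: S_def)

lemma S_natural:
  assumes \<delta>: "\<delta> \<in> Cell D" "dom2 D \<delta> = d" "cod2 D \<delta> = d'"
    and \<gamma>: "\<gamma> \<in> Cell C" "dom2 C \<gamma> = g" "cod2 C \<gamma> = g'" "tgt C g = R0 (src D d)"
    and Y: "src D d = Y" "tgt D d = Y'"
  shows "S d' g' \<bullet>\<^bsub>D\<^esub> (\<delta> \<star>\<^bsub>D\<^esub> E2 Y \<gamma>) = E2 Y' (R2 \<delta> \<star>\<^bsub>C\<^esub> \<gamma>) \<bullet>\<^bsub>D\<^esub> S d g"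
proof -
  have t: "d \<in> Mor D" "d' \<in> Mor D" "src D d = Y" "src D d' = Y" "tgt D d = Y'" "tgt D d' = Y'" "Y \<in> Ob D" "Y' \<in> Ob D"
      "g \<in> Mor C" "g' \<in> Mor C" "src C g' = src C g" "tgt C g' = R0 Y" "tgt C g = R0 Y"
    using assms L.B.dom2_Mor[of \<delta>] L.B.cod2_Mor[of \<delta>] L.B.src_cod2[of \<delta>] L.B.tgt_cod2[of \<delta>]
      L.A.dom2_Mor[of \<gamma>] L.A.cod2_Mor[of \<gamma>] L.A.src_cod2[of \<gamma>] L.A.tgt_cod2[of \<gamma>]
      L.B.src_Ob[of d] L.B.tgt_Ob[of d] by metis+
  note tys = t \<delta>(1-3) \<gamma>(1-3)
  have "E2 Y' (R2 \<delta> \<star>\<^bsub>C\<^esub> \<gamma>) \<bullet>\<^bsub>D\<^esub> S d g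
      = (E2 Y' (R2 \<delta> \<star>\<^bsub>C\<^esub> \<gamma>) \<bullet>\<^bsub>D\<^esub> mu Y' g (R1 d)) \<bullet>\<^bsub>D\<^esub> (\<sigma> d \<star>\<^bsub>D\<^esub> id2 D (ap1 L g))"
    unfolding S_def using tys by simp
  also have "E2 Y' (R2 \<delta> \<star>\<^bsub>C\<^esub> \<gamma>) \<bullet>\<^bsub>D\<^esub> mu Y' g (R1 d)
      = mu Y' g' (R1 d') \<bullet>\<^bsub>D\<^esub> (E2 Y' (R2 \<delta>) \<star>\<^bsub>D\<^esub> ap2 L \<gamma>)"
    using L.transposed_cpt_natural[of "e Y'" "R2 \<delta>" \<gamma> g g' "R1 d" "R1 d'"] tys by simp
  also have "(mu Y' g' (R1 d') \<bullet>\<^bsub>D\<^esub> (E2 Y' (R2 \<delta>) \<star>\<^bsub>D\<^esub> ap2 L \<gamma>)) \<bullet>\<^bsub>D\<^esub> (\<sigma> d \<star>\<^bsub>D\<^esub> id2 D (ap1 L g))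
      = mu Y' g' (R1 d') \<bullet>\<^bsub>D\<^esub> ((E2 Y' (R2 \<delta>) \<star>\<^bsub>D\<^esub> ap2 L \<gamma>) \<bullet>\<^bsub>D\<^esub> (\<sigma> d \<star>\<^bsub>D\<^esub> id2 D (ap1 L g)))"
    using tys by simp
  also have "(E2 Y' (R2 \<delta>) \<star>\<^bsub>D\<^esub> ap2 L \<gamma>) \<bullet>\<^bsub>D\<^esub> (\<sigma> d \<star>\<^bsub>D\<^esub> id2 D (ap1 L g)) = (E2 Y' (R2 \<delta>) \<bullet>\<^bsub>D\<^esub> \<sigma> d) \<star>\<^bsub>D\<^esub> ap2 L \<gamma>"
    using tys by (simp add: L.B.interchange' del: L.B.hcomp_assoc')
  also have "E2 Y' (R2 \<delta>) \<bullet>\<^bsub>D\<^esub> \<sigma> d = \<sigma> d' \<bullet>\<^bsub>D\<^esub> (\<delta> \<star>\<^bsub>D\<^esub> id2 D (e Y))"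
    using R2_transpose[of \<delta>] tys by simp
  also have "(\<sigma> d' \<bullet>\<^bsub>D\<^esub> (\<delta> \<star>\<^bsub>D\<^esub> id2 D (e Y))) \<star>\<^bsub>D\<^esub> ap2 L \<gamma>
      = (\<sigma> d' \<star>\<^bsub>D\<^esub> id2 D (ap1 L g')) \<bullet>\<^bsub>D\<^esub> ((\<delta> \<star>\<^bsub>D\<^esub> id2 D (e Y)) \<star>\<^bsub>D\<^esub> ap2 L \<gamma>)"
    using tys by (simp add: L.B.interchange' del: L.B.hcomp_assoc')
  also have "mu Y' g' (R1 d') \<bullet>\<^bsub>D\<^esub> \<dots> = S d' g' \<bullet>\<^bsub>D\<^esub> (\<delta> \<star>\<^bsub>D\<^esub> E2 Y \<gamma>)"
    unfolding S_def using tys by simp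
  finally show ?thesis by simp
qed

lemma mu_assoc:
  assumes "Y \<in> Ob D" "c \<in> Mor C" "g \<in> Mor C" "h \<in> Mor C" "tgt C c = src C g" "tgt C g = src C h" "tgt C h = R0 Y"
  shows "mu Y c (h \<odot>\<^bsub>C\<^esub> g) \<bullet>\<^bsub>D\<^esub> (mu Y g h \<star>\<^bsub>D\<^esub> id2 D (ap1 L c))
    = mu Y (g \<odot>\<^bsub>C\<^esub> c) h \<bullet>\<^bsub>D\<^esub> (id2 D (E1 Y h) \<star>\<^bsub>D\<^esub> cpt L c g)"
  using assms L.cpt_assoc'[of c g h]
  by (simp add: L.B.whisker_comp1 L.B.whisker_left_vcomp[symmetric])

lemma S_precomp:
  assumes "d \<in> Mor D" "src D d = Y" "tgt D d = Y'" "g \<in> Mor C" "tgt C g = R0 Y" "c \<in> Mor C" "tgt C c = src C g"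
  shows "S d (g \<odot>\<^bsub>C\<^esub> c) \<bullet>\<^bsub>D\<^esub> (id2 D d \<star>\<^bsub>D\<^esub> mu Y c g) = mu Y' c (R1 d \<odot>\<^bsub>C\<^esub> g) \<bullet>\<^bsub>D\<^esub> (S d g \<star>\<^bsub>D\<^esub> id2 D (ap1 L c))"
proof -
  have t: "Y \<in> Ob D" "Y' \<in> Ob D" using assms by auto
  note tys = t assms
  have "S d (g \<odot>\<^bsub>C\<^esub> c) \<bullet>\<^bsub>D\<^esub> (id2 D d \<star>\<^bsub>D\<^esub> mu Y c g)
      = mu Y' (g \<odot>\<^bsub>C\<^esub> c) (R1 d) \<bullet>\<^bsub>D\<^esub>
        ((\<sigma> d \<star>\<^bsub>D\<^esub> id2 D (ap1 L (g \<odot>\<^bsub>C\<^esub> c))) \<bullet>\<^bsub>D\<^esub> (id2 D (d \<odot>\<^bsub>D\<^esub> e Y) \<star>\<^bsub>D\<^esub> cpt L c g))"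
    unfolding S_def using tys by (simp add: L.B.whisker_comp1)
  also have "(\<sigma> d \<star>\<^bsub>D\<^esub> id2 D (ap1 L (g \<odot>\<^bsub>C\<^esub> c))) \<bullet>\<^bsub>D\<^esub> (id2 D (d \<odot>\<^bsub>D\<^esub> e Y) \<star>\<^bsub>D\<^esub> cpt L c g)
      = (id2 D (E1 Y' (R1 d)) \<star>\<^bsub>D\<^esub> cpt L c g) \<bullet>\<^bsub>D\<^esub> (\<sigma> d \<star>\<^bsub>D\<^esub> id2 D (ap1 L g \<odot>\<^bsub>D\<^esub> ap1 L c))"
    using tys by (simp add: L.B.interchange')
  also have "mu Y' (g \<odot>\<^bsub>C\<^esub> c) (R1 d) \<bullet>\<^bsub>D\<^esub> \<dots>
      = (mu Y' (g \<odot>\<^bsub>C\<^esub> c) (R1 d) \<bullet>\<^bsub>D\<^esub> (id2 D (E1 Y' (R1 d)) \<star>\<^bsub>D\<^esub> cpt L c g)) \<bullet>\<^bsub>D\<^esub> (\<sigma> d \<star>\<^bsub>D\<^esub> id2 D (ap1 L g \<odot>\<^bsub>D\<^esub> ap1 L c))"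
    using tys by simp
  also have "mu Y' (g \<odot>\<^bsub>C\<^esub> c) (R1 d) \<bullet>\<^bsub>D\<^esub> (id2 D (E1 Y' (R1 d)) \<star>\<^bsub>D\<^esub> cpt L c g)
      = mu Y' c (R1 d \<odot>\<^bsub>C\<^esub> g) \<bullet>\<^bsub>D\<^esub> (mu Y' g (R1 d) \<star>\<^bsub>D\<^esub> id2 D (ap1 L c))"
    using mu_assoc[of Y' c g "R1 d"] tys by simp
  also have "\<dots> \<bullet>\<^bsub>D\<^esub> (\<sigma> d \<star>\<^bsub>D\<^esub> id2 D (ap1 L g \<odot>\<^bsub>D\<^esub> ap1 L c))
      = mu Y' c (R1 d \<odot>\<^bsub>C\<^esub> g) \<bullet>\<^bsub>D\<^esub> (S d g \<star>\<^bsub>D\<^esub> id2 D (ap1 L c))"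
    unfolding S_def using tys by (simp add: L.B.whisker_right_vcomp)
  finally show ?thesis .
qed

text \<open>
  The compositor \<open>phi d d' : (R1 d') (R1 d) \<Rightarrow> R1 (d' d)\<close> compares two lifts of \<open>d' d (e Y)\<close>, the one
  obtained in two steps and the chosen one; \<open>phi_transpose\<close> is its defining property.
\<close>

definition phi :: "'n \<Rightarrow> 'n \<Rightarrow> 'c" where
  "phi d d' = lift (tgt D d') (R1 d' \<odot>\<^bsub>C\<^esub> R1 d) (R1 (d' \<odot>\<^bsub>D\<^esub> d))
    (\<sigma> (d' \<odot>\<^bsub>D\<^esub> d) \<bullet>\<^bsub>D\<^esub> L.B.inv2 (S d' (R1 d) \<bullet>\<^bsub>D\<^esub> (id2 D d' \<star>\<^bsub>D\<^esub> \<sigma> d)))"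

lemma phi:
  assumes "d \<in> Mor D" "d' \<in> Mor D" "tgt D d = src D d'"
  shows phi_type [simp]: "phi d d' \<in> Cell C" "dom2 C (phi d d') = R1 d' \<odot>\<^bsub>C\<^esub> R1 d"
      "cod2 C (phi d d') = R1 (d' \<odot>\<^bsub>D\<^esub> d)" "L.A.iso2 (phi d d')"
    and phi_transpose: "E2 (tgt D d') (phi d d') \<bullet>\<^bsub>D\<^esub> (S d' (R1 d) \<bullet>\<^bsub>D\<^esub> (id2 D d' \<star>\<^bsub>D\<^esub> \<sigma> d)) = \<sigma> (d' \<odot>\<^bsub>D\<^esub> d)"
proof -
  let ?p = "S d' (R1 d) \<bullet>\<^bsub>D\<^esub> (id2 D d' \<star>\<^bsub>D\<^esub> \<sigma> d)"
  let ?\<chi> = "\<sigma> (d' \<odot>\<^bsub>D\<^esub> d) \<bullet>\<^bsub>D\<^esub> L.B.inv2 ?p"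
  have p: "L.B.iso2 ?p" "?p \<in> Cell D" "dom2 D ?p = d' \<odot>\<^bsub>D\<^esub> (d \<odot>\<^bsub>D\<^esub> e (src D d))"
      "cod2 D ?p = E1 (tgt D d') (R1 d' \<odot>\<^bsub>C\<^esub> R1 d)"
    using assms by simp_all
  have \<chi>: "?\<chi> \<in> Cell D" "dom2 D ?\<chi> = E1 (tgt D d') (R1 d' \<odot>\<^bsub>C\<^esub> R1 d)" "cod2 D ?\<chi> = E1 (tgt D d') (R1 (d' \<odot>\<^bsub>D\<^esub> d))" "L.B.iso2 ?\<chi>"
    using p assms by (simp_all del: L.B.iso2_vcomp add: L.B.iso2_vcomp[of "L.B.inv2 ?p"])
  note l = lift[of "tgt D d'" "R1 d' \<odot>\<^bsub>C\<^esub> R1 d" "R1 (d' \<odot>\<^bsub>D\<^esub> d)" ?\<chi>, OF _ _ _ _ _ _ \<chi>(1-3)]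
  show ty: "phi d d' \<in> Cell C" "dom2 C (phi d d') = R1 d' \<odot>\<^bsub>C\<^esub> R1 d" "cod2 C (phi d d') = R1 (d' \<odot>\<^bsub>D\<^esub> d)"
    unfolding phi_def by (rule l; use assms in simp)+
  have E: "E2 (tgt D d') (phi d d') = ?\<chi>"
    unfolding phi_def by (rule l) (use assms in simp_all)
  show "L.A.iso2 (phi d d')"
    by (rule iso2_if_transpose[of "tgt D d'"]) (use assms ty E \<chi>(4) in simp_all)
  have "E2 (tgt D d') (phi d d') \<bullet>\<^bsub>D\<^esub> ?p = \<sigma> (d' \<odot>\<^bsub>D\<^esub> d) \<bullet>\<^bsub>D\<^esub> (L.B.inv2 ?p \<bullet>\<^bsub>D\<^esub> ?p)"
    unfolding E by (rule L.B.vcomp_assoc) (use p assms in simp_all)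
  also have "\<dots> = \<sigma> (d' \<odot>\<^bsub>D\<^esub> d)" unfolding L.B.inv2_vcomp(1)[OF p(1)] p(3) using assms by simp
  finally show "E2 (tgt D d') (phi d d') \<bullet>\<^bsub>D\<^esub> ?p = \<sigma> (d' \<odot>\<^bsub>D\<^esub> d)" .
qed

text \<open>The defining property of \<open>phi\<close> extends from the identity of \<open>R0 (src d)\<close> to all \<open>g\<close> into this object.\<close>

lemma S_comp:
  assumes "d \<in> Mor D" "d' \<in> Mor D" "tgt D d = src D d'" "g \<in> Mor C" "tgt C g = R0 (src D d)" "tgt D d' = Y''"
  shows "E2 Y'' (phi d d' \<star>\<^bsub>C\<^esub> id2 C g) \<bullet>\<^bsub>D\<^esub> (S d' (R1 d \<odot>\<^bsub>C\<^esub> g) \<bullet>\<^bsub>D\<^esub> (id2 D d' \<star>\<^bsub>D\<^esub> S d g)) = S (d' \<odot>\<^bsub>D\<^esub> d) g"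
proof -
  have t: "Y'' \<in> Ob D" "src D d \<in> Ob D" "src D d' \<in> Ob D" using assms by auto
  note tys = t assms
  let ?g = "id2 D (ap1 L g)"
  let ?n = "(S d' (R1 d) \<bullet>\<^bsub>D\<^esub> (id2 D d' \<star>\<^bsub>D\<^esub> \<sigma> d)) \<star>\<^bsub>D\<^esub> ?g"
  have "S d' (R1 d \<odot>\<^bsub>C\<^esub> g) \<bullet>\<^bsub>D\<^esub> (id2 D d' \<star>\<^bsub>D\<^esub> S d g)
      = (S d' (R1 d \<odot>\<^bsub>C\<^esub> g) \<bullet>\<^bsub>D\<^esub> (id2 D d' \<star>\<^bsub>D\<^esub> mu (src D d') g (R1 d))) \<bullet>\<^bsub>D\<^esub> ((id2 D d' \<star>\<^bsub>D\<^esub> \<sigma> d) \<star>\<^bsub>D\<^esub> ?g)"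
    unfolding S_def[of d] using tys by (simp add: L.B.whisker_left_vcomp)
  also have "S d' (R1 d \<odot>\<^bsub>C\<^esub> g) \<bullet>\<^bsub>D\<^esub> (id2 D d' \<star>\<^bsub>D\<^esub> mu (src D d') g (R1 d))
      = mu Y'' g (R1 d' \<odot>\<^bsub>C\<^esub> R1 d) \<bullet>\<^bsub>D\<^esub> (S d' (R1 d) \<star>\<^bsub>D\<^esub> ?g)"
    using S_precomp[of d' _ _ "R1 d" g] tys by simp
  also have "\<dots> \<bullet>\<^bsub>D\<^esub> ((id2 D d' \<star>\<^bsub>D\<^esub> \<sigma> d) \<star>\<^bsub>D\<^esub> ?g)
      = mu Y'' g (R1 d' \<odot>\<^bsub>C\<^esub> R1 d) \<bullet>\<^bsub>D\<^esub> ?n"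
    using tys by (simp add: L.B.whisker_right_vcomp)
  finally have 1: "S d' (R1 d \<odot>\<^bsub>C\<^esub> g) \<bullet>\<^bsub>D\<^esub> (id2 D d' \<star>\<^bsub>D\<^esub> S d g)
      = mu Y'' g (R1 d' \<odot>\<^bsub>C\<^esub> R1 d) \<bullet>\<^bsub>D\<^esub> ?n" .
  have "E2 Y'' (phi d d' \<star>\<^bsub>C\<^esub> id2 C g) \<bullet>\<^bsub>D\<^esub> (mu Y'' g (R1 d' \<odot>\<^bsub>C\<^esub> R1 d) \<bullet>\<^bsub>D\<^esub> ?n)
      = (E2 Y'' (phi d d' \<star>\<^bsub>C\<^esub> id2 C g) \<bullet>\<^bsub>D\<^esub> mu Y'' g (R1 d' \<odot>\<^bsub>C\<^esub> R1 d)) \<bullet>\<^bsub>D\<^esub>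
        ?n"
    using tys by simp
  also have "E2 Y'' (phi d d' \<star>\<^bsub>C\<^esub> id2 C g) \<bullet>\<^bsub>D\<^esub> mu Y'' g (R1 d' \<odot>\<^bsub>C\<^esub> R1 d)
      = mu Y'' g (R1 (d' \<odot>\<^bsub>D\<^esub> d)) \<bullet>\<^bsub>D\<^esub> (E2 Y'' (phi d d') \<star>\<^bsub>D\<^esub> ?g)"
    using L.transposed_cpt_natural[of "e Y''" "phi d d'" "id2 C g" g g "R1 d' \<odot>\<^bsub>C\<^esub> R1 d" "R1 (d' \<odot>\<^bsub>D\<^esub> d)"] tys by simp
  also have "\<dots> \<bullet>\<^bsub>D\<^esub> ((S d' (R1 d) \<bullet>\<^bsub>D\<^esub> (id2 D d' \<star>\<^bsub>D\<^esub> \<sigma> d)) \<star>\<^bsub>D\<^esub> ?g)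
      = mu Y'' g (R1 (d' \<odot>\<^bsub>D\<^esub> d)) \<bullet>\<^bsub>D\<^esub>
        ((E2 Y'' (phi d d') \<bullet>\<^bsub>D\<^esub> (S d' (R1 d) \<bullet>\<^bsub>D\<^esub> (id2 D d' \<star>\<^bsub>D\<^esub> \<sigma> d))) \<star>\<^bsub>D\<^esub> ?g)"
    using tys by (simp add: L.B.whisker_right_vcomp)
  also have "\<dots> = S (d' \<odot>\<^bsub>D\<^esub> d) g"
    using phi_transpose[of d d'] tys by (simp add: S_def)
  finally show ?thesis unfolding 1 .
qed

end


context universal_family
begin

definition R :: "('p, 'n, 'd, 'o, 'm, 'c) psfun" where
  "R = \<lparr>ap0 = R0, ap1 = R1, ap2 = R2, cpt = phi\<rparr>"

lemma R_sel [simp]: "ap0 R = R0" "ap1 R = R1" "ap2 R = R2" "cpt R = phi"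
  by (simp_all add: R_def)

lemma R2_id2 [simp]:
  assumes "d \<in> Mor D"
  shows "R2 (id2 D d) = id2 C (R1 d)"
  by (rule lift_eqI[of "tgt D d" _ _ "\<sigma> d"]) (use assms R2_transpose[of "id2 D d"] in simp_all)

lemma R2_vcomp:
  assumes "\<delta> \<in> Cell D" "\<delta>' \<in> Cell D" "cod2 D \<delta> = dom2 D \<delta>'"
  shows "R2 (\<delta>' \<bullet>\<^bsub>D\<^esub> \<delta>) = R2 \<delta>' \<bullet>\<^bsub>C\<^esub> R2 \<delta>"
proof (rule lift_eqI[of "tgt D (dom2 D \<delta>)" _ _ "\<sigma> (dom2 D \<delta>)"])
  let ?Y = "src D (dom2 D \<delta>)" and ?Y' = "tgt D (dom2 D \<delta>)"
  have t: "src D (dom2 D \<delta>') = ?Y" "tgt D (dom2 D \<delta>') = ?Y'"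
    using assms L.B.src_cod2[of \<delta>] L.B.tgt_cod2[of \<delta>] by simp_all
  have "E2 ?Y' (R2 \<delta>' \<bullet>\<^bsub>C\<^esub> R2 \<delta>) \<bullet>\<^bsub>D\<^esub> \<sigma> (dom2 D \<delta>) = E2 ?Y' (R2 \<delta>') \<bullet>\<^bsub>D\<^esub> (E2 ?Y' (R2 \<delta>) \<bullet>\<^bsub>D\<^esub> \<sigma> (dom2 D \<delta>))"
    using assms t by (simp add: L.B.whisker_left_vcomp)
  also have "\<dots> = E2 ?Y' (R2 \<delta>') \<bullet>\<^bsub>D\<^esub> (\<sigma> (dom2 D \<delta>') \<bullet>\<^bsub>D\<^esub> (\<delta> \<star>\<^bsub>D\<^esub> id2 D (e ?Y)))"
    using R2_transpose[OF assms(1)] assms(3) by simp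
  also have "\<dots> = (\<sigma> (cod2 D \<delta>') \<bullet>\<^bsub>D\<^esub> (\<delta>' \<star>\<^bsub>D\<^esub> id2 D (e ?Y))) \<bullet>\<^bsub>D\<^esub> (\<delta> \<star>\<^bsub>D\<^esub> id2 D (e ?Y))"
    by (rule L.B.vcomp_replace) (use R2_transpose[OF assms(2)] assms t in simp_all)
  also have "\<dots> = E2 ?Y' (R2 (\<delta>' \<bullet>\<^bsub>D\<^esub> \<delta>)) \<bullet>\<^bsub>D\<^esub> \<sigma> (dom2 D \<delta>)"
    using R2_transpose[of "\<delta>' \<bullet>\<^bsub>D\<^esub> \<delta>"] assms t by (simp add: L.B.whisker_right_vcomp)
  finally show "E2 ?Y' (R2 (\<delta>' \<bullet>\<^bsub>D\<^esub> \<delta>)) \<bullet>\<^bsub>D\<^esub> \<sigma> (dom2 D \<delta>)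
      = E2 ?Y' (R2 \<delta>' \<bullet>\<^bsub>C\<^esub> R2 \<delta>) \<bullet>\<^bsub>D\<^esub> \<sigma> (dom2 D \<delta>)" by simp
qed (use assms in simp_all)

text \<open>
  The coherence laws of \<open>R\<close> equate 2-cells into \<open>R0 Y''\<close>.  After transposition and composition with the
  two-step isomorphism built from \<open>\<sigma>\<close>, both sides reduce to the same composite in \<open>D\<close> by the
  properties of \<open>S\<close>.
\<close>

lemma phi_natural:
  assumes "\<delta> \<in> Cell D" "\<delta>' \<in> Cell D" "dom2 D \<delta> = a" "cod2 D \<delta> = b" "dom2 D \<delta>' = a'" "cod2 D \<delta>' = b'"
    "tgt D a = src D a'"
  shows "phi b b' \<bullet>\<^bsub>C\<^esub> (R2 \<delta>' \<star>\<^bsub>C\<^esub> R2 \<delta>) = R2 (\<delta>' \<star>\<^bsub>D\<^esub> \<delta>) \<bullet>\<^bsub>C\<^esub> phi a a'"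
proof -
  define Y Y' Y'' where Y: "Y = src D a" "Y' = src D a'" "Y'' = tgt D a'"
  have t: "a \<in> Mor D" "b \<in> Mor D" "a' \<in> Mor D" "b' \<in> Mor D" "src D a = Y" "src D b = Y" "tgt D a = Y'" "tgt D b = Y'"
      "src D a' = Y'" "src D b' = Y'" "tgt D a' = Y''" "tgt D b' = Y''" "Y \<in> Ob D" "Y' \<in> Ob D" "Y'' \<in> Ob D"
    using assms Y L.B.dom2_Mor[of \<delta>] L.B.cod2_Mor[of \<delta>] L.B.src_cod2[of \<delta>] L.B.tgt_cod2[of \<delta>]
      L.B.dom2_Mor[of \<delta>'] L.B.cod2_Mor[of \<delta>'] L.B.src_cod2[of \<delta>'] L.B.tgt_cod2[of \<delta>']
      L.B.src_Ob[of a] L.B.tgt_Ob[of a] L.B.tgt_Ob[of a'] by metis+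
  note tys = t assms(1-6)
  let ?p = "S a' (R1 a) \<bullet>\<^bsub>D\<^esub> (id2 D a' \<star>\<^bsub>D\<^esub> \<sigma> a)"
  have "E2 Y'' (phi b b' \<bullet>\<^bsub>C\<^esub> (R2 \<delta>' \<star>\<^bsub>C\<^esub> R2 \<delta>)) \<bullet>\<^bsub>D\<^esub> ?p
      = E2 Y'' (phi b b') \<bullet>\<^bsub>D\<^esub> ((E2 Y'' (R2 \<delta>' \<star>\<^bsub>C\<^esub> R2 \<delta>) \<bullet>\<^bsub>D\<^esub> S a' (R1 a)) \<bullet>\<^bsub>D\<^esub> (id2 D a' \<star>\<^bsub>D\<^esub> \<sigma> a))"
    using tys by (simp add: L.B.whisker_left_vcomp)
  also have "E2 Y'' (R2 \<delta>' \<star>\<^bsub>C\<^esub> R2 \<delta>) \<bullet>\<^bsub>D\<^esub> S a' (R1 a) = S b' (R1 b) \<bullet>\<^bsub>D\<^esub> (\<delta>' \<star>\<^bsub>D\<^esub> E2 Y' (R2 \<delta>))"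
    using S_natural[of \<delta>' a' b' "R2 \<delta>" "R1 a" "R1 b" Y' Y''] tys by simp
  also have "(S b' (R1 b) \<bullet>\<^bsub>D\<^esub> (\<delta>' \<star>\<^bsub>D\<^esub> E2 Y' (R2 \<delta>))) \<bullet>\<^bsub>D\<^esub> (id2 D a' \<star>\<^bsub>D\<^esub> \<sigma> a)
      = S b' (R1 b) \<bullet>\<^bsub>D\<^esub> (\<delta>' \<star>\<^bsub>D\<^esub> (E2 Y' (R2 \<delta>) \<bullet>\<^bsub>D\<^esub> \<sigma> a))"
    using tys by (simp add: L.B.interchange')
  also have "E2 Y' (R2 \<delta>) \<bullet>\<^bsub>D\<^esub> \<sigma> a = \<sigma> b \<bullet>\<^bsub>D\<^esub> (\<delta> \<star>\<^bsub>D\<^esub> id2 D (e Y))"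
    using R2_transpose[of \<delta>] tys by simp
  also have "S b' (R1 b) \<bullet>\<^bsub>D\<^esub> (\<delta>' \<star>\<^bsub>D\<^esub> (\<sigma> b \<bullet>\<^bsub>D\<^esub> (\<delta> \<star>\<^bsub>D\<^esub> id2 D (e Y))))
      = (S b' (R1 b) \<bullet>\<^bsub>D\<^esub> (id2 D b' \<star>\<^bsub>D\<^esub> \<sigma> b)) \<bullet>\<^bsub>D\<^esub> ((\<delta>' \<star>\<^bsub>D\<^esub> \<delta>) \<star>\<^bsub>D\<^esub> id2 D (e Y))"
    using tys by (simp add: L.B.interchange')
  also have "E2 Y'' (phi b b') \<bullet>\<^bsub>D\<^esub> \<dots>
      = (E2 Y'' (phi b b') \<bullet>\<^bsub>D\<^esub> (S b' (R1 b) \<bullet>\<^bsub>D\<^esub> (id2 D b' \<star>\<^bsub>D\<^esub> \<sigma> b))) \<bullet>\<^bsub>D\<^esub> ((\<delta>' \<star>\<^bsub>D\<^esub> \<delta>) \<star>\<^bsub>D\<^esub> id2 D (e Y))"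
    using tys by simp
  also have "E2 Y'' (phi b b') \<bullet>\<^bsub>D\<^esub> (S b' (R1 b) \<bullet>\<^bsub>D\<^esub> (id2 D b' \<star>\<^bsub>D\<^esub> \<sigma> b)) = \<sigma> (b' \<odot>\<^bsub>D\<^esub> b)"
    using phi_transpose[of b b'] tys by simp
  also have "\<sigma> (b' \<odot>\<^bsub>D\<^esub> b) \<bullet>\<^bsub>D\<^esub> ((\<delta>' \<star>\<^bsub>D\<^esub> \<delta>) \<star>\<^bsub>D\<^esub> id2 D (e Y)) = E2 Y'' (R2 (\<delta>' \<star>\<^bsub>D\<^esub> \<delta>)) \<bullet>\<^bsub>D\<^esub> \<sigma> (a' \<odot>\<^bsub>D\<^esub> a)"
    using R2_transpose[of "\<delta>' \<star>\<^bsub>D\<^esub> \<delta>"] tys by simp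
  also have "\<sigma> (a' \<odot>\<^bsub>D\<^esub> a) = E2 Y'' (phi a a') \<bullet>\<^bsub>D\<^esub> ?p"
    using phi_transpose[of a a'] tys by simp
  also have "E2 Y'' (R2 (\<delta>' \<star>\<^bsub>D\<^esub> \<delta>)) \<bullet>\<^bsub>D\<^esub> \<dots> = E2 Y'' (R2 (\<delta>' \<star>\<^bsub>D\<^esub> \<delta>) \<bullet>\<^bsub>C\<^esub> phi a a') \<bullet>\<^bsub>D\<^esub> ?p"
    using tys by (simp add: L.B.whisker_left_vcomp)
  finally show ?thesis
    by (intro lift_eqI[of Y'' _ _ ?p]) (use tys in simp_all)
qed

lemma phi_assoc:
  assumes "a \<in> Mor D" "a' \<in> Mor D" "a'' \<in> Mor D" "tgt D a = src D a'" "tgt D a' = src D a''"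
  shows "phi a (a'' \<odot>\<^bsub>D\<^esub> a') \<bullet>\<^bsub>C\<^esub> (phi a' a'' \<star>\<^bsub>C\<^esub> id2 C (R1 a))
    = phi (a' \<odot>\<^bsub>D\<^esub> a) a'' \<bullet>\<^bsub>C\<^esub> (id2 C (R1 a'') \<star>\<^bsub>C\<^esub> phi a a')"
proof -
  define Y Y' Y'' Y3 where Y: "Y = src D a" "Y' = src D a'" "Y'' = src D a''" "Y3 = tgt D a''"
  have t: "src D a = Y" "tgt D a = Y'" "src D a' = Y'" "tgt D a' = Y''" "src D a'' = Y''" "tgt D a'' = Y3"
      "Y \<in> Ob D" "Y' \<in> Ob D" "Y'' \<in> Ob D" "Y3 \<in> Ob D"
    using assms Y by simp_all
  note tys = t assms(1-3)
  let ?q = "S a' (R1 a) \<bullet>\<^bsub>D\<^esub> (id2 D a' \<star>\<^bsub>D\<^esub> \<sigma> a)"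
  let ?p = "S a'' (R1 a' \<odot>\<^bsub>C\<^esub> R1 a) \<bullet>\<^bsub>D\<^esub> (id2 D a'' \<star>\<^bsub>D\<^esub> ?q)"
  have "E2 Y3 (phi a (a'' \<odot>\<^bsub>D\<^esub> a') \<bullet>\<^bsub>C\<^esub> (phi a' a'' \<star>\<^bsub>C\<^esub> id2 C (R1 a))) \<bullet>\<^bsub>D\<^esub> ?p
      = E2 Y3 (phi a (a'' \<odot>\<^bsub>D\<^esub> a')) \<bullet>\<^bsub>D\<^esub> ((E2 Y3 (phi a' a'' \<star>\<^bsub>C\<^esub> id2 C (R1 a)) \<bullet>\<^bsub>D\<^esub>
          (S a'' (R1 a' \<odot>\<^bsub>C\<^esub> R1 a) \<bullet>\<^bsub>D\<^esub> (id2 D a'' \<star>\<^bsub>D\<^esub> S a' (R1 a)))) \<bullet>\<^bsub>D\<^esub> (id2 D (a'' \<odot>\<^bsub>D\<^esub> a') \<star>\<^bsub>D\<^esub> \<sigma> a))"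
    using tys by (simp add: L.B.whisker_left_vcomp L.B.whisker_comp1)
  also have "E2 Y3 (phi a' a'' \<star>\<^bsub>C\<^esub> id2 C (R1 a)) \<bullet>\<^bsub>D\<^esub>
          (S a'' (R1 a' \<odot>\<^bsub>C\<^esub> R1 a) \<bullet>\<^bsub>D\<^esub> (id2 D a'' \<star>\<^bsub>D\<^esub> S a' (R1 a))) = S (a'' \<odot>\<^bsub>D\<^esub> a') (R1 a)"
    using tys by (intro S_comp) simp_all
  also have "E2 Y3 (phi a (a'' \<odot>\<^bsub>D\<^esub> a')) \<bullet>\<^bsub>D\<^esub> (S (a'' \<odot>\<^bsub>D\<^esub> a') (R1 a) \<bullet>\<^bsub>D\<^esub> (id2 D (a'' \<odot>\<^bsub>D\<^esub> a') \<star>\<^bsub>D\<^esub> \<sigma> a))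
      = \<sigma> (a'' \<odot>\<^bsub>D\<^esub> (a' \<odot>\<^bsub>D\<^esub> a))"
    using phi_transpose[of a "a'' \<odot>\<^bsub>D\<^esub> a'"] tys by simp
  also have "\<dots> = E2 Y3 (phi (a' \<odot>\<^bsub>D\<^esub> a) a'') \<bullet>\<^bsub>D\<^esub> (S a'' (R1 (a' \<odot>\<^bsub>D\<^esub> a)) \<bullet>\<^bsub>D\<^esub> (id2 D a'' \<star>\<^bsub>D\<^esub> \<sigma> (a' \<odot>\<^bsub>D\<^esub> a)))"
    using phi_transpose[of "a' \<odot>\<^bsub>D\<^esub> a" a''] tys by simp
  also have "\<sigma> (a' \<odot>\<^bsub>D\<^esub> a) = E2 Y'' (phi a a') \<bullet>\<^bsub>D\<^esub> ?q"
    using phi_transpose[of a a'] tys by simp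
  also have "S a'' (R1 (a' \<odot>\<^bsub>D\<^esub> a)) \<bullet>\<^bsub>D\<^esub> (id2 D a'' \<star>\<^bsub>D\<^esub> (E2 Y'' (phi a a') \<bullet>\<^bsub>D\<^esub> ?q))
      = (S a'' (R1 (a' \<odot>\<^bsub>D\<^esub> a)) \<bullet>\<^bsub>D\<^esub> (id2 D a'' \<star>\<^bsub>D\<^esub> E2 Y'' (phi a a'))) \<bullet>\<^bsub>D\<^esub> (id2 D a'' \<star>\<^bsub>D\<^esub> ?q)"
    using tys by (simp add: L.B.whisker_left_vcomp)
  also have "S a'' (R1 (a' \<odot>\<^bsub>D\<^esub> a)) \<bullet>\<^bsub>D\<^esub> (id2 D a'' \<star>\<^bsub>D\<^esub> E2 Y'' (phi a a'))
      = E2 Y3 (id2 C (R1 a'') \<star>\<^bsub>C\<^esub> phi a a') \<bullet>\<^bsub>D\<^esub> S a'' (R1 a' \<odot>\<^bsub>C\<^esub> R1 a)"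
    using S_natural[of "id2 D a''" a'' a'' "phi a a'" "R1 a' \<odot>\<^bsub>C\<^esub> R1 a" "R1 (a' \<odot>\<^bsub>D\<^esub> a)" Y'' Y3] tys by simp
  also have "E2 Y3 (phi (a' \<odot>\<^bsub>D\<^esub> a) a'') \<bullet>\<^bsub>D\<^esub> ((E2 Y3 (id2 C (R1 a'') \<star>\<^bsub>C\<^esub> phi a a') \<bullet>\<^bsub>D\<^esub> S a'' (R1 a' \<odot>\<^bsub>C\<^esub> R1 a)) \<bullet>\<^bsub>D\<^esub> (id2 D a'' \<star>\<^bsub>D\<^esub> ?q))
      = E2 Y3 (phi (a' \<odot>\<^bsub>D\<^esub> a) a'' \<bullet>\<^bsub>C\<^esub> (id2 C (R1 a'') \<star>\<^bsub>C\<^esub> phi a a')) \<bullet>\<^bsub>D\<^esub> ?p"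
    using tys by (simp add: L.B.whisker_left_vcomp)
  finally show ?thesis
    by (intro lift_eqI[of Y3 _ _ ?p]) (use tys in simp_all)
qed

lemma phi_unit:
  assumes "a \<in> Mor D"
  shows "phi a (id1 D (tgt D a)) = id2 C (R1 a)" and "phi (id1 D (src D a)) a = id2 C (R1 a)"
proof -
  show "phi a (id1 D (tgt D a)) = id2 C (R1 a)"
    by (rule lift_eqI[of "tgt D a" _ _ "\<sigma> a"])
      (use assms phi_transpose[of a "id1 D (tgt D a)"] in simp_all)
  show "phi (id1 D (src D a)) a = id2 C (R1 a)"
    by (rule lift_eqI[of "tgt D a" _ _ "\<sigma> a"])
      (use assms phi_transpose[of "id1 D (src D a)" a] in simp_all)
qed

lemma normal_pseudo_functor_R: "normal_pseudo_functor D C R"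
proof (intro normal_pseudo_functor.intro, goal_cases)
  case (4 Y Y')
  show ?case
    by (intro cat_functor.intro L.A.category_hom_cat L.B.category_hom_cat)
      (auto simp: L.A.arrows_hom_cat L.B.arrows_hom_cat hom1_def hom2_def R2_vcomp split: if_splits)
next
  case (8 a X Y a' Z \<alpha> b \<alpha>' b')
  then show ?case using phi_natural[of \<alpha> \<alpha>' a b a' b'] by (simp add: hom1_def hom2_def)
next
  case (9 a W X a' Y a'' Z)
  then show ?case using phi_assoc[of a a' a''] by (simp add: hom1_def)
next
  case (10 a X Y)
  then show ?case using phi_unit(1)[of a] by (auto simp: hom1_def)
next
  case (11 a X Y)
  then show ?case using phi_unit(2)[of a] by (auto simp: hom1_def)
qed (auto simp: hom1_def hom2_def L.A.two_category_axioms L.B.two_category_axioms)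

end


section \<open>Pseudo-naturality of transposition\<close>

context universal_family
begin

text \<open>
  The constraint \<open>d (E1 Y g) (L c) \<Rightarrow> E1 Y' ((R1 d) g c)\<close> of the pseudo-natural family of transposition
  functors: a compositor of \<open>L\<close> absorbs \<open>c\<close>, then \<open>S\<close> moves \<open>d\<close> across \<open>e\<close>.
\<close>

definition theta :: "'m \<times> 'n \<Rightarrow> 'm \<Rightarrow> 'd" where
  "theta = (\<lambda>(c, d) g. S d (g \<odot>\<^bsub>C\<^esub> c) \<bullet>\<^bsub>D\<^esub> (id2 D d \<star>\<^bsub>D\<^esub> mu (src D d) c g))"

lemma theta_type:
  assumes "c \<in> Mor C" "g \<in> Mor C" "d \<in> Mor D" "tgt C c = src C g" "tgt C g = R0 (src D d)"
  shows "theta (c, d) g \<in> Cell D" "dom2 D (theta (c, d) g) = d \<odot>\<^bsub>D\<^esub> (E1 (src D d) g \<odot>\<^bsub>D\<^esub> ap1 L c)"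
    "cod2 D (theta (c, d) g) = E1 (tgt D d) (R1 d \<odot>\<^bsub>C\<^esub> (g \<odot>\<^bsub>C\<^esub> c))" "L.B.iso2 (theta (c, d) g)"
  using assms by (simp_all add: theta_def)

lemma theta_natural:
  assumes \<gamma>: "\<gamma> \<in> Cell C" "dom2 C \<gamma> = c" "cod2 C \<gamma> = c'" and \<delta>: "\<delta> \<in> Cell D" "dom2 D \<delta> = d" "cod2 D \<delta> = d'"
    and \<beta>: "\<beta> \<in> Cell C" "dom2 C \<beta> = g" "cod2 C \<beta> = g'"
    and Y: "src D d = Y" "tgt D d = Y'" "tgt C c = src C g" "tgt C g = R0 Y"
  shows "theta (c', d') g' \<bullet>\<^bsub>D\<^esub> (\<delta> \<star>\<^bsub>D\<^esub> (E2 Y \<beta> \<star>\<^bsub>D\<^esub> ap2 L \<gamma>)) = E2 Y' (R2 \<delta> \<star>\<^bsub>C\<^esub> (\<beta> \<star>\<^bsub>C\<^esub> \<gamma>)) \<bullet>\<^bsub>D\<^esub> theta (c, d) g"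
proof -
  have t: "c \<in> Mor C" "c' \<in> Mor C" "g \<in> Mor C" "g' \<in> Mor C" "d \<in> Mor D" "d' \<in> Mor D" "src D d = Y" "src D d' = Y"
      "tgt D d = Y'" "tgt D d' = Y'" "src C c' = src C c" "tgt C c' = src C g" "src C g' = src C g" "tgt C g' = R0 Y"
      "Y \<in> Ob D" "Y' \<in> Ob D"
    using assms L.B.dom2_Mor[of \<delta>] L.B.cod2_Mor[of \<delta>] L.B.src_cod2[of \<delta>] L.B.tgt_cod2[of \<delta>]
      L.A.dom2_Mor[of \<gamma>] L.A.cod2_Mor[of \<gamma>] L.A.src_cod2[of \<gamma>] L.A.tgt_cod2[of \<gamma>]
      L.A.dom2_Mor[of \<beta>] L.A.cod2_Mor[of \<beta>] L.A.src_cod2[of \<beta>] L.A.tgt_cod2[of \<beta>]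
      L.B.src_Ob[of d] L.B.tgt_Ob[of d] by metis+
  note tys = t assms
  have "theta (c', d') g' \<bullet>\<^bsub>D\<^esub> (\<delta> \<star>\<^bsub>D\<^esub> (E2 Y \<beta> \<star>\<^bsub>D\<^esub> ap2 L \<gamma>))
      = S d' (g' \<odot>\<^bsub>C\<^esub> c') \<bullet>\<^bsub>D\<^esub> ((id2 D d' \<star>\<^bsub>D\<^esub> mu Y c' g') \<bullet>\<^bsub>D\<^esub> (\<delta> \<star>\<^bsub>D\<^esub> (E2 Y \<beta> \<star>\<^bsub>D\<^esub> ap2 L \<gamma>)))"
    unfolding theta_def using tys by simp
  also have "(id2 D d' \<star>\<^bsub>D\<^esub> mu Y c' g') \<bullet>\<^bsub>D\<^esub> (\<delta> \<star>\<^bsub>D\<^esub> (E2 Y \<beta> \<star>\<^bsub>D\<^esub> ap2 L \<gamma>))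
      = \<delta> \<star>\<^bsub>D\<^esub> (mu Y c' g' \<bullet>\<^bsub>D\<^esub> (E2 Y \<beta> \<star>\<^bsub>D\<^esub> ap2 L \<gamma>))"
    using tys L.B.interchange'[of "E2 Y \<beta> \<star>\<^bsub>D\<^esub> ap2 L \<gamma>" "mu Y c' g'" \<delta> "id2 D d'"] by simp
  also have "mu Y c' g' \<bullet>\<^bsub>D\<^esub> (E2 Y \<beta> \<star>\<^bsub>D\<^esub> ap2 L \<gamma>) = E2 Y (\<beta> \<star>\<^bsub>C\<^esub> \<gamma>) \<bullet>\<^bsub>D\<^esub> mu Y c g"
    using L.transposed_cpt_natural[of "e Y" \<beta> \<gamma> c c' g g'] tys by simp
  also have "\<delta> \<star>\<^bsub>D\<^esub> (E2 Y (\<beta> \<star>\<^bsub>C\<^esub> \<gamma>) \<bullet>\<^bsub>D\<^esub> mu Y c g) = (\<delta> \<star>\<^bsub>D\<^esub> E2 Y (\<beta> \<star>\<^bsub>C\<^esub> \<gamma>)) \<bullet>\<^bsub>D\<^esub> (id2 D d \<star>\<^bsub>D\<^esub> mu Y c g)"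
    using tys L.B.interchange'[of "mu Y c g" "E2 Y (\<beta> \<star>\<^bsub>C\<^esub> \<gamma>)" "id2 D d" \<delta>] by simp
  also have "S d' (g' \<odot>\<^bsub>C\<^esub> c') \<bullet>\<^bsub>D\<^esub> \<dots>
      = (S d' (g' \<odot>\<^bsub>C\<^esub> c') \<bullet>\<^bsub>D\<^esub> (\<delta> \<star>\<^bsub>D\<^esub> E2 Y (\<beta> \<star>\<^bsub>C\<^esub> \<gamma>))) \<bullet>\<^bsub>D\<^esub> (id2 D d \<star>\<^bsub>D\<^esub> mu Y c g)"
    using tys by simp
  also have "S d' (g' \<odot>\<^bsub>C\<^esub> c') \<bullet>\<^bsub>D\<^esub> (\<delta> \<star>\<^bsub>D\<^esub> E2 Y (\<beta> \<star>\<^bsub>C\<^esub> \<gamma>)) = E2 Y' (R2 \<delta> \<star>\<^bsub>C\<^esub> (\<beta> \<star>\<^bsub>C\<^esub> \<gamma>)) \<bullet>\<^bsub>D\<^esub> S d (g \<odot>\<^bsub>C\<^esub> c)"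
    using S_natural[of \<delta> d d' "\<beta> \<star>\<^bsub>C\<^esub> \<gamma>" "g \<odot>\<^bsub>C\<^esub> c" "g' \<odot>\<^bsub>C\<^esub> c'" Y Y'] tys by simp
  also have "\<dots> \<bullet>\<^bsub>D\<^esub> (id2 D d \<star>\<^bsub>D\<^esub> mu Y c g) = E2 Y' (R2 \<delta> \<star>\<^bsub>C\<^esub> (\<beta> \<star>\<^bsub>C\<^esub> \<gamma>)) \<bullet>\<^bsub>D\<^esub> theta (c, d) g"
    unfolding theta_def using tys by simp
  finally show ?thesis .
qed

text \<open>
  The two applications of \<open>theta\<close> are brought into the order in which all compositors of \<open>L\<close> come first:
  \<open>S_precomp\<close> moves the inner \<open>S\<close> past the outer compositor and \<open>mu_assoc\<close> merges the compositors.  The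
  two remaining \<open>S\<close> are merged by \<open>S_comp\<close>.
\<close>

lemma theta_comp:
  assumes "c \<in> Mor C" "c' \<in> Mor C" "g \<in> Mor C" "tgt C c' = src C c" "tgt C c = src C g"
    and "d \<in> Mor D" "d' \<in> Mor D" "src D d = Y" "tgt D d = Y'" "src D d' = Y'" "tgt D d' = Y''" "tgt C g = R0 Y"
  shows "theta (c \<odot>\<^bsub>C\<^esub> c', d' \<odot>\<^bsub>D\<^esub> d) g \<bullet>\<^bsub>D\<^esub> (id2 D (d' \<odot>\<^bsub>D\<^esub> d) \<star>\<^bsub>D\<^esub> (id2 D (E1 Y g) \<star>\<^bsub>D\<^esub> cpt L c' c))
    = E2 Y'' (phi d d' \<star>\<^bsub>C\<^esub> id2 C (g \<odot>\<^bsub>C\<^esub> (c \<odot>\<^bsub>C\<^esub> c'))) \<bullet>\<^bsub>D\<^esub>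
      (theta (c', d') (R1 d \<odot>\<^bsub>C\<^esub> (g \<odot>\<^bsub>C\<^esub> c)) \<bullet>\<^bsub>D\<^esub> (id2 D d' \<star>\<^bsub>D\<^esub> (theta (c, d) g \<star>\<^bsub>D\<^esub> id2 D (ap1 L c'))))"
proof -
  have t: "Y \<in> Ob D" "Y' \<in> Ob D" "Y'' \<in> Ob D" using assms by auto
  note tys = t assms
  let ?c = "id2 D (ap1 L c')" and ?h = "g \<odot>\<^bsub>C\<^esub> (c \<odot>\<^bsub>C\<^esub> c')"
  let ?n = "mu Y (c \<odot>\<^bsub>C\<^esub> c') g \<bullet>\<^bsub>D\<^esub> (id2 D (E1 Y g) \<star>\<^bsub>D\<^esub> cpt L c' c)"
  have "mu Y' c' (R1 d \<odot>\<^bsub>C\<^esub> (g \<odot>\<^bsub>C\<^esub> c)) \<bullet>\<^bsub>D\<^esub> (theta (c, d) g \<star>\<^bsub>D\<^esub> ?c)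
      = (mu Y' c' (R1 d \<odot>\<^bsub>C\<^esub> (g \<odot>\<^bsub>C\<^esub> c)) \<bullet>\<^bsub>D\<^esub> (S d (g \<odot>\<^bsub>C\<^esub> c) \<star>\<^bsub>D\<^esub> ?c)) \<bullet>\<^bsub>D\<^esub> ((id2 D d \<star>\<^bsub>D\<^esub> mu Y c g) \<star>\<^bsub>D\<^esub> ?c)"
    unfolding theta_def using tys by (simp add: L.B.whisker_right_vcomp)
  also have "mu Y' c' (R1 d \<odot>\<^bsub>C\<^esub> (g \<odot>\<^bsub>C\<^esub> c)) \<bullet>\<^bsub>D\<^esub> (S d (g \<odot>\<^bsub>C\<^esub> c) \<star>\<^bsub>D\<^esub> ?c)
      = S d ?h \<bullet>\<^bsub>D\<^esub> (id2 D d \<star>\<^bsub>D\<^esub> mu Y c' (g \<odot>\<^bsub>C\<^esub> c))"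
    using S_precomp[of d Y Y' "g \<odot>\<^bsub>C\<^esub> c" c'] tys by simp
  also have "\<dots> \<bullet>\<^bsub>D\<^esub> ((id2 D d \<star>\<^bsub>D\<^esub> mu Y c g) \<star>\<^bsub>D\<^esub> ?c)
      = S d ?h \<bullet>\<^bsub>D\<^esub> (id2 D d \<star>\<^bsub>D\<^esub> (mu Y c' (g \<odot>\<^bsub>C\<^esub> c) \<bullet>\<^bsub>D\<^esub> (mu Y c g \<star>\<^bsub>D\<^esub> ?c)))"
    using tys by (simp add: L.B.whisker_left_vcomp)
  also have "mu Y c' (g \<odot>\<^bsub>C\<^esub> c) \<bullet>\<^bsub>D\<^esub> (mu Y c g \<star>\<^bsub>D\<^esub> ?c) = ?n"
    using mu_assoc[of Y c' c g] tys by simp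
  finally have 1: "mu Y' c' (R1 d \<odot>\<^bsub>C\<^esub> (g \<odot>\<^bsub>C\<^esub> c)) \<bullet>\<^bsub>D\<^esub> (theta (c, d) g \<star>\<^bsub>D\<^esub> ?c) = S d ?h \<bullet>\<^bsub>D\<^esub> (id2 D d \<star>\<^bsub>D\<^esub> ?n)" .
  have th: "theta (c, d) g \<in> Cell D" "dom2 D (theta (c, d) g) = d \<odot>\<^bsub>D\<^esub> (E1 Y g \<odot>\<^bsub>D\<^esub> ap1 L c)"
      "cod2 D (theta (c, d) g) = E1 Y' (R1 d \<odot>\<^bsub>C\<^esub> (g \<odot>\<^bsub>C\<^esub> c))"
    using theta_type[of c g d] tys by simp_all
  have "theta (c', d') (R1 d \<odot>\<^bsub>C\<^esub> (g \<odot>\<^bsub>C\<^esub> c)) \<bullet>\<^bsub>D\<^esub> (id2 D d' \<star>\<^bsub>D\<^esub> (theta (c, d) g \<star>\<^bsub>D\<^esub> ?c))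
      = S d' (R1 d \<odot>\<^bsub>C\<^esub> ?h) \<bullet>\<^bsub>D\<^esub> (id2 D d' \<star>\<^bsub>D\<^esub> (mu Y' c' (R1 d \<odot>\<^bsub>C\<^esub> (g \<odot>\<^bsub>C\<^esub> c)) \<bullet>\<^bsub>D\<^esub> (theta (c, d) g \<star>\<^bsub>D\<^esub> ?c)))"
    unfolding theta_def[THEN fun_cong, of "(c', d')"] using tys th by (simp add: L.B.whisker_left_vcomp)
  also have "\<dots> = (S d' (R1 d \<odot>\<^bsub>C\<^esub> ?h) \<bullet>\<^bsub>D\<^esub> (id2 D d' \<star>\<^bsub>D\<^esub> S d ?h)) \<bullet>\<^bsub>D\<^esub> (id2 D (d' \<odot>\<^bsub>D\<^esub> d) \<star>\<^bsub>D\<^esub> ?n)"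
    unfolding 1 using tys by (simp add: L.B.whisker_left_vcomp L.B.whisker_comp1)
  finally have 2: "theta (c', d') (R1 d \<odot>\<^bsub>C\<^esub> (g \<odot>\<^bsub>C\<^esub> c)) \<bullet>\<^bsub>D\<^esub> (id2 D d' \<star>\<^bsub>D\<^esub> (theta (c, d) g \<star>\<^bsub>D\<^esub> ?c))
      = (S d' (R1 d \<odot>\<^bsub>C\<^esub> ?h) \<bullet>\<^bsub>D\<^esub> (id2 D d' \<star>\<^bsub>D\<^esub> S d ?h)) \<bullet>\<^bsub>D\<^esub> (id2 D (d' \<odot>\<^bsub>D\<^esub> d) \<star>\<^bsub>D\<^esub> ?n)" .
  have "E2 Y'' (phi d d' \<star>\<^bsub>C\<^esub> id2 C ?h) \<bullet>\<^bsub>D\<^esub>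
        ((S d' (R1 d \<odot>\<^bsub>C\<^esub> ?h) \<bullet>\<^bsub>D\<^esub> (id2 D d' \<star>\<^bsub>D\<^esub> S d ?h)) \<bullet>\<^bsub>D\<^esub> (id2 D (d' \<odot>\<^bsub>D\<^esub> d) \<star>\<^bsub>D\<^esub> ?n))
      = (E2 Y'' (phi d d' \<star>\<^bsub>C\<^esub> id2 C ?h) \<bullet>\<^bsub>D\<^esub>
        (S d' (R1 d \<odot>\<^bsub>C\<^esub> ?h) \<bullet>\<^bsub>D\<^esub> (id2 D d' \<star>\<^bsub>D\<^esub> S d ?h))) \<bullet>\<^bsub>D\<^esub> (id2 D (d' \<odot>\<^bsub>D\<^esub> d) \<star>\<^bsub>D\<^esub> ?n)"
    using tys by simp
  also have "E2 Y'' (phi d d' \<star>\<^bsub>C\<^esub> id2 C ?h) \<bullet>\<^bsub>D\<^esub> (S d' (R1 d \<odot>\<^bsub>C\<^esub> ?h) \<bullet>\<^bsub>D\<^esub> (id2 D d' \<star>\<^bsub>D\<^esub> S d ?h)) = S (d' \<odot>\<^bsub>D\<^esub> d) ?h"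
    using tys by (intro S_comp) simp_all
  also have "S (d' \<odot>\<^bsub>D\<^esub> d) ?h \<bullet>\<^bsub>D\<^esub> (id2 D (d' \<odot>\<^bsub>D\<^esub> d) \<star>\<^bsub>D\<^esub> ?n)
      = theta (c \<odot>\<^bsub>C\<^esub> c', d' \<odot>\<^bsub>D\<^esub> d) g \<bullet>\<^bsub>D\<^esub> (id2 D (d' \<odot>\<^bsub>D\<^esub> d) \<star>\<^bsub>D\<^esub> (id2 D (E1 Y g) \<star>\<^bsub>D\<^esub> cpt L c' c))"
    unfolding theta_def using tys by (simp add: L.B.whisker_left_vcomp)
  finally show ?thesis unfolding 2 by simp
qed

definition Phi :: "'o \<times> 'p \<Rightarrow> ('m, 'c, 'n, 'd) fun_data" where
  "Phi = (\<lambda>(X, Y). transposition D L (e Y))"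

lemma Phi_functor:
  "\<lbrakk>X \<in> Ob C; Y \<in> Ob D\<rbrakk> \<Longrightarrow> cat_functor (hom_cat C X (R0 Y)) (hom_cat D (ap0 L X) Y) (Phi (X, Y))"
  using L.cat_functor_transposition[OF e_in] by (simp add: Phi_def)

lemma cat_valued_hom_right: "cat_valued_pseudo_functor (prod2 (op2 C) D) (hom_right C R)"
  unfolding hom_right_eq
  by (intro hom_setting.cat_valued_hom_psfun hom_setting.intro normal_pseudo_functor_id
      L.A.two_category_axioms normal_pseudo_functor_R)

lemma cat_valued_hom_left: "cat_valued_pseudo_functor (prod2 (op2 C) D) (hom_left D L)"
  unfolding hom_left_eq
  by (intro hom_setting.cat_valued_hom_psfun hom_setting.intro normal_pseudo_functor_id
      L.B.two_category_axioms L.normal_pseudo_functor_axioms)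

lemma theta_nat_iso:
  assumes c: "c \<in> Mor C" and d: "d \<in> Mor D"
  shows "nat_iso (hom_cat C (tgt C c) (R0 (src D d))) (hom_cat D (ap0 L (src C c)) (tgt D d))
    (fun_comp (at_mor (hom_left D L) (c, d)) (Phi (tgt C c, src D d)))
    (fun_comp (Phi (src C c, tgt D d)) (at_mor (hom_right C R) (c, d))) (theta (c, d))"
proof -
  have cd: "(c, d) \<in> hom1 (prod2 (op2 C) D) (tgt C c, src D d) (src C c, tgt D d)" using c d by (simp add: hom1_def)
  have Q: "cat_functor (hom_cat D (ap0 L (tgt C c)) (src D d)) (hom_cat D (ap0 L (src C c)) (tgt D d)) (at_mor (hom_left D L) (c, d))"
    using cat_valued_pseudo_functor.at_mor[OF cat_valued_hom_left cd] by (simp add: hom_left_def)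
  have P: "cat_functor (hom_cat C (tgt C c) (R0 (src D d))) (hom_cat C (src C c) (R0 (tgt D d))) (at_mor (hom_right C R) (c, d))"
    using cat_valued_pseudo_functor.at_mor[OF cat_valued_hom_right cd] by (simp add: hom_right_def)
  note F = cat_functor_fun_comp[OF Phi_functor Q] and G = cat_functor_fun_comp[OF P Phi_functor]
  show ?thesis
  proof (intro nat_iso.intro nat_trans.intro F G nat_trans_axioms.intro nat_iso_axioms.intro, goal_cases)
    case (5 g)
    then show ?case
      using theta_type[of c g d] c d
      by (simp add: hom1_def hom2_def L.B.arrows_hom_cat hom_left_def hom_right_def fun_comp_def Phi_def transposition_def)
  next
    case (6 \<beta> g g')
    then have \<beta>: "\<beta> \<in> Cell C" "dom2 C \<beta> = g" "cod2 C \<beta> = g'" "tgt C c = src C g" "tgt C g = R0 (src D d)"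
      by (auto simp: L.A.arrows_hom_cat hom1_def hom2_def split: if_splits)
    have g: "g \<in> Mor C" "g' \<in> Mor C" "src C g' = src C g" "tgt C g' = R0 (src D d)"
      using \<beta> L.A.dom2_Mor[of \<beta>] L.A.cod2_Mor[of \<beta>] L.A.src_cod2[of \<beta>] L.A.tgt_cod2[of \<beta>] by simp_all
    have "theta (c, d) g' \<bullet>\<^bsub>D\<^esub> (id2 D d \<star>\<^bsub>D\<^esub> (E2 (src D d) \<beta> \<star>\<^bsub>D\<^esub> id2 D (ap1 L c)))
        = E2 (tgt D d) (id2 C (R1 d) \<star>\<^bsub>C\<^esub> (\<beta> \<star>\<^bsub>C\<^esub> id2 C c)) \<bullet>\<^bsub>D\<^esub> theta (c, d) g"
      using theta_natural[of "id2 C c" c c "id2 D d" d d \<beta> g g' "src D d" "tgt D d"] c d \<beta>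
      by (simp del: L.B.hcomp_assoc' L.B.vcomp_assoc)
    then show ?case
      by (simp add: hom_left_def hom_right_def fun_comp_def Phi_def transposition_def)
  next
    case (7 g)
    then show ?case
      using theta_type[of c g d] c d by (subst L.B.is_iso_hom_cat) (auto simp: hom1_def)
  qed (use c d in simp_all)
qed

lemma pseudo_natural_Phi: "pseudo_natural (prod2 (op2 C) D) (hom_right C R) (hom_left D L) Phi theta"
proof (intro pseudo_natural.intro cat_valued_hom_right cat_valued_hom_left pseudo_natural_axioms.intro, goal_cases)
  case (1 p)
  then show ?case using Phi_functor by (cases p) (simp add: hom_right_def hom_left_def)
next
  case (2 a p q)
  obtain c d where a: "a = (c, d)" by (cases a)
  have cd: "c \<in> Mor C" "d \<in> Mor D" and pq: "p = (tgt C c, src D d)" "q = (src C c, tgt D d)"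
    using 2 unfolding a by (simp_all add: hom1_def)
  have "at_ob (hom_right C R) p = hom_cat C (tgt C c) (R0 (src D d))"
      "at_ob (hom_left D L) q = hom_cat D (ap0 L (src C c)) (tgt D d)"
    unfolding pq by (simp_all add: hom_right_def hom_left_def)
  then show ?case using theta_nat_iso[OF cd] unfolding a pq by simp
next
  case (3 a p q \<alpha> b g)
  obtain c d c' d' \<gamma> \<delta> X Y X' Y' where s: "a = (c, d)" "b = (c', d')" "\<alpha> = (\<gamma>, \<delta>)" "p = (X, Y)" "q = (X', Y')"
    by (cases a; cases b; cases \<alpha>; cases p; cases q)
  have t: "\<gamma> \<in> Cell C" "dom2 C \<gamma> = c" "cod2 C \<gamma> = c'" "\<delta> \<in> Cell D" "dom2 D \<delta> = d" "cod2 D \<delta> = d'"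
      "c \<in> Mor C" "d \<in> Mor D" "src C c = X'" "tgt C c = X" "src D d = Y" "tgt D d = Y'"
      "g \<in> Mor C" "src C g = X" "tgt C g = R0 Y"
    using 3 unfolding s by (simp_all add: hom1_def hom2_def hom_right_def)
  then have "Y \<in> Ob D" by auto
  then show ?case
    using theta_natural[of \<gamma> c c' \<delta> d d' "id2 C g" g g Y Y'] t
    unfolding s by (simp add: hom_left_def hom_right_def Phi_def transposition_def)
next
  case (4 p g)
  obtain X Y where p: "p = (X, Y)" by (cases p)
  have "X \<in> Ob C" "Y \<in> Ob D" "g \<in> Mor C" "src C g = X" "tgt C g = R0 Y"
    using 4 unfolding p by (simp_all add: hom1_def hom_right_def)
  then show ?case unfolding p by (simp add: hom_left_def Phi_def transposition_def theta_def)
next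
  case (5 a p q a' r g)
  obtain c d c' d' X Y X' Y' X'' Y'' where s: "a = (c, d)" "a' = (c', d')" "p = (X, Y)" "q = (X', Y')" "r = (X'', Y'')"
    by (cases a; cases a'; cases p; cases q; cases r)
  have t: "c \<in> Mor C" "d \<in> Mor D" "src C c = X'" "tgt C c = X" "src D d = Y" "tgt D d = Y'"
      "c' \<in> Mor C" "d' \<in> Mor D" "src C c' = X''" "tgt C c' = X'" "src D d' = Y'" "tgt D d' = Y''"
      "g \<in> Mor C" "src C g = X" "tgt C g = R0 Y"
    using 5 unfolding s by (simp_all add: hom1_def hom_right_def)
  then have "Y \<in> Ob D" "Y'' \<in> Ob D" by auto
  then show ?case
    using theta_comp[of c c' g d d' Y Y' Y''] t
    unfolding s by (simp add: hom_left_def hom_right_def Phi_def transposition_def)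
qed

lemma right_bi_adjoint_R: "right_bi_adjoint C D L R"
proof -
  have "\<exists>G \<eta> \<epsilon>. adjoint_equivalence (hom_cat C X (R0 Y)) (hom_cat D (ap0 L X) Y) (Phi (X, Y)) G \<eta> \<epsilon>"
    if "X \<in> Ob C" "Y \<in> Ob D" for X Y
    using adjoint_equivalence_if_fully_faithful[OF Phi_functor[OF that]] transposition_ff[OF that(2,1)]
      transposition_es[OF that(2,1)] by (simp add: Phi_def)
  then have "\<exists>G \<eta> \<epsilon>. p \<in> Ob C \<times> Ob D \<longrightarrow>
      adjoint_equivalence (hom_cat C (fst p) (R0 (snd p))) (hom_cat D (ap0 L (fst p)) (snd p)) (Phi p) G \<eta> \<epsilon>" for p
    by (cases p) auto
  then obtain \<Psi> \<eta> \<epsilon> where eq: "\<And>p. p \<in> Ob C \<times> Ob D \<Longrightarrow>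
      adjoint_equivalence (hom_cat C (fst p) (R0 (snd p))) (hom_cat D (ap0 L (fst p)) (snd p)) (Phi p) (\<Psi> p) (\<eta> p) (\<epsilon> p)"
    by metis
  have "bi_adjunction C D L R Phi theta \<Psi> \<eta> \<epsilon>"
    using eq by (intro bi_adjunction.intro bi_adjunction_axioms.intro L.normal_pseudo_functor_axioms
        normal_pseudo_functor_R pseudo_natural_Phi) force
  then show ?thesis unfolding right_bi_adjoint_def by blast
qed

end

section \<open>Bi-adjoints and bi-terminal objects of pseudo-slices\<close>

lemma right_bi_adjoint_if_universal_arrows:
  fixes C :: "('o, 'm, 'c) twocat" and D :: "('p, 'n, 'd) twocat" and L :: "('o, 'm, 'c, 'p, 'n, 'd) psfun"
  assumes L: "normal_pseudo_functor C D L" and pres: "preserves_tensors C D L walking_arrow"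
    and univ: "\<And>Y. Y \<in> Ob D \<Longrightarrow> \<exists>X \<epsilon>. normal_pseudo_functor.universal_arrow C D L Y X \<epsilon>"
  shows "\<exists>R. right_bi_adjoint C D L R"
proof -
  interpret L: normal_pseudo_functor C D L by (rule L)
  obtain R0 e where u: "\<And>Y. Y \<in> Ob D \<Longrightarrow> L.universal_arrow Y (R0 Y) (e Y)"
    using univ by metis
  have R0: "R0 Y \<in> Ob C" and e: "e Y \<in> hom1 D (ap0 L (R0 Y)) Y" if "Y \<in> Ob D" for Y
    using u[OF that] by (simp_all add: L.universal_arrow_def)
  \<comment> \<open>The last conjunct makes the choice trivial on identities; it can be met because \<open>L\<close> is normal.\<close>
  define ok where "ok d r s \<longleftrightarrow> r \<in> hom1 C (R0 (src D d)) (R0 (tgt D d))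
      \<and> s \<in> hom2 D (d \<odot>\<^bsub>D\<^esub> e (src D d)) (e (tgt D d) \<odot>\<^bsub>D\<^esub> ap1 L r) \<and> L.B.iso2 s
      \<and> (\<forall>Y \<in> Ob D. d = id1 D Y \<longrightarrow> r = id1 C (R0 Y) \<and> s = id2 D (e Y))" for d r s
  have "\<exists>r s. ok d r s" if d: "d \<in> Mor D" for d
  proof (cases "\<exists>Y \<in> Ob D. d = id1 D Y")
    case True
    then obtain Y where Y: "Y \<in> Ob D" "d = id1 D Y" by blast
    have id_eq: "Z = Y" if "Z \<in> Ob D" "id1 D Y = id1 D Z" for Z
      using that Y L.B.id1_type(2)[of Z] L.B.id1_type(2)[of Y] by simp
    have "ok d (id1 C (R0 Y)) (id2 D (e Y))"
      unfolding ok_def using Y R0 e[OF Y(1)] id_eq by (auto simp: hom1_def hom2_def)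
    then show ?thesis by blast
  next
    case False
    have Y: "src D d \<in> Ob D" "tgt D d \<in> Ob D" using d by simp_all
    have "d \<odot>\<^bsub>D\<^esub> e (src D d) \<in> hom1 D (ap0 L (R0 (src D d))) (tgt D d)"
      using d e[OF Y(1)] by (simp add: hom1_def)
    then obtain r s where r: "r \<in> hom1 C (R0 (src D d)) (R0 (tgt D d))"
        and s: "s \<in> hom2 D (e (tgt D d) \<odot>\<^bsub>D\<^esub> ap1 L r) (d \<odot>\<^bsub>D\<^esub> e (src D d))" "L.B.iso2 s"
      using u[OF Y(2)] R0[OF Y(1)] unfolding L.universal_arrow_def by blast
    have "ok d r (L.B.inv2 s)"
      unfolding ok_def using r s False by (auto simp: hom2_def)
    then show ?thesis by blast
  qed
  then obtain R1 \<sigma> where ok: "\<And>d. d \<in> Mor D \<Longrightarrow> ok d (R1 d) (\<sigma> d)" by metis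
  interpret universal_family C D L R0 e R1 \<sigma>
  proof (intro universal_family.intro universal_family_axioms.intro L R0 e, goal_cases)
    case (3 Y Z)
    then show ?case using L.fully_faithful_transposition[OF pres u] by blast
  next
    case (4 Y Z)
    then show ?case using L.essentially_surjective_transposition[OF u] by blast
  next
    case (5 d Y Y')
    then show ?case using ok[of d] by (auto simp: ok_def hom1_def[of D])
  next
    case (6 d Y Y')
    then show ?case using ok[of d] by (auto simp: ok_def hom1_def[of D])
  next
    case (7 d)
    then show ?case using ok[of d] by (simp add: ok_def)
  next
    case (8 Y)
    then show ?case using ok[of "id1 D Y"] L.B.id1_type(1)[of Y] unfolding ok_def by blast
  next
    case (9 Y)
    then show ?case using ok[of "id1 D Y"] L.B.id1_type(1)[of Y] unfolding ok_def by blast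
  qed
  show ?thesis using right_bi_adjoint_R by blast
qed

theorem theorem7p16:
  fixes C :: "('o, 'm, 'c) twocat" and D :: "('p, 'n, 'd) twocat"
    and L :: "('o, 'm, 'c, 'p, 'n, 'd) psfun"
  assumes "two_category C" and "two_category D"
    and "normal_pseudo_functor C D L"
    and "has_tensors C walking_arrow"
    and "preserves_tensors C D L walking_arrow"
  shows "(\<exists>R. right_bi_adjoint C D L R) \<longleftrightarrow>
    (\<forall>Y \<in> Ob D. \<exists>X \<in> Ob C. \<exists>\<epsilon> \<in> hom1 D (ap0 L X) Y.
       bi_terminal (pseudo_slice C D L Y) (X, \<epsilon>))"
proof -
  interpret L: normal_pseudo_functor C D L by (rule assms(3))
  have slice: "(\<exists>X \<in> Ob C. \<exists>\<epsilon> \<in> hom1 D (ap0 L X) Y. bi_terminal (pseudo_slice C D L Y) (X, \<epsilon>)) \<longleftrightarrow>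
      (\<exists>X \<epsilon>. L.universal_arrow Y X \<epsilon>)" for Y
    using L.bi_terminal_slice_iff by (auto simp: L.universal_arrow_def)
  show ?thesis
    unfolding slice
  proof
    assume "\<exists>R. right_bi_adjoint C D L R"
    then obtain R \<Phi> \<theta> \<Psi> \<eta> \<epsilon> where "bi_adjunction C D L R \<Phi> \<theta> \<Psi> \<eta> \<epsilon>"
      unfolding right_bi_adjoint_def by blast
    from bi_adjunction.universal_arrow_counit[OF this]
    show "\<forall>Y \<in> Ob D. \<exists>X \<epsilon>. L.universal_arrow Y X \<epsilon>" by blast
  next
    assume "\<forall>Y \<in> Ob D. \<exists>X \<epsilon>. L.universal_arrow Y X \<epsilon>"
    then show "\<exists>R. right_bi_adjoint C D L R"
      using right_bi_adjoint_if_universal_arrows[OF assms(3,5)] by blast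
  qed
qed

end
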